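(* Let $K$ be a field, let $Q$ be a finite quiver with $n$ vertices $\{v_1,\dots,v_n\}$ and let $D_1,\dots,D_m$ be the path connected components of $Q$. Let $KQ/C$ be the commuting algebra of $KQ$ and $\rho\colon KQ\to KQ/C$ the canonical surjection. Set $P=\bigoplus_{j=1}^m\rho(w_j)KQ/C$, where, for each $j=1,\dots,m$, $w_j$ is a vertex in $D_j$. Then the $K$-algebra $\mathrm{End}_{KQ/C}(P)$ is a basic algebra in the Morita class of $KQ/C$.
   Context: Paths in $Q$ include the paths of length zero (the vertices) and are composed from left to right: a path $p$ from $v$ to $w$ satisfies $vp=p=pw$ in $KQ$. Two paths are parallel if they have the same start vertex and the same end vertex. $C$ is the two-sided ideal of $KQ$ generated by all differences $p-q$ of parallel paths $p,q$ (of any lengths $\ge 0$); $KQ/C$ is the commuting algebra of $KQ$. On the vertex set of $Q$ define $v\sim w$ if there are paths from $v$ to $w$ and from $w$ to $v$; the equivalence classes are the path connected components of $Q$. $\rho(w_j)KQ/C$ denotes the right ideal of $KQ/C$ generated by the idempotent $\rho(w_j)$, so $P$ is a right $KQ/C$-module. A finite dimensional $K$-algebra is called basic if every simple right module over it is $1$-dimensional over $K$. Being in the Morita class of $KQ/C$ means being Morita equivalent to $KQ/C$ (equivalent categories of finitely generated right modules). *)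

theory Defs
  imports
    "HOL-Algebra.Module"
    "HOL-Algebra.QuotRing"
    "Graph_Theory.Digraph"
    "Graph_Theory.Arc_Walk"
    "Jordan_Normal_Form.Missing_VectorSpace"
begin

section \<open>Algebras over a field\<close>

text \<open>
  Algebras are unital, associative and not necessarily commutative (the locale \<open>algebra\<close> of
  HOL-Algebra is restricted to commutative ones), hence the separate definition. The zero
  algebra is allowed.
\<close>

definition is_algebra :: "('k, 'c) ring_scheme \<Rightarrow> ('k, 'a, 'd) module_scheme \<Rightarrow> bool" where
  "is_algebra K A \<longleftrightarrow> vectorspace K A \<and> ring A \<and>
     (\<forall>a\<in>carrier K. \<forall>x\<in>carrier A. \<forall>y\<in>carrier A.
        (a \<odot>\<^bsub>A\<^esub> x) \<otimes>\<^bsub>A\<^esub> y = a \<odot>\<^bsub>A\<^esub> (x \<otimes>\<^bsub>A\<^esub> y) \<and>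
        x \<otimes>\<^bsub>A\<^esub> (a \<odot>\<^bsub>A\<^esub> y) = a \<odot>\<^bsub>A\<^esub> (x \<otimes>\<^bsub>A\<^esub> y))"

definition quotient_algebra ::
  "('k, 'a, 'd) module_scheme \<Rightarrow> 'a set \<Rightarrow> ('k, 'a set) module" where
  "quotient_algebra A I = ring.extend (A Quot I)
     (module.fields (\<lambda>a X. \<Union>x\<in>X. I +>\<^bsub>A\<^esub> (a \<odot>\<^bsub>A\<^esub> x)))"


section \<open>Right modules\<close>

text \<open>
  As for the record \<open>module\<close> of HOL-Algebra, extending the record \<open>ring\<close> makes
  \<^term>\<open>abelian_group\<close> applicable; the fields \<open>mult\<close> and \<open>one\<close> of a module are irrelevant.
\<close>

record ('r, 'm) rmodule = "'m ring" +
  ract :: "'m \<Rightarrow> 'r \<Rightarrow> 'm" (infixl \<open>\<triangleleft>\<index>\<close> 70)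

locale right_module = B: ring B + M: abelian_group M
  for B :: "('r, 'c) ring_scheme" (structure) and M :: "('r, 'm) rmodule" +
  assumes ract_closed:
      "\<lbrakk> m \<in> carrier M; r \<in> carrier B \<rbrakk> \<Longrightarrow> m \<triangleleft>\<^bsub>M\<^esub> r \<in> carrier M"
    and ract_l_distr:
      "\<lbrakk> m \<in> carrier M; m' \<in> carrier M; r \<in> carrier B \<rbrakk>
        \<Longrightarrow> (m \<oplus>\<^bsub>M\<^esub> m') \<triangleleft>\<^bsub>M\<^esub> r = m \<triangleleft>\<^bsub>M\<^esub> r \<oplus>\<^bsub>M\<^esub> m' \<triangleleft>\<^bsub>M\<^esub> r"
    and ract_r_distr:
      "\<lbrakk> m \<in> carrier M; r \<in> carrier B; s \<in> carrier B \<rbrakk>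
        \<Longrightarrow> m \<triangleleft>\<^bsub>M\<^esub> (r \<oplus>\<^bsub>B\<^esub> s) = m \<triangleleft>\<^bsub>M\<^esub> r \<oplus>\<^bsub>M\<^esub> m \<triangleleft>\<^bsub>M\<^esub> s"
    and ract_assoc:
      "\<lbrakk> m \<in> carrier M; r \<in> carrier B; s \<in> carrier B \<rbrakk>
        \<Longrightarrow> m \<triangleleft>\<^bsub>M\<^esub> (r \<otimes>\<^bsub>B\<^esub> s) = (m \<triangleleft>\<^bsub>M\<^esub> r) \<triangleleft>\<^bsub>M\<^esub> s"
    and ract_one:
      "m \<in> carrier M \<Longrightarrow> m \<triangleleft>\<^bsub>M\<^esub> \<one>\<^bsub>B\<^esub> = m"

definition right_submodule ::
  "('r, 'c) ring_scheme \<Rightarrow> ('r, 'm) rmodule \<Rightarrow> 'm set \<Rightarrow> bool" where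
  "right_submodule B M N \<longleftrightarrow>
     additive_subgroup N M \<and> (\<forall>x\<in>N. \<forall>r\<in>carrier B. x \<triangleleft>\<^bsub>M\<^esub> r \<in> N)"

definition right_generated ::
  "('r, 'c) ring_scheme \<Rightarrow> ('r, 'm) rmodule \<Rightarrow> 'm set \<Rightarrow> 'm set" where
  "right_generated B M S = \<Inter>{N. right_submodule B M N \<and> S \<subseteq> N}"

definition finitely_generated :: "('r, 'c) ring_scheme \<Rightarrow> ('r, 'm) rmodule \<Rightarrow> bool" where
  "finitely_generated B M \<longleftrightarrow>
     (\<exists>S. finite S \<and> S \<subseteq> carrier M \<and> right_generated B M S = carrier M)"

definition simple_right_module :: "('r, 'c) ring_scheme \<Rightarrow> ('r, 'm) rmodule \<Rightarrow> bool" where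
  "simple_right_module B M \<longleftrightarrow> right_module B M \<and> carrier M \<noteq> {\<zero>\<^bsub>M\<^esub>} \<and>
     (\<forall>N. right_submodule B M N \<longrightarrow> N = {\<zero>\<^bsub>M\<^esub>} \<or> N = carrier M)"

text \<open>Homomorphisms are extensional, so that they are determined by their values on the carrier.\<close>

definition rmodule_hom ::
  "('r, 'c) ring_scheme \<Rightarrow> ('r, 'm) rmodule \<Rightarrow> ('r, 'n) rmodule \<Rightarrow> ('m \<Rightarrow> 'n) set" where
  "rmodule_hom B M N = {f \<in> carrier M \<rightarrow>\<^sub>E carrier N.
     (\<forall>x\<in>carrier M. \<forall>y\<in>carrier M. f (x \<oplus>\<^bsub>M\<^esub> y) = f x \<oplus>\<^bsub>N\<^esub> f y) \<and>
     (\<forall>x\<in>carrier M. \<forall>r\<in>carrier B. f (x \<triangleleft>\<^bsub>M\<^esub> r) = f x \<triangleleft>\<^bsub>N\<^esub> r)}"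

definition regular_rmodule :: "('a, 'c) ring_scheme \<Rightarrow> ('a, 'a) rmodule" where
  "regular_rmodule B = \<lparr>carrier = carrier B, mult = mult B, one = \<one>\<^bsub>B\<^esub>, zero = \<zero>\<^bsub>B\<^esub>,
     add = add B, ract = mult B\<rparr>"

definition right_ideal_rmodule :: "('a, 'c) ring_scheme \<Rightarrow> 'a \<Rightarrow> ('a, 'a) rmodule" where
  "right_ideal_rmodule B x = (regular_rmodule B)
     \<lparr>carrier := right_generated B (regular_rmodule B) {x}\<rparr>"

definition rmodule_direct_sum :: "'i set \<Rightarrow> ('i \<Rightarrow> ('r, 'm) rmodule) \<Rightarrow> ('r, 'i \<Rightarrow> 'm) rmodule" where
  "rmodule_direct_sum I M =
     \<lparr>carrier = {x \<in> \<Pi>\<^sub>E i\<in>I. carrier (M i). finite {i \<in> I. x i \<noteq> \<zero>\<^bsub>M i\<^esub>}},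
      mult = undefined, one = undefined,
      zero = (\<lambda>i\<in>I. \<zero>\<^bsub>M i\<^esub>),
      add = (\<lambda>x y. \<lambda>i\<in>I. x i \<oplus>\<^bsub>M i\<^esub> y i),
      ract = (\<lambda>x r. \<lambda>i\<in>I. x i \<triangleleft>\<^bsub>M i\<^esub> r)\<rparr>"

text \<open>
  A right module \<open>M\<close> over a \<open>K\<close>-algebra \<open>B\<close> is a \<open>K\<close>-vector space via \<open>a \<cdot> m = m (a 1\<^sub>B)\<close>;
  this also gives the \<open>K\<close>-algebra structure on \<open>End\<^sub>B(M)\<close>, whose product is composition
  \<open>(f g)(x) = f (g x)\<close>.
\<close>

definition underlying_space ::
  "('k, 'b, 'd) module_scheme \<Rightarrow> ('b, 'm) rmodule \<Rightarrow> ('k, 'm) module" where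
  "underlying_space B M = \<lparr>carrier = carrier M, mult = mult M, one = \<one>\<^bsub>M\<^esub>, zero = \<zero>\<^bsub>M\<^esub>,
     add = add M, smult = (\<lambda>a m. m \<triangleleft>\<^bsub>M\<^esub> (a \<odot>\<^bsub>B\<^esub> \<one>\<^bsub>B\<^esub>))\<rparr>"

definition End_algebra ::
  "('k, 'b, 'd) module_scheme \<Rightarrow> ('b, 'm) rmodule \<Rightarrow> ('k, 'm \<Rightarrow> 'm) module" where
  "End_algebra B M =
     \<lparr>carrier = rmodule_hom B M M,
      mult = (\<lambda>f g. compose (carrier M) f g),
      one = (\<lambda>x\<in>carrier M. x),
      zero = (\<lambda>x\<in>carrier M. \<zero>\<^bsub>M\<^esub>),
      add = (\<lambda>f g. \<lambda>x\<in>carrier M. f x \<oplus>\<^bsub>M\<^esub> g x),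
      smult = (\<lambda>a f. \<lambda>x\<in>carrier M. f x \<triangleleft>\<^bsub>M\<^esub> (a \<odot>\<^bsub>B\<^esub> \<one>\<^bsub>B\<^esub>))\<rparr>"


section \<open>Basic algebras\<close>

text \<open>
  The type argument is the type in which the carriers of the simple modules live. A theorem
  about \<open>basic_algebra TYPE('u)\<close> with \<open>'u\<close> a type variable speaks about all simple modules.
\<close>

definition basic_algebra ::
  "'u itself \<Rightarrow> ('k, 'c) ring_scheme \<Rightarrow> ('k, 'b, 'd) module_scheme \<Rightarrow> bool" where
  "basic_algebra T K B \<longleftrightarrow> is_algebra K B \<and> vectorspace.fin_dim K B \<and>
     (\<forall>M :: ('b, 'u) rmodule. simple_right_module B M \<longrightarrow>
        vectorspace.fin_dim K (underlying_space B M) \<and>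
        vectorspace.dim K (underlying_space B M) = 1)"


section \<open>Categories and Morita equivalence\<close>

text \<open>\<open>Comp C X Y Z g f\<close> is the composite of \<open>f : X \<rightarrow> Y\<close> followed by \<open>g : Y \<rightarrow> Z\<close>.\<close>

record ('o, 'a) cat =
  Obj :: "'o set"
  Hom :: "'o \<Rightarrow> 'o \<Rightarrow> 'a set"
  Ident :: "'o \<Rightarrow> 'a"
  Comp :: "'o \<Rightarrow> 'o \<Rightarrow> 'o \<Rightarrow> 'a \<Rightarrow> 'a \<Rightarrow> 'a"

definition is_category :: "('o, 'a) cat \<Rightarrow> bool" where
  "is_category C \<longleftrightarrow>
     (\<forall>X\<in>Obj C. Ident C X \<in> Hom C X X) \<and>
     (\<forall>X\<in>Obj C. \<forall>Y\<in>Obj C. \<forall>Z\<in>Obj C. \<forall>f\<in>Hom C X Y. \<forall>g\<in>Hom C Y Z.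
        Comp C X Y Z g f \<in> Hom C X Z) \<and>
     (\<forall>X\<in>Obj C. \<forall>Y\<in>Obj C. \<forall>f\<in>Hom C X Y.
        Comp C X X Y f (Ident C X) = f \<and> Comp C X Y Y (Ident C Y) f = f) \<and>
     (\<forall>W\<in>Obj C. \<forall>X\<in>Obj C. \<forall>Y\<in>Obj C. \<forall>Z\<in>Obj C.
        \<forall>f\<in>Hom C W X. \<forall>g\<in>Hom C X Y. \<forall>h\<in>Hom C Y Z.
        Comp C W Y Z h (Comp C W X Y g f) = Comp C W X Z (Comp C X Y Z h g) f)"

definition is_functor ::
  "('o, 'a) cat \<Rightarrow> ('p, 'b) cat \<Rightarrow> ('o \<Rightarrow> 'p) \<Rightarrow> ('o \<Rightarrow> 'o \<Rightarrow> 'a \<Rightarrow> 'b) \<Rightarrow> bool" where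
  "is_functor C D Fo Fa \<longleftrightarrow>
     (\<forall>X\<in>Obj C. Fo X \<in> Obj D) \<and>
     (\<forall>X\<in>Obj C. \<forall>Y\<in>Obj C. \<forall>f\<in>Hom C X Y. Fa X Y f \<in> Hom D (Fo X) (Fo Y)) \<and>
     (\<forall>X\<in>Obj C. Fa X X (Ident C X) = Ident D (Fo X)) \<and>
     (\<forall>X\<in>Obj C. \<forall>Y\<in>Obj C. \<forall>Z\<in>Obj C. \<forall>f\<in>Hom C X Y. \<forall>g\<in>Hom C Y Z.
        Fa X Z (Comp C X Y Z g f) = Comp D (Fo X) (Fo Y) (Fo Z) (Fa Y Z g) (Fa X Y f))"

definition is_iso :: "('o, 'a) cat \<Rightarrow> 'o \<Rightarrow> 'o \<Rightarrow> 'a \<Rightarrow> bool" where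
  "is_iso C X Y f \<longleftrightarrow> f \<in> Hom C X Y \<and>
     (\<exists>g\<in>Hom C Y X. Comp C X Y X g f = Ident C X \<and> Comp C Y X Y f g = Ident C Y)"

definition natural_iso ::
  "('o, 'a) cat \<Rightarrow> ('p, 'b) cat \<Rightarrow> ('o \<Rightarrow> 'p) \<Rightarrow> ('o \<Rightarrow> 'o \<Rightarrow> 'a \<Rightarrow> 'b)
    \<Rightarrow> ('o \<Rightarrow> 'p) \<Rightarrow> ('o \<Rightarrow> 'o \<Rightarrow> 'a \<Rightarrow> 'b) \<Rightarrow> ('o \<Rightarrow> 'b) \<Rightarrow> bool" where
  "natural_iso C D Fo Fa Go Ga \<eta> \<longleftrightarrow>
     (\<forall>X\<in>Obj C. is_iso D (Fo X) (Go X) (\<eta> X)) \<and>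
     (\<forall>X\<in>Obj C. \<forall>Y\<in>Obj C. \<forall>f\<in>Hom C X Y.
        Comp D (Fo X) (Fo Y) (Go Y) (\<eta> Y) (Fa X Y f) =
        Comp D (Fo X) (Go X) (Go Y) (Ga X Y f) (\<eta> X))"

definition equivalent_categories :: "('o, 'a) cat \<Rightarrow> ('p, 'b) cat \<Rightarrow> bool" where
  "equivalent_categories C D \<longleftrightarrow> is_category C \<and> is_category D \<and>
     (\<exists>Fo Fa Go Ga \<eta> \<epsilon>. is_functor C D Fo Fa \<and> is_functor D C Go Ga \<and>
        natural_iso C C (\<lambda>X. Go (Fo X)) (\<lambda>X Y f. Ga (Fo X) (Fo Y) (Fa X Y f))
          (\<lambda>X. X) (\<lambda>X Y f. f) \<eta> \<and>
        natural_iso D D (\<lambda>X. Fo (Go X)) (\<lambda>X Y f. Fa (Go X) (Go Y) (Ga X Y f))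
          (\<lambda>X. X) (\<lambda>X Y f. f) \<epsilon>)"

text \<open>
  The carriers of the objects have to live in a fixed type. Every finitely generated right
  \<open>B\<close>-module is isomorphic to some \<open>B\<^sup>n / N\<close>, whose elements are sets of functions
  \<open>nat \<Rightarrow> 'b\<close>, so with the type \<open>(nat \<Rightarrow> 'b) set\<close> nothing is lost up to isomorphism, i.e. up
  to equivalence of categories.
\<close>

definition fg_right_modules ::
  "('b, 'd) ring_scheme \<Rightarrow>
    (('b, (nat \<Rightarrow> 'b) set) rmodule, (nat \<Rightarrow> 'b) set \<Rightarrow> (nat \<Rightarrow> 'b) set) cat" where
  "fg_right_modules B =
     \<lparr>Obj = {M. right_module B M \<and> finitely_generated B M},
      Hom = rmodule_hom B,
      Ident = (\<lambda>M. \<lambda>x\<in>carrier M. x),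
      Comp = (\<lambda>L M N g f. compose (carrier L) g f)\<rparr>"

definition morita_equivalent ::
  "('k, 'c) ring_scheme \<Rightarrow> ('k, 'a, 'd) module_scheme \<Rightarrow> ('k, 'b, 'e) module_scheme \<Rightarrow> bool" where
  "morita_equivalent K A B \<longleftrightarrow> is_algebra K A \<and> is_algebra K B \<and>
     equivalent_categories (fg_right_modules A) (fg_right_modules B)"


section \<open>The commuting algebra of a quiver\<close>

text \<open>
  A finite quiver is a \<^term>\<open>fin_digraph\<close> (loops and multiple arrows allowed). A path is given
  by its start vertex, its list of arrows (empty for the paths of length zero) and its end vertex.
\<close>

type_synonym ('v, 'e) qpath = "'v \<times> 'e list \<times> 'v"

definition qpaths :: "('v, 'e) pre_digraph \<Rightarrow> ('v, 'e) qpath set" where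
  "qpaths Q = {(v, p, w). pre_digraph.awalk Q v p w}"

definition is_concat :: "('v, 'e) qpath \<Rightarrow> ('v, 'e) qpath \<Rightarrow> ('v, 'e) qpath \<Rightarrow> bool" where
  "is_concat p q r \<longleftrightarrow> (case (p, q) of ((u, as, v), (v', bs, w)) \<Rightarrow>
     v = v' \<and> r = (u, as @ bs, w))"

definition path_elem :: "('k, 'c) ring_scheme \<Rightarrow> ('v, 'e) qpath \<Rightarrow> ('v, 'e) qpath \<Rightarrow> 'k" where
  "path_elem K p = (\<lambda>q. if q = p then \<one>\<^bsub>K\<^esub> else \<zero>\<^bsub>K\<^esub>)"

text \<open>
  Elements are the families of coefficients of finite linear combinations of paths. Each path has
  only finitely many factorizations, so the sum defining the product is finite.
\<close>

definition path_algebra ::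
  "('k, 'c) ring_scheme \<Rightarrow> ('v, 'e) pre_digraph \<Rightarrow> ('k, ('v, 'e) qpath \<Rightarrow> 'k) module" where
  "path_algebra K Q =
     \<lparr>carrier = {f. range f \<subseteq> carrier K \<and> finite {p. f p \<noteq> \<zero>\<^bsub>K\<^esub>} \<and>
                  {p. f p \<noteq> \<zero>\<^bsub>K\<^esub>} \<subseteq> qpaths Q},
      mult = (\<lambda>f g r. \<Oplus>\<^bsub>K\<^esub>s \<in> {(p, q). p \<in> qpaths Q \<and> q \<in> qpaths Q \<and> is_concat p q r}.
                f (fst s) \<otimes>\<^bsub>K\<^esub> g (snd s)),
      one = (\<lambda>r. if r \<in> {(v, [], v) | v. v \<in> verts Q} then \<one>\<^bsub>K\<^esub> else \<zero>\<^bsub>K\<^esub>),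
      zero = (\<lambda>r. \<zero>\<^bsub>K\<^esub>),
      add = (\<lambda>f g r. f r \<oplus>\<^bsub>K\<^esub> g r),
      smult = (\<lambda>a f r. a \<otimes>\<^bsub>K\<^esub> f r)\<rparr>"

definition parallel :: "('v, 'e) qpath \<Rightarrow> ('v, 'e) qpath \<Rightarrow> bool" where
  "parallel p q \<longleftrightarrow> fst p = fst q \<and> snd (snd p) = snd (snd q)"

definition commuting_ideal ::
  "('k, 'c) ring_scheme \<Rightarrow> ('v, 'e) pre_digraph \<Rightarrow> (('v, 'e) qpath \<Rightarrow> 'k) set" where
  "commuting_ideal K Q = Idl\<^bsub>path_algebra K Q\<^esub>
     {path_elem K p \<ominus>\<^bsub>path_algebra K Q\<^esub> path_elem K q | p q.
        p \<in> qpaths Q \<and> q \<in> qpaths Q \<and> parallel p q}"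

definition commuting_algebra ::
  "('k, 'c) ring_scheme \<Rightarrow> ('v, 'e) pre_digraph \<Rightarrow> ('k, (('v, 'e) qpath \<Rightarrow> 'k) set) module" where
  "commuting_algebra K Q = quotient_algebra (path_algebra K Q) (commuting_ideal K Q)"

definition commuting_proj ::
  "('k, 'c) ring_scheme \<Rightarrow> ('v, 'e) pre_digraph \<Rightarrow> (('v, 'e) qpath \<Rightarrow> 'k)
    \<Rightarrow> (('v, 'e) qpath \<Rightarrow> 'k) set" where
  "commuting_proj K Q x = commuting_ideal K Q +>\<^bsub>path_algebra K Q\<^esub> x"

definition vertex_elem :: "('k, 'c) ring_scheme \<Rightarrow> 'v \<Rightarrow> ('v, 'e) qpath \<Rightarrow> 'k" where
  "vertex_elem K v = path_elem K (v, [], v)"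

definition path_connected_components :: "('v, 'e) pre_digraph \<Rightarrow> 'v set set" where
  "path_connected_components Q = verts Q //
     {(v, w). (\<exists>p. pre_digraph.awalk Q v p w) \<and> (\<exists>p. pre_digraph.awalk Q w p v)}"

end

theory Submission
  imports Defs
begin

text \<open>
  Write \<open>A = KQ/C\<close>. All paths from \<open>u\<close> to \<open>v\<close> become equal in \<open>A\<close>, so there is one element
  \<open>E u v\<close> of \<open>A\<close> for each pair with \<open>v\<close> reachable from \<open>u\<close>. These elements span \<open>A\<close> and multiply
  like matrix units: \<open>E u v E v w = E u w\<close>, all other products are \<open>0\<close>, and the sum of all
  \<open>E v v\<close> is \<open>1\<close>. The locale \<open>incidence_units\<close> axiomatizes this situation, for an arbitrary
  preorder on a finite set; \<open>commuting_algebra_incidence_units\<close> says that \<open>A\<close> is an instance.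
  Let \<open>e\<close> be the sum of the idempotents \<open>E w w\<close> over the chosen representatives \<open>w\<close>.

  The module \<open>P\<close> is isomorphic to \<open>eA\<close> by adding up the components, and therefore its
  endomorphism algebra is isomorphic to \<open>eAe\<close> (\<open>orthogonal_idempotents_dual_basis\<close>,
  \<open>End_to_corner_bij\<close>, \<open>End_to_corner_algebra\<close>).

  Morita equivalence: a vertex \<open>v\<close> and the representative \<open>w\<close> of its component are joined by paths
  in both directions, so \<open>E v v = E v w E w v\<close>, and summing over \<open>v\<close> gives \<open>1 = \<Sum> a\<^sub>v b\<^sub>v\<close> with
  \<open>a\<^sub>v \<in> Ae\<close> and \<open>b\<^sub>v \<in> eA\<close>. Hence \<open>e\<close> is a full idempotent, and \<open>M \<mapsto> Me\<close> is an equivalence from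
  the right modules over \<open>A\<close> to those over \<open>eAe\<close> (\<open>corner_equivalence\<close>). A homomorphism \<open>g\<close> from
  \<open>Me\<close> to \<open>Ne\<close> extends uniquely to \<open>M\<close>, by \<open>m \<mapsto> \<Sum> g(m a\<^sub>v) b\<^sub>v\<close>, so the functor is fully
  faithful; an \<open>eAe\<close>-module \<open>N\<close> is isomorphic to \<open>Me\<close> for the coinduced module
  \<open>M = Hom(Ae, N)\<close>, so it is essentially surjective. Both constructions preserve finite
  generation, again because \<open>1 = \<Sum> a\<^sub>v b\<^sub>v\<close>. As the objects of the module categories have carriers
  in one fixed type, \<open>Me\<close> and \<open>Hom(Ae, N)\<close> have to be replaced by copies in that type
  (\<open>finitely_generated_copy\<close>).

  Basicness: \<open>eAe\<close> is spanned by the \<open>E w w'\<close> for representatives \<open>w\<close>, \<open>w'\<close>, and on these the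
  preorder is antisymmetric. Given a simple module, choose a representative \<open>w\<close> that is maximal
  among those for which \<open>E w w\<close> does not annihilate the module, and a nonzero \<open>x\<close> with
  \<open>x E w w = x\<close>. Then all matrix units other than \<open>E w w\<close> annihilate \<open>x\<close>, so \<open>K x\<close> is a submodule
  and hence everything (\<open>antisym_basic\<close>).
\<close>

section \<open>Equivalences of categories\<close>

lemma is_categoryD:
  assumes "is_category C"
  shows "\<And>X. X \<in> Obj C \<Longrightarrow> Ident C X \<in> Hom C X X"
    and "\<And>X Y Z f g. \<lbrakk>X \<in> Obj C; Y \<in> Obj C; Z \<in> Obj C; f \<in> Hom C X Y; g \<in> Hom C Y Z\<rbrakk>
           \<Longrightarrow> Comp C X Y Z g f \<in> Hom C X Z"
    and "\<And>X Y f. \<lbrakk>X \<in> Obj C; Y \<in> Obj C; f \<in> Hom C X Y\<rbrakk> \<Longrightarrow> Comp C X X Y f (Ident C X) = f"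
    and "\<And>X Y f. \<lbrakk>X \<in> Obj C; Y \<in> Obj C; f \<in> Hom C X Y\<rbrakk> \<Longrightarrow> Comp C X Y Y (Ident C Y) f = f"
    and "\<And>W X Y Z f g h. \<lbrakk>W \<in> Obj C; X \<in> Obj C; Y \<in> Obj C; Z \<in> Obj C;
            f \<in> Hom C W X; g \<in> Hom C X Y; h \<in> Hom C Y Z\<rbrakk>
           \<Longrightarrow> Comp C W Y Z h (Comp C W X Y g f) = Comp C W X Z (Comp C X Y Z h g) f"
  using assms unfolding is_category_def by simp_all

lemma is_functorD:
  assumes "is_functor C D Fo Fa"
  shows "\<And>X. X \<in> Obj C \<Longrightarrow> Fo X \<in> Obj D"
    and "\<And>X Y f. \<lbrakk>X \<in> Obj C; Y \<in> Obj C; f \<in> Hom C X Y\<rbrakk> \<Longrightarrow> Fa X Y f \<in> Hom D (Fo X) (Fo Y)"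
    and "\<And>X. X \<in> Obj C \<Longrightarrow> Fa X X (Ident C X) = Ident D (Fo X)"
    and "\<And>X Y Z f g. \<lbrakk>X \<in> Obj C; Y \<in> Obj C; Z \<in> Obj C; f \<in> Hom C X Y; g \<in> Hom C Y Z\<rbrakk>
           \<Longrightarrow> Fa X Z (Comp C X Y Z g f)
             = Comp D (Fo X) (Fo Y) (Fo Z) (Fa Y Z g) (Fa X Y f)"
  using assms unfolding is_functor_def by simp_all

text \<open>
  By fullness an inverse of the image is itself an image; by faithfulness its preimage is an inverse.
\<close>

lemma fully_faithful_reflects_iso:
  assumes C: "is_category C" and F: "is_functor C D Fo Fa"
    and ff: "\<And>X Y. \<lbrakk>X \<in> Obj C; Y \<in> Obj C\<rbrakk>
      \<Longrightarrow> bij_betw (Fa X Y) (Hom C X Y) (Hom D (Fo X) (Fo Y))"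
    and X: "X \<in> Obj C" and Y: "Y \<in> Obj C" and f: "f \<in> Hom C X Y"
    and iso: "is_iso D (Fo X) (Fo Y) (Fa X Y f)"
  shows "is_iso C X Y f"
proof -
  obtain g' where g': "g' \<in> Hom D (Fo Y) (Fo X)"
      "Comp D (Fo X) (Fo Y) (Fo X) g' (Fa X Y f) = Ident D (Fo X)"
      "Comp D (Fo Y) (Fo X) (Fo Y) (Fa X Y f) g' = Ident D (Fo Y)"
    using iso unfolding is_iso_def by blast
  obtain g where g: "g \<in> Hom C Y X" "Fa Y X g = g'"
    using ff[OF Y X] g'(1) unfolding bij_betw_def by (metis imageE)
  have inj: "h = k" if "Z \<in> Obj C" "h \<in> Hom C Z Z" "k \<in> Hom C Z Z" "Fa Z Z h = Fa Z Z k" for Z h k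
    using ff[of Z Z] that by (auto simp: bij_betw_def inj_on_def)
  have "Comp C X Y X g f = Ident C X"
    by (rule inj[OF X]) (use X Y f g g' is_categoryD[OF C] is_functorD[OF F] in auto)
  moreover have "Comp C Y X Y f g = Ident C Y"
    by (rule inj[OF Y]) (use X Y f g g' is_categoryD[OF C] is_functorD[OF F] in auto)
  ultimately show ?thesis
    unfolding is_iso_def using f g by blast
qed

text \<open>
  The quasi-inverse sends \<open>Z\<close> to a chosen \<open>X\<close> with an isomorphism \<open>\<epsilon> : F X \<rightarrow> Z\<close>, and a morphism to
  the preimage under \<open>F\<close> of its conjugate by these isomorphisms. Identities between morphisms of the
  first category are checked after applying the faithful functor \<open>F\<close>.
\<close>

lemma equivalent_categories_fully_faithful:
  assumes C: "is_category C" and D: "is_category D" and F: "is_functor C D Fo Fa"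
    and ff: "\<And>X Y. \<lbrakk>X \<in> Obj C; Y \<in> Obj C\<rbrakk>
      \<Longrightarrow> bij_betw (Fa X Y) (Hom C X Y) (Hom D (Fo X) (Fo Y))"
    and es: "\<And>Z. Z \<in> Obj D \<Longrightarrow> \<exists>X\<in>Obj C. \<exists>f. is_iso D (Fo X) Z f"
  shows "equivalent_categories C D"
proof -
  note C' = is_categoryD[OF C] and D' = is_categoryD[OF D] and F' = is_functorD[OF F]
  have "\<forall>Z\<in>Obj D. \<exists>X f g. X \<in> Obj C \<and> f \<in> Hom D (Fo X) Z \<and> g \<in> Hom D Z (Fo X) \<and>
      Comp D (Fo X) Z (Fo X) g f = Ident D (Fo X) \<and> Comp D Z (Fo X) Z f g = Ident D Z"
    using es unfolding is_iso_def by blast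
  then obtain Go \<epsilon> \<delta> where G: "\<And>Z. Z \<in> Obj D \<Longrightarrow> Go Z \<in> Obj C"
      "\<And>Z. Z \<in> Obj D \<Longrightarrow> \<epsilon> Z \<in> Hom D (Fo (Go Z)) Z"
      "\<And>Z. Z \<in> Obj D \<Longrightarrow> \<delta> Z \<in> Hom D Z (Fo (Go Z))"
      "\<And>Z. Z \<in> Obj D \<Longrightarrow> Comp D (Fo (Go Z)) Z (Fo (Go Z)) (\<delta> Z) (\<epsilon> Z) = Ident D (Fo (Go Z))"
      "\<And>Z. Z \<in> Obj D \<Longrightarrow> Comp D Z (Fo (Go Z)) Z (\<epsilon> Z) (\<delta> Z) = Ident D Z"
    by metis
  have FG: "\<And>Z. Z \<in> Obj D \<Longrightarrow> Fo (Go Z) \<in> Obj D"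
    using F' G by blast
  define lift where "lift X Y = inv_into (Hom C X Y) (Fa X Y)" for X Y
  have lift: "lift X Y g \<in> Hom C X Y" "Fa X Y (lift X Y g) = g"
    if "X \<in> Obj C" "Y \<in> Obj C" "g \<in> Hom D (Fo X) (Fo Y)" for X Y g
    using ff[OF that(1,2)] that(3)
    by (auto simp: lift_def bij_betw_def inv_into_into f_inv_into_f)
  have inj: "h = k" if "X \<in> Obj C" "Y \<in> Obj C" "h \<in> Hom C X Y" "k \<in> Hom C X Y"
      "Fa X Y h = Fa X Y k" for X Y h k
    using ff[of X Y] that by (auto simp: bij_betw_def inj_on_def)
  define t where "t Z Z' g = Comp D (Fo (Go Z)) Z' (Fo (Go Z')) (\<delta> Z') (Comp D (Fo (Go Z)) Z Z' g (\<epsilon> Z))"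
    for Z Z' g
  define Ga where "Ga Z Z' g = lift (Go Z) (Go Z') (t Z Z' g)" for Z Z' g
  have t: "t Z Z' g \<in> Hom D (Fo (Go Z)) (Fo (Go Z'))"
    if "Z \<in> Obj D" "Z' \<in> Obj D" "g \<in> Hom D Z Z'" for Z Z' g
    unfolding t_def by (intro D'(2)) (use that G FG in auto)
  have Ga: "Ga Z Z' g \<in> Hom C (Go Z) (Go Z')" "Fa (Go Z) (Go Z') (Ga Z Z' g) = t Z Z' g"
    if "Z \<in> Obj D" "Z' \<in> Obj D" "g \<in> Hom D Z Z'" for Z Z' g
    unfolding Ga_def using lift[OF G(1) G(1) t] that by auto
  \<comment> \<open>this says that \<open>\<epsilon>\<close> is natural; it determines \<open>t\<close> because \<open>\<epsilon>\<close> can be cancelled\<close>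
  have t_nat: "Comp D (Fo (Go Z)) (Fo (Go Z')) Z' (\<epsilon> Z') (t Z Z' g) = Comp D (Fo (Go Z)) Z Z' g (\<epsilon> Z)"
    if "Z \<in> Obj D" "Z' \<in> Obj D" "g \<in> Hom D Z Z'" for Z Z' g
  proof -
    have h: "Comp D (Fo (Go Z)) Z Z' g (\<epsilon> Z) \<in> Hom D (Fo (Go Z)) Z'"
      by (rule D'(2)) (use that G FG in auto)
    have "Comp D (Fo (Go Z)) (Fo (Go Z')) Z' (\<epsilon> Z') (t Z Z' g)
        = Comp D (Fo (Go Z)) Z' Z' (Comp D Z' (Fo (Go Z')) Z' (\<epsilon> Z') (\<delta> Z'))
             (Comp D (Fo (Go Z)) Z Z' g (\<epsilon> Z))"
      unfolding t_def by (rule D'(5)) (use that G FG h in auto)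
    then show ?thesis
      using G(5)[of Z'] that D'(4)[OF FG[of Z] _ h] by simp
  qed
  have cancel: "h = k" if "Z \<in> Obj D" "W \<in> Obj D" "h \<in> Hom D W (Fo (Go Z))" "k \<in> Hom D W (Fo (Go Z))"
      "Comp D W (Fo (Go Z)) Z (\<epsilon> Z) h = Comp D W (Fo (Go Z)) Z (\<epsilon> Z) k" for Z W h k
  proof -
    have "l = Comp D W Z (Fo (Go Z)) (\<delta> Z) (Comp D W (Fo (Go Z)) Z (\<epsilon> Z) l)"
      if "l \<in> Hom D W (Fo (Go Z))" for l
      using D'(5)[of W "Fo (Go Z)" Z "Fo (Go Z)" l "\<epsilon> Z" "\<delta> Z"] D'(4)[of W "Fo (Go Z)" l]
        G FG that \<open>Z \<in> Obj D\<close> \<open>W \<in> Obj D\<close> by simp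
    then show ?thesis using that by metis
  qed
  have functor_G: "is_functor D C Go Ga"
    unfolding is_functor_def
  proof (intro conjI ballI)
    fix Z assume Z: "Z \<in> Obj D"
    show "Go Z \<in> Obj C" using G Z by blast
    have "t Z Z (Ident D Z) = Ident D (Fo (Go Z))"
      unfolding t_def using D'(4)[of "Fo (Go Z)" Z "\<epsilon> Z"] FG G Z by simp
    then show "Ga Z Z (Ident D Z) = Ident C (Go Z)"
      by (intro inj[of "Go Z" "Go Z"]) (use Z G C' D' Ga F' in auto)
  next
    fix Z Z' f assume "Z \<in> Obj D" "Z' \<in> Obj D" "f \<in> Hom D Z Z'"
    then show "Ga Z Z' f \<in> Hom C (Go Z) (Go Z')" by (rule Ga(1))
  next
    fix X Y Z f g assume X: "X \<in> Obj D" and Y: "Y \<in> Obj D" and Z: "Z \<in> Obj D"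
      and f: "f \<in> Hom D X Y" and g: "g \<in> Hom D Y Z"
    let ?X = "Fo (Go X)" and ?Y = "Fo (Go Y)" and ?Z = "Fo (Go Z)"
    have gf: "Comp D X Y Z g f \<in> Hom D X Z" using D'(2) X Y Z f g by blast
    have "Comp D ?X ?Z Z (\<epsilon> Z) (t X Z (Comp D X Y Z g f)) = Comp D ?X X Z (Comp D X Y Z g f) (\<epsilon> X)"
      by (rule t_nat[OF X Z gf])
    also have "\<dots> = Comp D ?X Y Z g (Comp D ?X X Y f (\<epsilon> X))"
      using D'(5)[of ?X X Y Z] X Y Z f g G FG by simp
    also have "\<dots> = Comp D ?X Y Z g (Comp D ?X ?Y Y (\<epsilon> Y) (t X Y f))"
      using t_nat X Y f by simp
    also have "\<dots> = Comp D ?X ?Y Z (Comp D ?Y Y Z g (\<epsilon> Y)) (t X Y f)"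
      using D'(5)[of ?X ?Y Y Z] X Y Z t f g G FG by simp
    also have "\<dots> = Comp D ?X ?Y Z (Comp D ?Y ?Z Z (\<epsilon> Z) (t Y Z g)) (t X Y f)"
      using t_nat Y Z g by simp
    also have "\<dots> = Comp D ?X ?Z Z (\<epsilon> Z) (Comp D ?X ?Y ?Z (t Y Z g) (t X Y f))"
      using D'(5)[of ?X ?Y ?Z Z] X Y Z t f g G FG by simp
    finally have "t X Z (Comp D X Y Z g f) = Comp D ?X ?Y ?Z (t Y Z g) (t X Y f)"
      by (rule cancel[rotated -1]) (use X Y Z t f g gf FG D' in auto)
    then show "Ga X Z (Comp D X Y Z g f) = Comp C (Go X) (Go Y) (Go Z) (Ga Y Z g) (Ga X Y f)"
      by (intro inj[of "Go X" "Go Z"]) (use X Y Z f g gf G Ga C' F' in auto)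
  qed
  have nat_\<epsilon>: "natural_iso D D (\<lambda>X. Fo (Go X)) (\<lambda>X Y f. Fa (Go X) (Go Y) (Ga X Y f))
      (\<lambda>X. X) (\<lambda>X Y f. f) \<epsilon>"
    unfolding natural_iso_def
  proof (intro conjI ballI)
    fix X assume "X \<in> Obj D"
    then show "is_iso D (Fo (Go X)) X (\<epsilon> X)" unfolding is_iso_def using G by blast
  next
    fix X Y f assume "X \<in> Obj D" "Y \<in> Obj D" "f \<in> Hom D X Y"
    then show "Comp D (Fo (Go X)) (Fo (Go Y)) Y (\<epsilon> Y) (Fa (Go X) (Go Y) (Ga X Y f)) =
        Comp D (Fo (Go X)) X Y f (\<epsilon> X)"
      using t_nat Ga by simp
  qed
  define \<eta> where "\<eta> X = lift (Go (Fo X)) X (\<epsilon> (Fo X))" for X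
  have \<eta>: "\<eta> X \<in> Hom C (Go (Fo X)) X" "Fa (Go (Fo X)) X (\<eta> X) = \<epsilon> (Fo X)" if "X \<in> Obj C" for X
    unfolding \<eta>_def using lift[OF G(1) that G(2)] F'(1)[OF that] by auto
  have nat_\<eta>: "natural_iso C C (\<lambda>X. Go (Fo X)) (\<lambda>X Y f. Ga (Fo X) (Fo Y) (Fa X Y f))
      (\<lambda>X. X) (\<lambda>X Y f. f) \<eta>"
    unfolding natural_iso_def
  proof (intro conjI ballI)
    fix X assume X: "X \<in> Obj C"
    have "is_iso D (Fo (Go (Fo X))) (Fo X) (\<epsilon> (Fo X))"
      unfolding is_iso_def using G F' X by blast
    then show "is_iso C (Go (Fo X)) X (\<eta> X)"
      using fully_faithful_reflects_iso[OF C F ff, of "Go (Fo X)" X "\<eta> X"] X \<eta> G F' by auto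
  next
    fix X Y f assume X: "X \<in> Obj C" and Y: "Y \<in> Obj C" and f: "f \<in> Hom C X Y"
    show "Comp C (Go (Fo X)) (Go (Fo Y)) Y (\<eta> Y) (Ga (Fo X) (Fo Y) (Fa X Y f)) =
        Comp C (Go (Fo X)) X Y f (\<eta> X)"
      by (rule inj[of "Go (Fo X)" Y]) (use X Y f G F' \<eta> Ga t_nat C' in auto)
  qed
  show ?thesis
    unfolding equivalent_categories_def
    using C D F functor_G nat_\<epsilon> nat_\<eta> by blast
qed

section \<open>Right modules\<close>

context right_module begin

lemma ract_l_null: "r \<in> carrier B \<Longrightarrow> \<zero>\<^bsub>M\<^esub> \<triangleleft>\<^bsub>M\<^esub> r = \<zero>\<^bsub>M\<^esub>"
  using ract_l_distr[of "\<zero>\<^bsub>M\<^esub>" "\<zero>\<^bsub>M\<^esub>" r] ract_closed[of "\<zero>\<^bsub>M\<^esub>" r]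
  by (metis M.add.r_cancel_one' M.l_zero M.zero_closed)

lemma ract_r_null: "m \<in> carrier M \<Longrightarrow> m \<triangleleft>\<^bsub>M\<^esub> \<zero> = \<zero>\<^bsub>M\<^esub>"
  using ract_r_distr[of m \<zero> \<zero>] ract_closed[of m \<zero>]
  by (metis M.add.r_cancel_one' B.l_zero B.zero_closed)

lemma ract_r_minus: "\<lbrakk> m \<in> carrier M; r \<in> carrier B \<rbrakk> \<Longrightarrow> m \<triangleleft>\<^bsub>M\<^esub> (\<ominus> r) = \<ominus>\<^bsub>M\<^esub> (m \<triangleleft>\<^bsub>M\<^esub> r)"
  using ract_r_distr[of m "\<ominus> r" r] ract_closed[of m r] ract_closed[of m "\<ominus> r"] ract_r_null[of m]
    B.l_neg[of r] M.minus_equality[of "m \<triangleleft>\<^bsub>M\<^esub> (\<ominus> r)" "m \<triangleleft>\<^bsub>M\<^esub> r"]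
  by auto

lemma ract_minus_one: "m \<in> carrier M \<Longrightarrow> m \<triangleleft>\<^bsub>M\<^esub> (\<ominus> \<one>) = \<ominus>\<^bsub>M\<^esub> m"
  by (simp add: ract_r_minus ract_one)

lemma finsum_ract:
  assumes "finite I" "\<And>i. i \<in> I \<Longrightarrow> f i \<in> carrier M" "r \<in> carrier B"
  shows "(\<Oplus>\<^bsub>M\<^esub>i\<in>I. f i) \<triangleleft>\<^bsub>M\<^esub> r = (\<Oplus>\<^bsub>M\<^esub>i\<in>I. f i \<triangleleft>\<^bsub>M\<^esub> r)"
  using assms
proof (induction I rule: finite_induct)
  case empty
  then show ?case by (simp add: ract_l_null)
next
  case (insert i I)
  then have "(\<Oplus>\<^bsub>M\<^esub>i\<in>I. f i) \<in> carrier M" "(\<lambda>i. f i \<triangleleft>\<^bsub>M\<^esub> r) \<in> I \<rightarrow> carrier M" "f \<in> I \<rightarrow> carrier M"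
    by (auto intro!: M.finsum_closed ract_closed)
  with insert show ?case by (simp add: ract_l_distr ract_closed)
qed

lemma ract_finsum:
  assumes "finite I" "\<And>i. i \<in> I \<Longrightarrow> f i \<in> carrier B" "m \<in> carrier M"
  shows "m \<triangleleft>\<^bsub>M\<^esub> (\<Oplus>i\<in>I. f i) = (\<Oplus>\<^bsub>M\<^esub>i\<in>I. m \<triangleleft>\<^bsub>M\<^esub> f i)"
  using assms
proof (induction I rule: finite_induct)
  case empty
  then show ?case by (simp add: ract_r_null)
next
  case (insert i I)
  then have "(\<Oplus>i\<in>I. f i) \<in> carrier B" "(\<lambda>i. m \<triangleleft>\<^bsub>M\<^esub> f i) \<in> I \<rightarrow> carrier M" "f \<in> I \<rightarrow> carrier B"
    by (auto intro!: B.finsum_closed ract_closed)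
  with insert show ?case by (simp add: ract_r_distr ract_closed)
qed

text \<open>
  Closure under negation is automatic, since \<open>- x = x (- 1)\<close>.
\<close>

lemma right_submoduleI:
  assumes "N \<subseteq> carrier M" "\<zero>\<^bsub>M\<^esub> \<in> N"
    and "\<And>x y. x \<in> N \<Longrightarrow> y \<in> N \<Longrightarrow> x \<oplus>\<^bsub>M\<^esub> y \<in> N"
    and "\<And>x r. x \<in> N \<Longrightarrow> r \<in> carrier B \<Longrightarrow> x \<triangleleft>\<^bsub>M\<^esub> r \<in> N"
  shows "right_submodule B M N"
proof -
  have "\<ominus>\<^bsub>M\<^esub> x \<in> N" if "x \<in> N" for x
    using assms(4)[OF that, of "\<ominus> \<one>"] assms(1) that by (auto simp: ract_minus_one)
  then have "subgroup N (add_monoid M)"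
    using assms by (intro M.add.subgroupI) (auto simp: a_inv_def)
  then show ?thesis
    using assms(4) by (simp add: right_submodule_def additive_subgroup_def)
qed

lemma right_submoduleD:
  assumes "right_submodule B M N"
  shows "N \<subseteq> carrier M" "\<zero>\<^bsub>M\<^esub> \<in> N"
    and "\<And>x y. x \<in> N \<Longrightarrow> y \<in> N \<Longrightarrow> x \<oplus>\<^bsub>M\<^esub> y \<in> N"
    and "\<And>x r. x \<in> N \<Longrightarrow> r \<in> carrier B \<Longrightarrow> x \<triangleleft>\<^bsub>M\<^esub> r \<in> N"
  using assms
  by (auto simp: right_submodule_def additive_subgroup.a_subset additive_subgroup.zero_closed
      additive_subgroup.a_closed)

lemma right_submodule_finsum:
  assumes N: "right_submodule B M N" and I: "finite I" and f: "\<And>i. i \<in> I \<Longrightarrow> f i \<in> N"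
  shows "(\<Oplus>\<^bsub>M\<^esub>i\<in>I. f i) \<in> N"
  using I f
proof (induction I rule: finite_induct)
  case empty
  then show ?case using right_submoduleD[OF N] by simp
next
  case (insert i I)
  then have "f \<in> I \<rightarrow> carrier M" "f i \<in> carrier M"
    using right_submoduleD(1)[OF N] by auto
  with insert show ?case using right_submoduleD(3)[OF N] by simp
qed

lemma finitely_generated_iff:
  "finitely_generated B M \<longleftrightarrow> (\<exists>S. finite S \<and> S \<subseteq> carrier M \<and>
     (\<forall>N. right_submodule B M N \<and> S \<subseteq> N \<longrightarrow> carrier M \<subseteq> N))"
proof -
  have "right_submodule B M (carrier M)"
    by (rule right_submoduleI) (auto intro: ract_closed)
  then have eq: "right_generated B M S = carrier M \<longleftrightarrow>
      (\<forall>N. right_submodule B M N \<and> S \<subseteq> N \<longrightarrow> carrier M \<subseteq> N)" if "S \<subseteq> carrier M" for S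
    using that unfolding right_generated_def by blast
  show ?thesis
    unfolding finitely_generated_def by (intro arg_cong[where f = Ex] ext conj_cong refl eq)
qed

end

lemma rmodule_homD:
  assumes "f \<in> rmodule_hom B M N"
  shows "f \<in> carrier M \<rightarrow>\<^sub>E carrier N"
    and "\<And>x. x \<in> carrier M \<Longrightarrow> f x \<in> carrier N"
    and "\<And>x y. \<lbrakk>x \<in> carrier M; y \<in> carrier M\<rbrakk> \<Longrightarrow> f (x \<oplus>\<^bsub>M\<^esub> y) = f x \<oplus>\<^bsub>N\<^esub> f y"
    and "\<And>x r. \<lbrakk>x \<in> carrier M; r \<in> carrier B\<rbrakk> \<Longrightarrow> f (x \<triangleleft>\<^bsub>M\<^esub> r) = f x \<triangleleft>\<^bsub>N\<^esub> r"
  using assms unfolding rmodule_hom_def by auto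

lemma rmodule_hom_eqI:
  assumes "f \<in> rmodule_hom B M N" "g \<in> rmodule_hom B' M N'" "\<And>x. x \<in> carrier M \<Longrightarrow> f x = g x"
  shows "f = g"
  using assms(3) rmodule_homD(1)[OF assms(1)] rmodule_homD(1)[OF assms(2)]
  by (metis PiE_restrict restrict_ext)

text \<open>
  Homomorphisms are extensional by definition, so a map given by a formula has to be restricted to
  the carrier first.
\<close>

lemma restrict_rmodule_hom:
  assumes M: "right_module B M"
    and "\<And>x. x \<in> carrier M \<Longrightarrow> f x \<in> carrier N"
    and "\<And>x y. \<lbrakk>x \<in> carrier M; y \<in> carrier M\<rbrakk> \<Longrightarrow> f (x \<oplus>\<^bsub>M\<^esub> y) = f x \<oplus>\<^bsub>N\<^esub> f y"
    and "\<And>x r. \<lbrakk>x \<in> carrier M; r \<in> carrier B\<rbrakk> \<Longrightarrow> f (x \<triangleleft>\<^bsub>M\<^esub> r) = f x \<triangleleft>\<^bsub>N\<^esub> r"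
  shows "restrict f (carrier M) \<in> rmodule_hom B M N"
proof -
  interpret right_module B M by (rule M)
  show ?thesis using assms(2-) by (auto simp: rmodule_hom_def ract_closed)
qed

lemma rmodule_hom_zero:
  assumes M: "right_module B M" and N: "right_module B N" and f: "f \<in> rmodule_hom B M N"
  shows "f \<zero>\<^bsub>M\<^esub> = \<zero>\<^bsub>N\<^esub>"
proof -
  interpret M: right_module B M by (rule M)
  interpret N: right_module B N by (rule N)
  show ?thesis
    using rmodule_homD(4)[OF f, of "\<zero>\<^bsub>M\<^esub>" "\<zero>\<^bsub>B\<^esub>"] rmodule_homD(2)[OF f, of "\<zero>\<^bsub>M\<^esub>"]
    by (simp add: M.ract_r_null N.ract_r_null)
qed

lemma rmodule_hom_finsum:
  assumes M: "right_module B M" and N: "right_module B N" and f: "f \<in> rmodule_hom B M N"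
    and I: "finite I" and x: "\<And>i. i \<in> I \<Longrightarrow> x i \<in> carrier M"
  shows "f (\<Oplus>\<^bsub>M\<^esub>i\<in>I. x i) = (\<Oplus>\<^bsub>N\<^esub>i\<in>I. f (x i))"
proof -
  interpret M: right_module B M by (rule M)
  interpret N: right_module B N by (rule N)
  note f' = rmodule_homD(2-)[OF f]
  show ?thesis using I x
  proof (induction I rule: finite_induct)
    case empty
    then show ?case by (simp add: rmodule_hom_zero[OF M N f])
  next
    case (insert i I)
    then have "(\<Oplus>\<^bsub>M\<^esub>i\<in>I. x i) \<in> carrier M" "(\<lambda>i. f (x i)) \<in> I \<rightarrow> carrier N" "x \<in> I \<rightarrow> carrier M"
      by (auto intro!: M.M.finsum_closed f')
    with insert show ?case by (simp add: f')
  qed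
qed

lemma compose_rmodule_hom:
  assumes L: "right_module B L" and f: "f \<in> rmodule_hom B L M" and g: "g \<in> rmodule_hom B M N"
  shows "compose (carrier L) g f \<in> rmodule_hom B L N"
proof -
  note f' = rmodule_homD(2-)[OF f] and g' = rmodule_homD(2-)[OF g]
  show ?thesis
    unfolding compose_def by (rule restrict_rmodule_hom[OF L]) (simp_all add: f' g')
qed

lemma id_rmodule_hom: "right_module B M \<Longrightarrow> (\<lambda>x\<in>carrier M. x) \<in> rmodule_hom B M M"
  by (rule restrict_rmodule_hom[where f = "\<lambda>x. x"]) simp_all

definition rmodule_iso ::
  "('r, 'c) ring_scheme \<Rightarrow> ('r, 'm) rmodule \<Rightarrow> ('r, 'n) rmodule \<Rightarrow> ('m \<Rightarrow> 'n) set" where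
  "rmodule_iso B M N = {f \<in> rmodule_hom B M N. bij_betw f (carrier M) (carrier N)}"

lemma rmodule_isoD:
  assumes "f \<in> rmodule_iso B M N"
  shows "f \<in> rmodule_hom B M N" "bij_betw f (carrier M) (carrier N)"
  using assms by (auto simp: rmodule_iso_def)

lemma rmodule_iso_inverse:
  assumes M: "right_module B M" and N: "right_module B N" and f: "f \<in> rmodule_iso B M N"
  obtains g where "g \<in> rmodule_iso B N M"
    and "\<And>x. x \<in> carrier M \<Longrightarrow> g (f x) = x" and "\<And>y. y \<in> carrier N \<Longrightarrow> f (g y) = y"
proof -
  interpret M: right_module B M by (rule M)
  interpret N: right_module B N by (rule N)
  note f' = rmodule_homD(2-)[OF rmodule_isoD(1)[OF f]]
  have bij: "bij_betw f (carrier M) (carrier N)" by (rule rmodule_isoD(2)[OF f])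
  define g where "g = restrict (inv_into (carrier M) f) (carrier N)"
  have gf: "g (f x) = x" if "x \<in> carrier M" for x
    using bij that f'(1) by (simp add: g_def bij_betw_def)
  have g: "g y \<in> carrier M" and fg: "f (g y) = y" if "y \<in> carrier N" for y
    using bij that by (auto simp: g_def bij_betw_def inv_into_into f_inv_into_f)
  have "g \<in> rmodule_hom B N M"
    unfolding g_def
  proof (rule restrict_rmodule_hom[OF N])
    fix x y assume x: "x \<in> carrier N" and y: "y \<in> carrier N"
    show "inv_into (carrier M) f x \<in> carrier M"
      using g[OF x] x by (simp add: g_def)
    show "inv_into (carrier M) f (x \<oplus>\<^bsub>N\<^esub> y)
        = inv_into (carrier M) f x \<oplus>\<^bsub>M\<^esub> inv_into (carrier M) f y"
      using gf[of "g x \<oplus>\<^bsub>M\<^esub> g y"] f'(2) g fg x y by (simp add: g_def)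
  next
    fix x r assume x: "x \<in> carrier N" and r: "r \<in> carrier B"
    show "inv_into (carrier M) f (x \<triangleleft>\<^bsub>N\<^esub> r) = inv_into (carrier M) f x \<triangleleft>\<^bsub>M\<^esub> r"
      using gf[of "g x \<triangleleft>\<^bsub>M\<^esub> r"] f'(3) g fg x r M.ract_closed N.ract_closed by (simp add: g_def)
  qed
  moreover have "bij_betw g (carrier N) (carrier M)"
    by (rule bij_betw_byWitness[where f' = f]) (use gf fg g f' in auto)
  ultimately show thesis using that gf fg by (auto simp: rmodule_iso_def)
qed

lemma compose_rmodule_iso:
  assumes L: "right_module B L" and f: "f \<in> rmodule_iso B L M" and g: "g \<in> rmodule_iso B M N"
  shows "compose (carrier L) g f \<in> rmodule_iso B L N"
  using compose_rmodule_hom[OF L rmodule_isoD(1)[OF f] rmodule_isoD(1)[OF g]]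
    bij_betw_compose[OF rmodule_isoD(2)[OF f] rmodule_isoD(2)[OF g]]
  by (simp add: rmodule_iso_def)

lemma finitely_generated_hom_image:
  assumes M: "right_module B M" and N: "right_module B N" and f: "f \<in> rmodule_hom B M N"
    and surj: "f ` carrier M = carrier N" and fg: "finitely_generated B M"
  shows "finitely_generated B N"
proof -
  interpret M: right_module B M by (rule M)
  interpret N: right_module B N by (rule N)
  note f' = rmodule_homD(2-)[OF f]
  obtain S where S: "finite S" "S \<subseteq> carrier M"
      "\<And>L. right_submodule B M L \<Longrightarrow> S \<subseteq> L \<Longrightarrow> carrier M \<subseteq> L"
    using fg M.finitely_generated_iff by auto
  have "\<forall>L. right_submodule B N L \<and> f ` S \<subseteq> L \<longrightarrow> carrier N \<subseteq> L"
  proof (intro allI impI, elim conjE)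
    fix L assume L: "right_submodule B N L" "f ` S \<subseteq> L"
    note L' = N.right_submoduleD[OF L(1)]
    have "right_submodule B M {x \<in> carrier M. f x \<in> L}"
      by (rule M.right_submoduleI)
        (use L' f' rmodule_hom_zero[OF M N f] M.ract_closed in auto)
    then have "carrier M \<subseteq> {x \<in> carrier M. f x \<in> L}"
      using S(2) L(2) by (intro S(3)) auto
    then show "carrier N \<subseteq> L" unfolding surj[symmetric] by (auto dest: subsetD)
  qed
  moreover have "finite (f ` S)" "f ` S \<subseteq> carrier N" using S(1,2) surj by auto
  ultimately show ?thesis
    unfolding N.finitely_generated_iff by (intro exI[of _ "f ` S"] conjI)
qed

lemma finitely_generated_iso:
  assumes "right_module B M" "right_module B N" "f \<in> rmodule_iso B M N" "finitely_generated B M"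
  shows "finitely_generated B N"
  by (rule finitely_generated_hom_image[OF assms(1,2) rmodule_isoD(1)[OF assms(3)] _ assms(4)])
    (use rmodule_isoD(2)[OF assms(3)] in \<open>simp add: bij_betw_def\<close>)

lemma regular_right_module: "ring A \<Longrightarrow> right_module A (regular_rmodule A)"
proof -
  assume "ring A"
  then interpret ring A .
  have "abelian_group (regular_rmodule A)"
    by (rule abelian_groupI) (auto simp: regular_rmodule_def a_ac intro: add.l_inv_ex)
  then show ?thesis
    by (intro right_module.intro right_module_axioms.intro ring_axioms)
      (auto simp: regular_rmodule_def l_distr r_distr m_assoc)
qed

text \<open>
  Every module axiom is an equation, so it can be checked after applying an injective map that
  preserves the operations; negatives are obtained from \<open>- x = x (- 1)\<close>.
\<close>

lemma right_module_inj_transport: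
  fixes N :: "('r, 'n) rmodule"
  assumes M: "right_module B M"
    and f: "\<And>x. x \<in> carrier N \<Longrightarrow> f x \<in> carrier M" and inj: "inj_on f (carrier N)"
    and zero: "\<zero>\<^bsub>N\<^esub> \<in> carrier N" "f \<zero>\<^bsub>N\<^esub> = \<zero>\<^bsub>M\<^esub>"
    and add: "\<And>x y. \<lbrakk>x \<in> carrier N; y \<in> carrier N\<rbrakk> \<Longrightarrow> x \<oplus>\<^bsub>N\<^esub> y \<in> carrier N"
      "\<And>x y. \<lbrakk>x \<in> carrier N; y \<in> carrier N\<rbrakk> \<Longrightarrow> f (x \<oplus>\<^bsub>N\<^esub> y) = f x \<oplus>\<^bsub>M\<^esub> f y"
    and ract: "\<And>x r. \<lbrakk>x \<in> carrier N; r \<in> carrier B\<rbrakk> \<Longrightarrow> x \<triangleleft>\<^bsub>N\<^esub> r \<in> carrier N"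
      "\<And>x r. \<lbrakk>x \<in> carrier N; r \<in> carrier B\<rbrakk> \<Longrightarrow> f (x \<triangleleft>\<^bsub>N\<^esub> r) = f x \<triangleleft>\<^bsub>M\<^esub> r"
  shows "right_module B N"
proof -
  interpret M: right_module B M by (rule M)
  have eq: "x = y" if "x \<in> carrier N" "y \<in> carrier N" "f x = f y" for x y
    using inj that by (auto simp: inj_on_def)
  have "abelian_group N"
  proof (rule abelian_groupI)
    fix x assume x: "x \<in> carrier N"
    show "\<exists>y\<in>carrier N. y \<oplus>\<^bsub>N\<^esub> x = \<zero>\<^bsub>N\<^esub>"
    proof (intro bexI eq)
      show "f (x \<triangleleft>\<^bsub>N\<^esub> (\<ominus>\<^bsub>B\<^esub> \<one>\<^bsub>B\<^esub>) \<oplus>\<^bsub>N\<^esub> x) = f \<zero>\<^bsub>N\<^esub>"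
        using x f[OF x] by (simp add: add ract zero M.ract_minus_one M.M.l_neg)
    qed (use x zero add ract in auto)
  qed (auto intro!: eq simp: f zero add M.M.a_ac)
  then show ?thesis
    by (intro right_module.intro right_module_axioms.intro M.B.ring_axioms)
      (auto intro!: eq simp: f add ract M.ract_l_distr M.ract_r_distr M.ract_assoc M.ract_one)
qed

lemma finitely_generated_spanning_family:
  assumes M: "right_module B M" and fg: "finitely_generated B M"
  obtains k :: nat and s where "\<forall>i<k. s i \<in> carrier M"
    and "\<forall>x\<in>carrier M. \<exists>c. (\<forall>i<k. c i \<in> carrier B) \<and> x = (\<Oplus>\<^bsub>M\<^esub>i\<in>{..<k}. s i \<triangleleft>\<^bsub>M\<^esub> c i)"
proof -
  interpret right_module B M by (rule M)
  obtain S where S: "finite S" "S \<subseteq> carrier M"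
      "\<And>L. right_submodule B M L \<Longrightarrow> S \<subseteq> L \<Longrightarrow> carrier M \<subseteq> L"
    using fg finitely_generated_iff by auto
  obtain s :: "nat \<Rightarrow> _" and k where s: "S = s ` {..<k}"
    using finite_imp_nat_seg_image_inj_on[OF S(1)] by (auto simp: lessThan_def)
  have sM: "s i \<in> carrier M" if "i < k" for i using S(2) s that by auto
  define L where "L = {x. \<exists>c. (\<forall>i<k. c i \<in> carrier B) \<and> x = (\<Oplus>\<^bsub>M\<^esub>i\<in>{..<k}. s i \<triangleleft>\<^bsub>M\<^esub> c i)}"
  have LI: "(\<Oplus>\<^bsub>M\<^esub>i\<in>{..<k}. s i \<triangleleft>\<^bsub>M\<^esub> c i) \<in> L" if "\<And>i. i < k \<Longrightarrow> c i \<in> carrier B" for c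
    using that L_def by blast
  have cl: "(\<lambda>i. s i \<triangleleft>\<^bsub>M\<^esub> c i) \<in> {..<k} \<rightarrow> carrier M" if "\<forall>i<k. c i \<in> carrier B" for c
    using that sM ract_closed by auto
  have "right_submodule B M L"
  proof (rule right_submoduleI)
    show "L \<subseteq> carrier M" using cl by (auto simp: L_def intro!: M.finsum_closed)
    have "(\<Oplus>\<^bsub>M\<^esub>i\<in>{..<k}. s i \<triangleleft>\<^bsub>M\<^esub> \<zero>\<^bsub>B\<^esub>) = (\<Oplus>\<^bsub>M\<^esub>i\<in>{..<k}. \<zero>\<^bsub>M\<^esub>)"
      by (rule M.finsum_cong') (auto simp: ract_r_null sM)
    then show "\<zero>\<^bsub>M\<^esub> \<in> L" using LI[of "\<lambda>_. \<zero>\<^bsub>B\<^esub>"] by simp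
  next
    fix x y assume "x \<in> L" "y \<in> L"
    then obtain c d where c: "\<forall>i<k. c i \<in> carrier B" "x = (\<Oplus>\<^bsub>M\<^esub>i\<in>{..<k}. s i \<triangleleft>\<^bsub>M\<^esub> c i)"
      and d: "\<forall>i<k. d i \<in> carrier B" "y = (\<Oplus>\<^bsub>M\<^esub>i\<in>{..<k}. s i \<triangleleft>\<^bsub>M\<^esub> d i)"
      by (auto simp: L_def)
    have "x \<oplus>\<^bsub>M\<^esub> y = (\<Oplus>\<^bsub>M\<^esub>i\<in>{..<k}. s i \<triangleleft>\<^bsub>M\<^esub> c i \<oplus>\<^bsub>M\<^esub> s i \<triangleleft>\<^bsub>M\<^esub> d i)"
      using c d by (simp add: M.finsum_addf cl)
    also have "\<dots> = (\<Oplus>\<^bsub>M\<^esub>i\<in>{..<k}. s i \<triangleleft>\<^bsub>M\<^esub> (c i \<oplus>\<^bsub>B\<^esub> d i))"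
      by (rule M.finsum_cong') (use c d sM ract_closed in \<open>auto simp: ract_r_distr\<close>)
    also have "\<dots> \<in> L" by (rule LI) (use c d in auto)
    finally show "x \<oplus>\<^bsub>M\<^esub> y \<in> L" .
  next
    fix x r assume "x \<in> L" and r: "r \<in> carrier B"
    then obtain c where c: "\<forall>i<k. c i \<in> carrier B" "x = (\<Oplus>\<^bsub>M\<^esub>i\<in>{..<k}. s i \<triangleleft>\<^bsub>M\<^esub> c i)"
      by (auto simp: L_def)
    have "x \<triangleleft>\<^bsub>M\<^esub> r = (\<Oplus>\<^bsub>M\<^esub>i\<in>{..<k}. s i \<triangleleft>\<^bsub>M\<^esub> c i \<triangleleft>\<^bsub>M\<^esub> r)"
      unfolding c(2) by (rule finsum_ract) (use c r cl[of c] in auto)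
    also have "\<dots> = (\<Oplus>\<^bsub>M\<^esub>i\<in>{..<k}. s i \<triangleleft>\<^bsub>M\<^esub> (c i \<otimes>\<^bsub>B\<^esub> r))"
      by (rule M.finsum_cong') (use c r sM ract_closed in \<open>auto simp: ract_assoc\<close>)
    also have "\<dots> \<in> L" by (rule LI) (use c r in auto)
    finally show "x \<triangleleft>\<^bsub>M\<^esub> r \<in> L" .
  qed
  moreover have "S \<subseteq> L"
  proof
    fix x assume "x \<in> S"
    then obtain j where j: "j < k" "x = s j" using s by auto
    have "(\<Oplus>\<^bsub>M\<^esub>i\<in>{..<k}. s i \<triangleleft>\<^bsub>M\<^esub> (if j = i then \<one>\<^bsub>B\<^esub> else \<zero>\<^bsub>B\<^esub>))
        = (\<Oplus>\<^bsub>M\<^esub>i\<in>{..<k}. if j = i then s i else \<zero>\<^bsub>M\<^esub>)"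
      by (rule M.finsum_cong') (auto simp: ract_r_null ract_one sM)
    also have "\<dots> = s j" by (rule M.finsum_singleton) (use j sM in auto)
    finally show "x \<in> L" using LI[of "\<lambda>i. if j = i then \<one>\<^bsub>B\<^esub> else \<zero>\<^bsub>B\<^esub>"] j by simp
  qed
  ultimately have "carrier M \<subseteq> L" by (rule S(3))
  then show thesis using that[of k s] sM unfolding L_def by blast
qed

text \<open>
  With generators \<open>s\<^sub>0, \<dots>, s\<^sub>k\<^sub>-\<^sub>1\<close>, an element is determined by the set of all coefficient
  sequences \<open>c\<close> for which it equals \<open>\<Sum> s\<^sub>i c\<^sub>i\<close>. These sets are elements of the fixed type
  \<open>(nat \<Rightarrow> 'r) set\<close>, whatever the type of the module is, and the structure is transported to them.
\<close>

lemma finitely_generated_copy: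
  fixes M :: "('r, 'm) rmodule"
  assumes M: "right_module B M" and fg: "finitely_generated B M"
  shows "\<exists>(N :: ('r, (nat \<Rightarrow> 'r) set) rmodule) f.
    right_module B N \<and> finitely_generated B N \<and> f \<in> rmodule_iso B M N"
proof -
  interpret right_module B M by (rule M)
  obtain k :: nat and s where s: "\<forall>i<k. s i \<in> carrier M"
    and span: "\<forall>x\<in>carrier M. \<exists>c. (\<forall>i<k. c i \<in> carrier B) \<and> x = (\<Oplus>\<^bsub>M\<^esub>i\<in>{..<k}. s i \<triangleleft>\<^bsub>M\<^esub> c i)"
    by (rule finitely_generated_spanning_family[OF M fg])
  define t where "t = (\<lambda>x\<in>carrier M.
    {c. (\<forall>i<k. c i \<in> carrier B) \<and> x = (\<Oplus>\<^bsub>M\<^esub>i\<in>{..<k}. s i \<triangleleft>\<^bsub>M\<^esub> c i)})"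
  have inj: "inj_on t (carrier M)"
  proof (rule inj_onI)
    fix x y assume xy: "x \<in> carrier M" "y \<in> carrier M" "t x = t y"
    obtain c where "c \<in> t x" using span xy(1) by (auto simp: t_def)
    with xy show "x = y" by (auto simp: t_def)
  qed
  define u where "u = inv_into (carrier M) t"
  have ut: "u (t x) = x" if "x \<in> carrier M" for x using inj that by (simp add: u_def)
  define N :: "('r, (nat \<Rightarrow> 'r) set) rmodule" where
    "N = \<lparr>carrier = t ` carrier M, mult = undefined, one = undefined, zero = t \<zero>\<^bsub>M\<^esub>,
          add = (\<lambda>x y. t (u x \<oplus>\<^bsub>M\<^esub> u y)), ract = (\<lambda>x r. t (u x \<triangleleft>\<^bsub>M\<^esub> r))\<rparr>"
  have N: "right_module B N"
    by (rule right_module_inj_transport[OF M, where f = u])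
      (auto simp: N_def ut ract_closed inj_on_def)
  have "restrict t (carrier M) \<in> rmodule_hom B M N"
    by (rule restrict_rmodule_hom[OF M]) (auto simp: N_def ut)
  moreover have "restrict t (carrier M) = t" by (simp add: t_def)
  ultimately have "t \<in> rmodule_iso B M N"
    using inj by (auto simp: rmodule_iso_def bij_betw_def N_def)
  with N show ?thesis using finitely_generated_iso[OF M N _ fg] by blast
qed

lemma fg_right_modules_category:
  fixes B :: "('r, 'd) ring_scheme"
  shows "is_category (fg_right_modules B)"
proof -
  note [simp] = fg_right_modules_def
  have "\<lbrakk>f \<in> rmodule_hom B M N\<rbrakk> \<Longrightarrow> f \<in> carrier M \<rightarrow> carrier N \<and> f \<in> extensional (carrier M) \<and>
      compose (carrier M) f (\<lambda>x\<in>carrier M. x) = f"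
    for M N :: "('r, (nat \<Rightarrow> 'r) set) rmodule" and f
    using rmodule_homD(1)[of f B M N] compose_Id[of f "carrier M" "carrier N"] by (simp add: PiE_def)
  then show ?thesis
    unfolding is_category_def
    by (simp add: id_rmodule_hom compose_rmodule_hom compose_assoc[symmetric] Id_compose)
qed

lemma is_iso_fg_right_modules:
  assumes "M \<in> Obj (fg_right_modules B)" "N \<in> Obj (fg_right_modules B)" "f \<in> rmodule_iso B M N"
  shows "is_iso (fg_right_modules B) M N f"
proof -
  have M: "right_module B M" and N: "right_module B N"
    using assms by (auto simp: fg_right_modules_def)
  obtain g where g: "g \<in> rmodule_iso B N M"
      "\<And>x. x \<in> carrier M \<Longrightarrow> g (f x) = x" "\<And>y. y \<in> carrier N \<Longrightarrow> f (g y) = y"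
    by (rule rmodule_iso_inverse[OF M N assms(3)], rule that)
  have "compose (carrier M) g f = (\<lambda>x\<in>carrier M. x)" "compose (carrier N) f g = (\<lambda>x\<in>carrier N. x)"
    using g by (auto simp: compose_def intro!: restrict_ext)
  then show ?thesis
    unfolding is_iso_def fg_right_modules_def
    using rmodule_isoD(1)[OF assms(3)] rmodule_isoD(1)[OF g(1)] by auto
qed

section \<open>Modules over a full corner\<close>

text \<open>
  The module \<open>Me\<close>. It is a module over a ring \<open>B\<close> that need not be \<open>eAe\<close> itself: \<open>B\<close> acts through
  an isomorphism \<open>\<phi>\<close> from \<open>B\<close> onto \<open>eAe\<close>.
\<close>

definition corner_rmodule :: "('b \<Rightarrow> 'a) \<Rightarrow> 'a \<Rightarrow> ('a, 'm) rmodule \<Rightarrow> ('b, 'm) rmodule" where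
  "corner_rmodule \<phi> e M = \<lparr>carrier = {m \<in> carrier M. m \<triangleleft>\<^bsub>M\<^esub> e = m}, mult = mult M, one = \<one>\<^bsub>M\<^esub>,
     zero = \<zero>\<^bsub>M\<^esub>, add = add M, ract = (\<lambda>m r. m \<triangleleft>\<^bsub>M\<^esub> \<phi> r)\<rparr>"

text \<open>
  The last assumption expresses that \<open>e\<close> is full, that is \<open>AeA = A\<close>: as \<open>a\<^sub>i \<in> Ae\<close> and \<open>b\<^sub>i \<in> eA\<close>,
  it writes \<open>1\<close> as an element of \<open>AeA\<close>.
\<close>

locale full_corner = A: ring A + B: ring B
  for A :: "('a, 'c) ring_scheme" (structure) and B :: "('b, 'd) ring_scheme" +
  fixes \<phi> :: "'b \<Rightarrow> 'a" and e :: 'a and I :: "'i set" and a b :: "'i \<Rightarrow> 'a"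
  assumes \<phi>_bij: "bij_betw \<phi> (carrier B) {t \<in> carrier A. e \<otimes> t = t \<and> t \<otimes> e = t}"
    and \<phi>_add: "\<lbrakk>x \<in> carrier B; y \<in> carrier B\<rbrakk> \<Longrightarrow> \<phi> (x \<oplus>\<^bsub>B\<^esub> y) = \<phi> x \<oplus> \<phi> y"
    and \<phi>_mult: "\<lbrakk>x \<in> carrier B; y \<in> carrier B\<rbrakk> \<Longrightarrow> \<phi> (x \<otimes>\<^bsub>B\<^esub> y) = \<phi> x \<otimes> \<phi> y"
    and \<phi>_one: "\<phi> \<one>\<^bsub>B\<^esub> = e"
    and finite_I: "finite I"
    and a_closed: "i \<in> I \<Longrightarrow> a i \<in> carrier A" and a_e: "i \<in> I \<Longrightarrow> a i \<otimes> e = a i"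
    and b_closed: "i \<in> I \<Longrightarrow> b i \<in> carrier A" and e_b: "i \<in> I \<Longrightarrow> e \<otimes> b i = b i"
    and sum_ab: "(\<Oplus>i\<in>I. a i \<otimes> b i) = \<one>"
begin

lemma \<phi>_closed: "x \<in> carrier B \<Longrightarrow> \<phi> x \<in> carrier A"
  and e_\<phi>: "x \<in> carrier B \<Longrightarrow> e \<otimes> \<phi> x = \<phi> x"
  and \<phi>_e: "x \<in> carrier B \<Longrightarrow> \<phi> x \<otimes> e = \<phi> x"
  using bij_betwE[OF \<phi>_bij] by auto

lemma e_closed: "e \<in> carrier A" and e_e: "e \<otimes> e = e"
  using \<phi>_closed[of "\<one>\<^bsub>B\<^esub>"] e_\<phi>[of "\<one>\<^bsub>B\<^esub>"] by (auto simp: \<phi>_one)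

definition \<psi> :: "'a \<Rightarrow> 'b" where "\<psi> = inv_into (carrier B) \<phi>"

lemma
  assumes "t \<in> carrier A" "e \<otimes> t = t" "t \<otimes> e = t"
  shows \<psi>_closed: "\<psi> t \<in> carrier B" and \<phi>_\<psi>: "\<phi> (\<psi> t) = t"
  using \<phi>_bij assms by (auto simp: \<psi>_def bij_betw_def inv_into_into f_inv_into_f)

lemma \<psi>_\<phi>: "x \<in> carrier B \<Longrightarrow> \<psi> (\<phi> x) = x"
  using \<phi>_bij by (simp add: \<psi>_def bij_betw_def)

lemma \<psi>_eqI: "\<lbrakk>x \<in> carrier B; \<phi> x = t\<rbrakk> \<Longrightarrow> \<psi> t = x"
  using \<psi>_\<phi> by blast

lemma \<phi>_finsum:
  assumes "finite J" "\<And>j. j \<in> J \<Longrightarrow> x j \<in> carrier B"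
  shows "\<phi> (\<Oplus>\<^bsub>B\<^esub>j\<in>J. x j) = (\<Oplus>j\<in>J. \<phi> (x j))"
  using assms
proof (induction J rule: finite_induct)
  case empty
  have "\<phi> \<zero>\<^bsub>B\<^esub> \<oplus> \<phi> \<zero>\<^bsub>B\<^esub> = \<phi> \<zero>\<^bsub>B\<^esub>" using \<phi>_add[of "\<zero>\<^bsub>B\<^esub>" "\<zero>\<^bsub>B\<^esub>"] by simp
  then show ?case using \<phi>_closed[of "\<zero>\<^bsub>B\<^esub>"] by (simp add: A.add.r_cancel_one)
next
  case (insert j J)
  then have "(\<Oplus>\<^bsub>B\<^esub>j\<in>J. x j) \<in> carrier B" "(\<lambda>j. \<phi> (x j)) \<in> J \<rightarrow> carrier A" "x \<in> J \<rightarrow> carrier B"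
    by (auto intro!: B.finsum_closed \<phi>_closed)
  with insert show ?case by (simp add: \<phi>_add \<phi>_closed)
qed

lemma \<psi>_corner:
  assumes "s \<in> carrier A" "t \<in> carrier A" "e \<otimes> s = s" "t \<otimes> e = t"
  shows "\<psi> (s \<otimes> t) \<in> carrier B" "\<phi> (\<psi> (s \<otimes> t)) = s \<otimes> t"
proof -
  have "e \<otimes> (s \<otimes> t) = s \<otimes> t" "(s \<otimes> t) \<otimes> e = s \<otimes> t"
    using assms e_closed A.m_assoc[of e s t] A.m_assoc[of s t e] by auto
  then show "\<psi> (s \<otimes> t) \<in> carrier B" "\<phi> (\<psi> (s \<otimes> t)) = s \<otimes> t"
    using assms by (auto intro: \<psi>_closed \<phi>_\<psi>)
qed

abbreviation corner :: "('a, 'm) rmodule \<Rightarrow> ('b, 'm) rmodule" where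
  "corner M \<equiv> corner_rmodule \<phi> e M"

lemma corner_carrier: "m \<in> carrier (corner M) \<longleftrightarrow> m \<in> carrier M \<and> m \<triangleleft>\<^bsub>M\<^esub> e = m"
  and corner_simps: "\<zero>\<^bsub>corner M\<^esub> = \<zero>\<^bsub>M\<^esub>" "add (corner M) = add M"
    "m \<triangleleft>\<^bsub>corner M\<^esub> r = m \<triangleleft>\<^bsub>M\<^esub> \<phi> r"
  by (auto simp: corner_rmodule_def)

context
  fixes M :: "('a, 'm) rmodule"
  assumes M: "right_module A M"
begin

interpretation M: right_module A M by (rule M)

abbreviation act_M (infixl \<open>\<cdot>\<close> 70) where "m \<cdot> r \<equiv> m \<triangleleft>\<^bsub>M\<^esub> r"

lemma ract_corner:
  assumes "m \<in> carrier M" "r \<in> carrier A" "r \<otimes> e = r"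
  shows "m \<cdot> r \<in> carrier (corner M)"
  using assms e_closed M.ract_assoc[of m r e] by (simp add: corner_carrier M.ract_closed)

lemma corner_right_module: "right_module B (corner M)"
proof -
  have "abelian_group (corner M)"
  proof (rule abelian_groupI)
    fix x assume x: "x \<in> carrier (corner M)"
    then have "\<ominus>\<^bsub>M\<^esub> x = x \<cdot> (\<ominus> e)"
      using M.ract_r_minus[of x e] e_closed by (auto simp: corner_carrier)
    then have "\<ominus>\<^bsub>M\<^esub> x \<in> carrier (corner M)"
      using x e_closed ract_corner[of x "\<ominus> e"] by (simp add: corner_carrier A.l_minus e_e)
    then show "\<exists>y\<in>carrier (corner M). y \<oplus>\<^bsub>corner M\<^esub> x = \<zero>\<^bsub>corner M\<^esub>"
      using x by (intro bexI[of _ "\<ominus>\<^bsub>M\<^esub> x"]) (auto simp: corner_simps corner_carrier M.M.l_neg)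
  qed (auto simp: corner_carrier corner_simps e_closed M.ract_l_distr M.ract_l_null M.M.a_ac)
  then show ?thesis
  proof (intro right_module.intro right_module_axioms.intro B.ring_axioms)
    fix m r assume "m \<in> carrier (corner M)" "r \<in> carrier B"
    then show "m \<triangleleft>\<^bsub>corner M\<^esub> r \<in> carrier (corner M)"
      using ract_corner[of m "\<phi> r"] by (simp add: corner_simps \<phi>_closed \<phi>_e corner_carrier)
  qed (auto simp: corner_carrier corner_simps \<phi>_add \<phi>_mult \<phi>_one \<phi>_closed
      M.ract_l_distr M.ract_r_distr M.ract_assoc)
qed

lemma corner_finsum:
  assumes "finite J" "\<And>j. j \<in> J \<Longrightarrow> f j \<in> carrier (corner M)"
  shows "(\<Oplus>\<^bsub>corner M\<^esub>j\<in>J. f j) = (\<Oplus>\<^bsub>M\<^esub>j\<in>J. f j)"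
proof -
  interpret C: right_module B "corner M" by (rule corner_right_module)
  show ?thesis using assms
  proof (induction J rule: finite_induct)
    case (insert j J)
    then have "f \<in> J \<rightarrow> carrier (corner M)" "f \<in> J \<rightarrow> carrier M" "f j \<in> carrier (corner M)" "f j \<in> carrier M"
      by (auto simp: corner_carrier)
    with insert show ?case by (simp add: corner_simps)
  qed (simp add: corner_simps)
qed

text \<open>
  Insert \<open>1 = \<Sum> a\<^sub>i b\<^sub>i\<close> between \<open>m\<close> and \<open>x\<close>. As \<open>b\<^sub>i x \<in> eAe\<close>, this expresses \<open>m x \<in> Me\<close> by the
  elements \<open>m a\<^sub>i\<close> of \<open>Me\<close> and the action of \<open>B\<close> alone. It is how information about \<open>M\<close> is
  recovered from the \<open>B\<close>-module \<open>Me\<close>.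
\<close>

lemma ract_column:
  assumes m: "m \<in> carrier M" and x: "x \<in> carrier A" "x \<otimes> e = x"
  shows "m \<cdot> x = (\<Oplus>\<^bsub>corner M\<^esub>i\<in>I. (m \<cdot> a i) \<triangleleft>\<^bsub>corner M\<^esub> \<psi> (b i \<otimes> x))"
proof -
  interpret C: right_module B "corner M" by (rule corner_right_module)
  have ma: "m \<cdot> a i \<in> carrier (corner M)" if "i \<in> I" for i
    using m that by (simp add: ract_corner a_closed a_e)
  have bx: "\<psi> (b i \<otimes> x) \<in> carrier B" "\<phi> (\<psi> (b i \<otimes> x)) = b i \<otimes> x" if "i \<in> I" for i
    using \<psi>_corner[of "b i" x] that x by (simp_all add: b_closed e_b)
  have "x = (\<Oplus>i\<in>I. a i \<otimes> b i) \<otimes> x" using x by (simp add: sum_ab)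
  also have "\<dots> = (\<Oplus>i\<in>I. a i \<otimes> b i \<otimes> x)"
    by (rule A.finsum_ldistr) (use x in \<open>auto simp: finite_I a_closed b_closed\<close>)
  finally have "m \<cdot> x = m \<cdot> (\<Oplus>i\<in>I. a i \<otimes> b i \<otimes> x)" by simp
  also have "\<dots> = (\<Oplus>\<^bsub>M\<^esub>i\<in>I. m \<cdot> (a i \<otimes> b i \<otimes> x))"
    by (rule M.ract_finsum) (use x m in \<open>auto simp: finite_I a_closed b_closed\<close>)
  also have "\<dots> = (\<Oplus>\<^bsub>M\<^esub>i\<in>I. (m \<cdot> a i) \<triangleleft>\<^bsub>corner M\<^esub> \<psi> (b i \<otimes> x))"
    by (rule M.M.finsum_cong') (use m x bx in \<open>auto simp: corner_simps a_closed b_closed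
        A.m_assoc M.ract_assoc intro!: M.ract_closed\<close>)
  also have "\<dots> = (\<Oplus>\<^bsub>corner M\<^esub>i\<in>I. (m \<cdot> a i) \<triangleleft>\<^bsub>corner M\<^esub> \<psi> (b i \<otimes> x))"
    by (rule corner_finsum[symmetric]) (use ma bx in \<open>auto simp: finite_I intro: C.ract_closed\<close>)
  finally show ?thesis .
qed

text \<open>
  Since \<open>m = \<Sum> (m a\<^sub>i) b\<^sub>i\<close>, an element is determined by its products with the \<open>a\<^sub>i\<close>.
\<close>

lemma ract_eqI:
  assumes m: "m \<in> carrier M" and n: "n \<in> carrier M"
    and eq: "\<And>i. i \<in> I \<Longrightarrow> m \<cdot> a i = n \<cdot> a i"
  shows "m = n"
proof -
  have "k = (\<Oplus>\<^bsub>M\<^esub>i\<in>I. (k \<cdot> a i) \<cdot> b i)" if k: "k \<in> carrier M" for k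
  proof -
    have "k = k \<cdot> (\<Oplus>i\<in>I. a i \<otimes> b i)" using k by (simp add: sum_ab M.ract_one)
    also have "\<dots> = (\<Oplus>\<^bsub>M\<^esub>i\<in>I. k \<cdot> (a i \<otimes> b i))"
      by (rule M.ract_finsum) (use k in \<open>auto simp: finite_I a_closed b_closed\<close>)
    also have "\<dots> = (\<Oplus>\<^bsub>M\<^esub>i\<in>I. (k \<cdot> a i) \<cdot> b i)"
      by (rule M.M.finsum_cong')
        (use k in \<open>auto simp: M.ract_assoc a_closed b_closed intro!: M.ract_closed\<close>)
    finally show ?thesis .
  qed
  moreover have "(\<Oplus>\<^bsub>M\<^esub>i\<in>I. (m \<cdot> a i) \<cdot> b i) = (\<Oplus>\<^bsub>M\<^esub>i\<in>I. (n \<cdot> a i) \<cdot> b i)"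
    by (rule M.M.finsum_cong') (use n eq in \<open>auto simp: a_closed b_closed intro!: M.ract_closed\<close>)
  ultimately show ?thesis using m n by metis
qed

text \<open>
  If \<open>S\<close> generates \<open>M\<close>, then the finitely many \<open>s a\<^sub>i\<close> with \<open>s \<in> S\<close> generate \<open>Me\<close>: given a submodule
  \<open>L\<close> of \<open>Me\<close> that contains them, the \<open>m\<close> with all \<open>m a\<^sub>i \<in> L\<close> form a submodule of \<open>M\<close>, hence all
  of \<open>M\<close>.
\<close>

lemma corner_finitely_generated:
  assumes "finitely_generated A M"
  shows "finitely_generated B (corner M)"
proof -
  interpret C: right_module B "corner M" by (rule corner_right_module)
  obtain S where S: "finite S" "S \<subseteq> carrier M"
      "\<And>L. right_submodule A M L \<Longrightarrow> S \<subseteq> L \<Longrightarrow> carrier M \<subseteq> L"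
    using assms M.finitely_generated_iff by auto
  define S' where "S' = (\<lambda>(s, i). s \<cdot> a i) ` (S \<times> I)"
  have gen: "carrier (corner M) \<subseteq> L" if L: "right_submodule B (corner M) L" "S' \<subseteq> L" for L
  proof -
    note L' = C.right_submoduleD[OF L(1), unfolded corner_simps(1,2)]
    \<comment> \<open>equivalently \<open>m A e \<subseteq> L\<close>, as the next fact shows; hence \<open>T\<close> is a submodule\<close>
  define T where "T = {m \<in> carrier M. \<forall>i\<in>I. m \<cdot> a i \<in> L}"
    have column: "m \<cdot> x \<in> L" if "m \<in> T" "x \<in> carrier A" "x \<otimes> e = x" for m x
    proof -
      have "m \<cdot> x = (\<Oplus>\<^bsub>corner M\<^esub>i\<in>I. (m \<cdot> a i) \<triangleleft>\<^bsub>corner M\<^esub> \<psi> (b i \<otimes> x))"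
        by (rule ract_column) (use that in \<open>auto simp: T_def\<close>)
      also have "\<dots> \<in> L"
        using that \<psi>_corner(1)[of "b _" x]
        by (intro C.right_submodule_finsum[OF L(1) finite_I] L'(4)) (auto simp: T_def b_closed e_b)
      finally show ?thesis .
    qed
    have "right_submodule A M T"
    proof (rule M.right_submoduleI)
      fix x r assume x: "x \<in> T" and r: "r \<in> carrier A"
      then have xM: "x \<in> carrier M" by (simp add: T_def)
      have "(x \<cdot> r) \<cdot> a i \<in> L" if "i \<in> I" for i
        using column[OF x, of "r \<otimes> a i"] xM r that e_closed
        by (simp add: a_closed a_e A.m_assoc M.ract_assoc)
      then show "x \<cdot> r \<in> T" using xM r by (simp add: T_def M.ract_closed)
    qed (use L' a_closed in \<open>auto simp: T_def M.ract_l_null M.ract_l_distr\<close>)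
    moreover have "S \<subseteq> T" using L(2) S(2) by (force simp: T_def S'_def)
    ultimately have T: "carrier M \<subseteq> T" by (rule S(3))
    show ?thesis
    proof
      fix m assume "m \<in> carrier (corner M)"
      then show "m \<in> L" using column[of m e] T e_closed e_e by (auto simp: corner_carrier)
    qed
  qed
  have "finite S'" using S(1) finite_I by (simp add: S'_def)
  moreover have "S' \<subseteq> carrier (corner M)"
    using S(2) by (auto simp: S'_def intro!: ract_corner a_closed a_e)
  ultimately show ?thesis
    unfolding C.finitely_generated_iff using gen by (intro exI[of _ S'] conjI allI impI) auto
qed

end

definition corner_map :: "('a, 'm) rmodule \<Rightarrow> ('m \<Rightarrow> 'n) \<Rightarrow> 'm \<Rightarrow> 'n" where
  "corner_map M f = restrict f (carrier (corner M))"

text \<open>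
  The only candidate for an extension of \<open>g\<close> from \<open>Me\<close> to \<open>M\<close>: an extension \<open>f\<close> satisfies
  \<open>f m = f (\<Sum> m a\<^sub>i b\<^sub>i) = \<Sum> g (m a\<^sub>i) b\<^sub>i\<close>.
\<close>

definition corner_extension ::
  "('a, 'm) rmodule \<Rightarrow> ('a, 'n) rmodule \<Rightarrow> ('m \<Rightarrow> 'n) \<Rightarrow> 'm \<Rightarrow> 'n" where
  "corner_extension M N g = (\<lambda>m\<in>carrier M. \<Oplus>\<^bsub>N\<^esub>i\<in>I. g (m \<triangleleft>\<^bsub>M\<^esub> a i) \<triangleleft>\<^bsub>N\<^esub> b i)"

lemma corner_map_hom:
  assumes M: "right_module A M" and f: "f \<in> rmodule_hom A M N"
  shows "corner_map M f \<in> rmodule_hom B (corner M) (corner N)"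
  unfolding corner_map_def
proof (rule restrict_rmodule_hom[OF corner_right_module[OF M]])
  note f' = rmodule_homD(2-)[OF f]
  show "f x \<in> carrier (corner N)" if "x \<in> carrier (corner M)" for x
    using that f'(3)[of x e] by (simp add: corner_carrier f' e_closed)
qed (use rmodule_homD(2-)[OF f] in \<open>auto simp: corner_carrier corner_simps \<phi>_closed\<close>)

context
  fixes M :: "('a, 'm) rmodule" and N :: "('a, 'n) rmodule"
  assumes M: "right_module A M" and N: "right_module A N"
begin

interpretation M: right_module A M by (rule M)
interpretation N: right_module A N by (rule N)

abbreviation act_source (infixl \<open>\<cdot>\<close> 70) where "m \<cdot> r \<equiv> m \<triangleleft>\<^bsub>M\<^esub> r"
abbreviation act_target (infixl \<open>\<star>\<close> 70) where "n \<star> r \<equiv> n \<triangleleft>\<^bsub>N\<^esub> r"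

text \<open>
  Both sides are \<open>\<Sum> g (m a\<^sub>i) (b\<^sub>i x)\<close>, the right one because \<open>b\<^sub>i x \<in> eAe\<close>. With \<open>x = a\<^sub>i\<close> this
  reduces every property of the extension, via \<open>ract_eqI\<close>, to the same property of \<open>g\<close>.
\<close>

lemma corner_extension_ract:
  assumes g: "g \<in> rmodule_hom B (corner M) (corner N)"
    and m: "m \<in> carrier M" and x: "x \<in> carrier A" "x \<otimes> e = x"
  shows "corner_extension M N g m \<star> x = g (m \<cdot> x)"
proof -
  note g' = rmodule_homD(2-)[OF g]
  have ma: "m \<cdot> a i \<in> carrier (corner M)" if "i \<in> I" for i
    using ract_corner[OF M m] a_closed a_e that by blast
  have gN: "g (m \<cdot> a i) \<in> carrier N" if "i \<in> I" for i
    using g'(1)[OF ma[OF that]] by (simp add: corner_carrier)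
  have bx: "\<psi> (b i \<otimes> x) \<in> carrier B" "\<phi> (\<psi> (b i \<otimes> x)) = b i \<otimes> x" if "i \<in> I" for i
    using \<psi>_corner[of "b i" x] that x by (simp_all add: b_closed e_b)
  interpret CM: right_module B "corner M" by (rule corner_right_module[OF M])
  interpret CN: right_module B "corner N" by (rule corner_right_module[OF N])
  have "corner_extension M N g m \<star> x = (\<Oplus>\<^bsub>N\<^esub>i\<in>I. g (m \<cdot> a i) \<star> b i \<star> x)"
    unfolding corner_extension_def using m x
    by (simp add: N.finsum_ract finite_I N.ract_closed gN b_closed)
  also have "\<dots> = (\<Oplus>\<^bsub>N\<^esub>i\<in>I. g (m \<cdot> a i) \<triangleleft>\<^bsub>corner N\<^esub> \<psi> (b i \<otimes> x))"
    by (rule N.M.finsum_cong')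
      (use x bx in \<open>auto simp: corner_simps N.ract_assoc gN b_closed intro!: N.ract_closed\<close>)
  also have "\<dots> = (\<Oplus>\<^bsub>corner N\<^esub>i\<in>I. g (m \<cdot> a i) \<triangleleft>\<^bsub>corner N\<^esub> \<psi> (b i \<otimes> x))"
    by (rule corner_finsum[OF N finite_I, symmetric]) (use ma bx g' CN.ract_closed in auto)
  also have "\<dots> = (\<Oplus>\<^bsub>corner N\<^esub>i\<in>I. g ((m \<cdot> a i) \<triangleleft>\<^bsub>corner M\<^esub> \<psi> (b i \<otimes> x)))"
    by (rule CN.M.finsum_cong') (use ma bx g' CN.ract_closed in auto)
  also have "\<dots> = g (\<Oplus>\<^bsub>corner M\<^esub>i\<in>I. (m \<cdot> a i) \<triangleleft>\<^bsub>corner M\<^esub> \<psi> (b i \<otimes> x))"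
    by (rule rmodule_hom_finsum[OF corner_right_module[OF M] corner_right_module[OF N] g finite_I,
          symmetric]) (use ma bx CM.ract_closed in auto)
  also have "\<dots> = g (m \<cdot> x)" using ract_column[OF M m x] by simp
  finally show ?thesis .
qed

lemma corner_extension_hom:
  assumes g: "g \<in> rmodule_hom B (corner M) (corner N)"
  shows "corner_extension M N g \<in> rmodule_hom A M N"
proof -
  let ?f = "corner_extension M N g"
  note fx = corner_extension_ract[OF g]
  note g' = rmodule_homD(2-)[OF g]
  have ma: "m \<cdot> a i \<in> carrier (corner M)" if "m \<in> carrier M" "i \<in> I" for m i
    using ract_corner[OF M] that a_closed a_e by blast
  have "g (m \<cdot> a i) \<in> carrier N" if "m \<in> carrier M" "i \<in> I" for m i
    using g'(1)[OF ma[OF that]] by (simp add: corner_carrier)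
  then have fN: "?f m \<in> carrier N" if "m \<in> carrier M" for m
    using that by (auto simp: corner_extension_def intro!: N.M.finsum_closed N.ract_closed b_closed)
  have "restrict ?f (carrier M) \<in> rmodule_hom A M N"
  proof (rule restrict_rmodule_hom[OF M fN])
    fix x y assume x: "x \<in> carrier M" and y: "y \<in> carrier M"
    show "?f (x \<oplus>\<^bsub>M\<^esub> y) = ?f x \<oplus>\<^bsub>N\<^esub> ?f y"
    proof (rule ract_eqI[OF N])
      fix i assume i: "i \<in> I"
      show "?f (x \<oplus>\<^bsub>M\<^esub> y) \<star> a i = (?f x \<oplus>\<^bsub>N\<^esub> ?f y) \<star> a i"
        using x y i ma[OF x i] ma[OF y i] g'(2)
        by (simp add: fN fx a_closed a_e M.ract_l_distr N.ract_l_distr corner_simps)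
    qed (use x y fN in auto)
  next
    fix x r assume x: "x \<in> carrier M" and r: "r \<in> carrier A"
    show "?f (x \<cdot> r) = ?f x \<star> r"
    proof (rule ract_eqI[OF N])
      fix i assume i: "i \<in> I"
      have "?f x \<star> r \<star> a i = ?f x \<star> (r \<otimes> a i)"
        using x r i by (simp add: N.ract_assoc fN a_closed)
      also have "\<dots> = g (x \<cdot> (r \<otimes> a i))"
        using x r i e_closed by (simp add: fx a_closed a_e A.m_assoc)
      also have "\<dots> = ?f (x \<cdot> r) \<star> a i"
        using x r i by (simp add: fx a_closed a_e M.ract_closed M.ract_assoc)
      finally show "?f (x \<cdot> r) \<star> a i = ?f x \<star> r \<star> a i" by simp
    qed (use x r fN M.ract_closed N.ract_closed in auto)
  qed
  then show ?thesis by (simp add: corner_extension_def)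
qed

lemma corner_map_extension:
  assumes g: "g \<in> rmodule_hom B (corner M) (corner N)"
  shows "corner_map M (corner_extension M N g) = g"
proof (rule rmodule_hom_eqI[OF corner_map_hom[OF M corner_extension_hom[OF g]] g])
  fix m assume m: "m \<in> carrier (corner M)"
  then have mM: "m \<in> carrier M" "m \<cdot> e = m" by (auto simp: corner_carrier)
  note f' = rmodule_homD(2-)[OF corner_extension_hom[OF g]]
  have "corner_extension M N g m = corner_extension M N g (m \<cdot> e)" using mM by simp
  also have "\<dots> = corner_extension M N g m \<star> e" by (rule f'(3)[OF mM(1) e_closed])
  also have "\<dots> = g m" using corner_extension_ract[OF g mM(1) e_closed e_e] mM by simp
  finally show "corner_map M (corner_extension M N g) m = g m" using m by (simp add: corner_map_def)
qed

lemma corner_extension_map: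
  assumes f: "f \<in> rmodule_hom A M N"
  shows "corner_extension M N (corner_map M f) = f"
proof (rule rmodule_hom_eqI[OF corner_extension_hom[OF corner_map_hom[OF M f]] f])
  note f' = rmodule_homD(2-)[OF f]
  fix m assume m: "m \<in> carrier M"
  note h = corner_extension_hom[OF corner_map_hom[OF M f]]
  show "corner_extension M N (corner_map M f) m = f m"
  proof (rule ract_eqI[OF N rmodule_homD(2)[OF h m] f'(1)[OF m]])
    fix i assume i: "i \<in> I"
    have "corner_extension M N (corner_map M f) m \<star> a i = corner_map M f (m \<cdot> a i)"
      by (rule corner_extension_ract[OF corner_map_hom[OF M f] m a_closed[OF i] a_e[OF i]])
    also have "\<dots> = f m \<star> a i"
      using ract_corner[OF M m a_closed[OF i] a_e[OF i]] m i by (simp add: corner_map_def f' a_closed)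
    finally show "corner_extension M N (corner_map M f) m \<star> a i = f m \<star> a i" .
  qed
qed

lemma corner_map_bij:
  "bij_betw (corner_map M) (rmodule_hom A M N) (rmodule_hom B (corner M) (corner N))"
  by (rule bij_betw_byWitness[where f' = "corner_extension M N"])
    (auto simp: corner_map_extension corner_extension_map
      intro: corner_map_hom[OF M] corner_extension_hom)

lemma corner_map_iso:
  assumes f: "f \<in> rmodule_iso A M N"
  shows "corner_map M f \<in> rmodule_iso B (corner M) (corner N)"
proof -
  note hom = rmodule_isoD(1)[OF f]
  note f' = rmodule_homD(2-)[OF hom]
  have bij: "bij_betw f (carrier M) (carrier N)" by (rule rmodule_isoD(2)[OF f])
  have "x \<in> f ` carrier (corner M)" if "x \<in> carrier (corner N)" for x
  proof -
    have x: "x \<in> carrier N" "x \<star> e = x" using that by (auto simp: corner_carrier)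
    then obtain m where m: "m \<in> carrier M" "f m = x"
      using bij unfolding bij_betw_def by (metis imageE)
    then have "f (m \<cdot> e) = f m" using f' x e_closed by simp
    then have "m \<cdot> e = m"
      using bij m e_closed by (auto simp: bij_betw_def inj_on_def M.ract_closed)
    with m show ?thesis by (auto simp: corner_carrier)
  qed
  moreover have "inj_on f (carrier (corner M))"
    using bij by (auto simp: bij_betw_def corner_carrier inj_on_def)
  moreover have "f ` carrier (corner M) \<subseteq> carrier (corner N)"
    using rmodule_homD(2)[OF corner_map_hom[OF M hom]] by (auto simp: corner_map_def)
  ultimately have "bij_betw f (carrier (corner M)) (carrier (corner N))"
    by (auto simp: bij_betw_def)
  then have "bij_betw (corner_map M f) (carrier (corner M)) (carrier (corner N))"
    unfolding corner_map_def by (subst bij_betw_restrict_eq)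
  then show ?thesis using corner_map_hom[OF M hom] by (simp add: rmodule_iso_def)
qed

end

text \<open>
  The left ideal \<open>Ae\<close>, regarded as a right \<open>B\<close>-module; it is \<open>Me\<close> for \<open>M = A\<close>.
\<close>

abbreviation Ae :: "('b, 'a) rmodule" where "Ae \<equiv> corner (regular_rmodule A)"

lemma Ae_right_module: "right_module B Ae"
  by (rule corner_right_module[OF regular_right_module[OF A.ring_axioms]])

lemma Ae_carrier: "x \<in> carrier Ae \<longleftrightarrow> x \<in> carrier A \<and> x \<otimes> e = x"
  and Ae_simps: "\<zero>\<^bsub>Ae\<^esub> = \<zero>" "x \<oplus>\<^bsub>Ae\<^esub> y = x \<oplus> y" "x \<triangleleft>\<^bsub>Ae\<^esub> t = x \<otimes> \<phi> t"
  by (auto simp: corner_carrier corner_simps regular_rmodule_def)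

lemma Ae_mult: "\<lbrakk>r \<in> carrier A; x \<in> carrier Ae\<rbrakk> \<Longrightarrow> r \<otimes> x \<in> carrier Ae"
  using e_closed by (simp add: Ae_carrier A.m_assoc)

text \<open>
  The right \<open>A\<close>-module \<open>Hom\<^sub>B(Ae, N)\<close>, where \<open>A\<close> acts on a homomorphism through left
  multiplication on its argument.
\<close>

definition coinduced_rmodule :: "('b, 'n) rmodule \<Rightarrow> ('a, 'a \<Rightarrow> 'n) rmodule" where
  "coinduced_rmodule N = \<lparr>carrier = rmodule_hom B Ae N, mult = undefined, one = undefined,
     zero = (\<lambda>x\<in>carrier Ae. \<zero>\<^bsub>N\<^esub>), add = (\<lambda>h k. \<lambda>x\<in>carrier Ae. h x \<oplus>\<^bsub>N\<^esub> k x),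
     ract = (\<lambda>h r. \<lambda>x\<in>carrier Ae. h (r \<otimes> x))\<rparr>"

text \<open>
  The isomorphism \<open>N \<cong> Hom\<^sub>B(eAe, N) \<cong> Hom\<^sub>B(Ae, N) e\<close>; its inverse is evaluation at \<open>e\<close>.
\<close>

definition coinduced_unit :: "('b, 'n) rmodule \<Rightarrow> 'n \<Rightarrow> 'a \<Rightarrow> 'n" where
  "coinduced_unit N = (\<lambda>n\<in>carrier N. \<lambda>x\<in>carrier Ae. n \<triangleleft>\<^bsub>N\<^esub> \<psi> (e \<otimes> x))"

context
  fixes N :: "('b, 'n) rmodule"
  assumes N: "right_module B N"
begin

interpretation N: right_module B N by (rule N)

abbreviation Coind where "Coind \<equiv> coinduced_rmodule N"

lemma coinduced_simps: "carrier Coind = rmodule_hom B Ae N" "\<zero>\<^bsub>Coind\<^esub> = (\<lambda>x\<in>carrier Ae. \<zero>\<^bsub>N\<^esub>)"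
  "h \<oplus>\<^bsub>Coind\<^esub> k = (\<lambda>x\<in>carrier Ae. h x \<oplus>\<^bsub>N\<^esub> k x)" "h \<triangleleft>\<^bsub>Coind\<^esub> r = (\<lambda>x\<in>carrier Ae. h (r \<otimes> x))"
  by (simp_all add: coinduced_rmodule_def)

lemma coinduced_right_module: "right_module A Coind"
proof -
  note hom = rmodule_homD(2-)[where M = Ae and B = B, unfolded Ae_simps]
  have ext: "h = k" if "h \<in> carrier Coind" "k \<in> carrier Coind" "\<And>x. x \<in> carrier Ae \<Longrightarrow> h x = k x" for h k
    using that rmodule_hom_eqI unfolding coinduced_simps by blast
  have val: "h x \<in> carrier N" if "h \<in> carrier Coind" "x \<in> carrier Ae" for h x
    using that hom(1) unfolding coinduced_simps by blast
  have zero: "\<zero>\<^bsub>Coind\<^esub> \<in> carrier Coind"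
    unfolding coinduced_simps by (rule restrict_rmodule_hom[OF Ae_right_module]) (simp_all add: N.ract_l_null)
  have add: "h \<oplus>\<^bsub>Coind\<^esub> k \<in> carrier Coind" if "h \<in> carrier Coind" "k \<in> carrier Coind" for h k
  proof -
    note h = that[unfolded coinduced_simps]
    show ?thesis
      unfolding coinduced_simps by (rule restrict_rmodule_hom[OF Ae_right_module])
        (simp_all add: hom[OF h(1)] hom[OF h(2)] Ae_simps N.ract_l_distr N.M.a_ac)
  qed
  have act: "h \<triangleleft>\<^bsub>Coind\<^esub> r \<in> carrier Coind" if h: "h \<in> carrier Coind" and r: "r \<in> carrier A" for h r
  proof -
    note h' = hom[OF h[unfolded coinduced_simps]]
    show ?thesis
      unfolding coinduced_simps
    proof (rule restrict_rmodule_hom[OF Ae_right_module])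
      fix x y assume x: "x \<in> carrier Ae" and y: "y \<in> carrier Ae"
      show "h (r \<otimes> x) \<in> carrier N" by (rule h'(1)[OF Ae_mult[OF r x]])
      show "h (r \<otimes> (x \<oplus>\<^bsub>Ae\<^esub> y)) = h (r \<otimes> x) \<oplus>\<^bsub>N\<^esub> h (r \<otimes> y)"
        using r x y h'(2)[OF Ae_mult[OF r x] Ae_mult[OF r y]]
        by (simp add: Ae_simps Ae_carrier A.r_distr)
    next
      fix x t assume x: "x \<in> carrier Ae" and t: "t \<in> carrier B"
      show "h (r \<otimes> (x \<triangleleft>\<^bsub>Ae\<^esub> t)) = h (r \<otimes> x) \<triangleleft>\<^bsub>N\<^esub> t"
        using r x t h'(3)[OF Ae_mult[OF r x] t] by (simp add: Ae_simps Ae_carrier \<phi>_closed A.m_assoc)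
    qed
  qed
  have "abelian_group Coind"
  proof (rule abelian_groupI)
    fix h assume h: "h \<in> carrier Coind"
    note h' = hom[OF h[unfolded coinduced_simps]]
    have "h \<triangleleft>\<^bsub>Coind\<^esub> (\<ominus> \<one>) \<oplus>\<^bsub>Coind\<^esub> h = \<zero>\<^bsub>Coind\<^esub>"
    proof (rule ext)
      fix x assume x: "x \<in> carrier Ae"
      have "h (\<ominus> \<one> \<otimes> x) \<oplus>\<^bsub>N\<^esub> h x = h (\<ominus> \<one> \<otimes> x \<oplus> x)"
        by (rule h'(2)[symmetric]) (use x in \<open>simp_all add: Ae_mult\<close>)
      also have "\<ominus> \<one> \<otimes> x \<oplus> x = \<zero>" using x by (simp add: Ae_carrier A.l_minus A.l_neg)
      also have "h \<zero> = \<zero>\<^bsub>N\<^esub>"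
        using rmodule_hom_zero[OF Ae_right_module N h[unfolded coinduced_simps]] by (simp add: Ae_simps)
      finally show "(h \<triangleleft>\<^bsub>Coind\<^esub> (\<ominus> \<one>) \<oplus>\<^bsub>Coind\<^esub> h) x = \<zero>\<^bsub>Coind\<^esub> x"
        using x by (simp add: coinduced_simps)
    qed (use h zero add act in auto)
    then show "\<exists>k\<in>carrier Coind. k \<oplus>\<^bsub>Coind\<^esub> h = \<zero>\<^bsub>Coind\<^esub>"
      by (intro bexI[of _ "h \<triangleleft>\<^bsub>Coind\<^esub> (\<ominus> \<one>)"]) (simp_all add: h act)
  qed (auto intro!: ext simp: add zero, auto simp: coinduced_simps(2,3) val N.M.a_ac)
  moreover have "h ((r \<oplus> s) \<otimes> x) = h (r \<otimes> x) \<oplus>\<^bsub>N\<^esub> h (s \<otimes> x)"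
    if "h \<in> carrier Coind" "r \<in> carrier A" "s \<in> carrier A" "x \<in> carrier Ae" for h r s x
    using hom(2)[OF that(1)[unfolded coinduced_simps] Ae_mult[OF that(2,4)] Ae_mult[OF that(3,4)]] that
    by (simp add: Ae_carrier A.l_distr)
  moreover have "\<one> \<otimes> x = x" if "x \<in> carrier Ae" for x
    using that by (simp add: Ae_carrier)
  moreover have "(r \<otimes> s) \<otimes> x = r \<otimes> (s \<otimes> x)"
    if "r \<in> carrier A" "s \<in> carrier A" "x \<in> carrier Ae" for r s x
    using that by (simp_all add: Ae_carrier A.m_assoc)
  ultimately show ?thesis
    by (intro right_module.intro right_module_axioms.intro A.ring_axioms)
      (auto intro!: ext simp: add act, auto simp: coinduced_simps(3,4) Ae_mult)
qed

interpretation Coind: right_module A Coind by (rule coinduced_right_module)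

lemma \<psi>_e_Ae:
  assumes "x \<in> carrier Ae"
  shows "\<psi> (e \<otimes> x) \<in> carrier B" "\<phi> (\<psi> (e \<otimes> x)) = e \<otimes> x"
  using \<psi>_corner[of e x] assms e_closed e_e by (simp_all add: Ae_carrier)

lemma coinduced_unit_closed: "n \<in> carrier N \<Longrightarrow> coinduced_unit N n \<in> carrier Coind"
proof -
  assume n: "n \<in> carrier N"
  have add: "\<psi> (e \<otimes> (x \<oplus> y)) = \<psi> (e \<otimes> x) \<oplus>\<^bsub>B\<^esub> \<psi> (e \<otimes> y)" if "x \<in> carrier Ae" "y \<in> carrier Ae" for x y
    by (rule \<psi>_eqI) (use that e_closed in \<open>auto simp: \<psi>_e_Ae \<phi>_add Ae_carrier A.r_distr\<close>)
  have mult: "\<psi> (e \<otimes> (x \<otimes> \<phi> t)) = \<psi> (e \<otimes> x) \<otimes>\<^bsub>B\<^esub> t" if "x \<in> carrier Ae" "t \<in> carrier B" for x t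
    by (rule \<psi>_eqI) (use that e_closed in \<open>auto simp: \<psi>_e_Ae \<phi>_mult \<phi>_closed Ae_carrier A.m_assoc\<close>)
  have "(\<lambda>x\<in>carrier Ae. n \<triangleleft>\<^bsub>N\<^esub> \<psi> (e \<otimes> x)) \<in> rmodule_hom B Ae N"
    by (rule restrict_rmodule_hom[OF Ae_right_module])
      (simp_all add: n N.ract_closed \<psi>_e_Ae Ae_simps add mult N.ract_r_distr N.ract_assoc)
  then show ?thesis using n by (simp add: coinduced_unit_def coinduced_simps)
qed

lemma coinduced_unit_iso: "coinduced_unit N \<in> rmodule_iso B N (corner Coind)"
proof -
  have e_Ae: "e \<in> carrier Ae" by (simp add: Ae_carrier e_closed e_e)
  have e_ex: "e \<otimes> (e \<otimes> x) = e \<otimes> x" if "x \<in> carrier Ae" for x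
    using that e_closed by (simp add: Ae_carrier A.m_assoc[symmetric] e_e)
  have inner: "n \<triangleleft>\<^bsub>N\<^esub> \<psi> (e \<otimes> (\<phi> t \<otimes> x)) = n \<triangleleft>\<^bsub>N\<^esub> t \<triangleleft>\<^bsub>N\<^esub> \<psi> (e \<otimes> x)"
    if "n \<in> carrier N" "t \<in> carrier B" "x \<in> carrier Ae" for n t x
  proof -
    have xA: "x \<in> carrier A" using that(3) by (simp add: Ae_carrier)
    have "\<phi> t \<otimes> (e \<otimes> x) = e \<otimes> (\<phi> t \<otimes> x)"
      using xA that(2) e_closed \<phi>_closed[OF that(2)] e_\<phi>[OF that(2)] \<phi>_e[OF that(2)] by (metis A.m_assoc)
    then have "\<psi> (e \<otimes> (\<phi> t \<otimes> x)) = t \<otimes>\<^bsub>B\<^esub> \<psi> (e \<otimes> x)"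
      using that by (intro \<psi>_eqI) (simp_all add: \<phi>_mult \<psi>_e_Ae)
    then show ?thesis using that by (simp add: N.ract_assoc \<psi>_e_Ae)
  qed
  have "restrict (coinduced_unit N) (carrier N) \<in> rmodule_hom B N (corner Coind)"
  proof (rule restrict_rmodule_hom[OF N])
    fix n assume n: "n \<in> carrier N"
    have "(\<lambda>x\<in>carrier Ae. coinduced_unit N n (e \<otimes> x)) = coinduced_unit N n"
      using n e_closed by (auto simp: coinduced_unit_def Ae_mult e_ex intro!: restrict_ext)
    then show "coinduced_unit N n \<in> carrier (corner Coind)"
      using n by (simp add: corner_carrier coinduced_simps(4) coinduced_unit_closed)
  next
    fix n k assume "n \<in> carrier N" "k \<in> carrier N"
    then show "coinduced_unit N (n \<oplus>\<^bsub>N\<^esub> k) = coinduced_unit N n \<oplus>\<^bsub>corner Coind\<^esub> coinduced_unit N k"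
      by (auto simp: corner_simps coinduced_simps coinduced_unit_def N.ract_l_distr \<psi>_e_Ae
          intro!: restrict_ext)
  next
    fix n t assume "n \<in> carrier N" "t \<in> carrier B"
    then show "coinduced_unit N (n \<triangleleft>\<^bsub>N\<^esub> t) = coinduced_unit N n \<triangleleft>\<^bsub>corner Coind\<^esub> t"
      by (auto simp: corner_simps coinduced_simps coinduced_unit_def N.ract_closed inner Ae_mult \<phi>_closed
          intro!: restrict_ext)
  qed
  moreover have "restrict (coinduced_unit N) (carrier N) = coinduced_unit N" by (simp add: coinduced_unit_def)
  ultimately have hom: "coinduced_unit N \<in> rmodule_hom B N (corner Coind)" by simp
  have "bij_betw (coinduced_unit N) (carrier N) (carrier (corner Coind))"
  proof (rule bij_betw_byWitness[where f' = "\<lambda>h. h e"])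
    have "\<psi> (e \<otimes> e) = \<one>\<^bsub>B\<^esub>" by (rule \<psi>_eqI) (simp_all add: e_e \<phi>_one)
    then show "\<forall>n\<in>carrier N. coinduced_unit N n e = n"
      by (simp add: coinduced_unit_def e_Ae N.ract_one)
    show "\<forall>h\<in>carrier (corner Coind). coinduced_unit N (h e) = h"
    proof
      fix h assume "h \<in> carrier (corner Coind)"
      then have h: "h \<in> rmodule_hom B Ae N" and he: "(\<lambda>x\<in>carrier Ae. h (e \<otimes> x)) = h"
        by (simp_all add: corner_carrier coinduced_simps)
      note h' = rmodule_homD(2-)[OF h, unfolded Ae_simps]
      have "coinduced_unit N (h e) = (\<lambda>x\<in>carrier Ae. h (e \<otimes> x))"
        using h'(3)[OF e_Ae, symmetric] h'(1)[OF e_Ae]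
        by (auto simp: coinduced_unit_def \<psi>_e_Ae e_ex intro!: restrict_ext)
      with he show "coinduced_unit N (h e) = h" by simp
    qed
    show "coinduced_unit N ` carrier N \<subseteq> carrier (corner Coind)" using rmodule_homD(2)[OF hom] by auto
    show "(\<lambda>h. h e) ` carrier (corner Coind) \<subseteq> carrier N"
      using rmodule_homD(2)[OF _ e_Ae] by (auto simp: corner_carrier coinduced_simps)
  qed
  with hom show ?thesis by (simp add: rmodule_iso_def)
qed

lemma coinduced_finsum:
  assumes "finite J" "\<And>j. j \<in> J \<Longrightarrow> f j \<in> carrier Coind"
  shows "(\<Oplus>\<^bsub>Coind\<^esub>j\<in>J. f j) = (\<lambda>x\<in>carrier Ae. \<Oplus>\<^bsub>N\<^esub>j\<in>J. f j x)"
  using assms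
proof (induction J rule: finite_induct)
  case (insert j J)
  then have f: "f \<in> J \<rightarrow> carrier Coind" "f j \<in> carrier Coind" by auto
  have "f i x \<in> carrier N" if "i \<in> insert j J" "x \<in> carrier Ae" for i x
    using rmodule_homD(2)[OF insert.prems[OF that(1), unfolded coinduced_simps] that(2)] .
  with insert f show ?case by (auto simp: coinduced_simps(3) intro!: restrict_ext)
qed (simp add: coinduced_simps)

text \<open>
  Let \<open>\<iota>\<close> be the isomorphism from \<open>N\<close> to \<open>Hom\<^sub>B(Ae, N) e\<close>. If \<open>S\<close> generates \<open>N\<close>, then \<open>\<iota> S\<close> generates
  the coinduced module: \<open>x = \<Sum> a\<^sub>i (b\<^sub>i x)\<close> for \<open>x \<in> Ae\<close> gives \<open>h = \<Sum> \<iota> (h a\<^sub>i) b\<^sub>i\<close> for every \<open>h\<close>.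
\<close>

lemma coinduced_finitely_generated:
  assumes "finitely_generated B N"
  shows "finitely_generated A Coind"
proof -
  obtain S where S: "finite S" "S \<subseteq> carrier N"
      "\<And>L. right_submodule B N L \<Longrightarrow> S \<subseteq> L \<Longrightarrow> carrier N \<subseteq> L"
    using assms N.finitely_generated_iff by auto
  note hom = rmodule_homD(2-)[OF rmodule_isoD(1)[OF coinduced_unit_iso], unfolded corner_simps]
  have gen: "carrier Coind \<subseteq> L"
    if L: "right_submodule A Coind L" "coinduced_unit N ` S \<subseteq> L" for L
  proof
    note L' = Coind.right_submoduleD[OF L(1)]
    have "right_submodule B N {n \<in> carrier N. coinduced_unit N n \<in> L}"
    proof (rule N.right_submoduleI)
      show "\<zero>\<^bsub>N\<^esub> \<in> {n \<in> carrier N. coinduced_unit N n \<in> L}"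
        using L'(2) rmodule_hom_zero[OF N corner_right_module[OF coinduced_right_module]
            rmodule_isoD(1)[OF coinduced_unit_iso]] by (simp add: corner_simps)
    qed (use L' hom \<phi>_closed N.ract_closed in auto)
    moreover have "S \<subseteq> {n \<in> carrier N. coinduced_unit N n \<in> L}" using S(2) L(2) by auto
    ultimately have T: "carrier N \<subseteq> {n \<in> carrier N. coinduced_unit N n \<in> L}" by (rule S(3))
    fix h assume h: "h \<in> carrier Coind"
    then have h_hom: "h \<in> rmodule_hom B Ae N" by (simp add: coinduced_simps)
    note h' = rmodule_homD(2-)[OF h_hom]
    have aAe: "a i \<in> carrier Ae" if "i \<in> I" for i using that by (simp add: Ae_carrier a_closed a_e)
    let ?u = "\<lambda>i. coinduced_unit N (h (a i)) \<triangleleft>\<^bsub>Coind\<^esub> b i"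
    have uL: "?u i \<in> L" if "i \<in> I" for i
      using T h'(1)[OF aAe[OF that]] that by (intro L'(4)) (auto simp: b_closed)
    have "(\<Oplus>\<^bsub>Coind\<^esub>i\<in>I. ?u i) = (\<lambda>x\<in>carrier Ae. \<Oplus>\<^bsub>N\<^esub>i\<in>I. ?u i x)"
      by (rule coinduced_finsum[OF finite_I]) (use uL L'(1) in auto)
    also have "\<dots> = (\<lambda>x\<in>carrier Ae. h x)"
    proof (rule restrict_ext)
      fix x assume x: "x \<in> carrier Ae"
      then have xA: "x \<in> carrier A" "x \<otimes> e = x" by (auto simp: Ae_carrier)
      have bx: "\<psi> (b i \<otimes> x) \<in> carrier B" "e \<otimes> (b i \<otimes> x) = b i \<otimes> x" if "i \<in> I" for i
        using \<psi>_corner(1)[of "b i" x] that xA e_closed A.m_assoc[of e "b i" x] by (simp_all add: b_closed e_b)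
      interpret Ae: right_module B Ae by (rule Ae_right_module)
      have "(\<Oplus>\<^bsub>N\<^esub>i\<in>I. ?u i x) = (\<Oplus>\<^bsub>N\<^esub>i\<in>I. h (a i \<triangleleft>\<^bsub>Ae\<^esub> \<psi> (b i \<otimes> x)))"
        by (rule N.M.finsum_cong') (use x bx h' aAe in \<open>auto simp: coinduced_simps(4)
            coinduced_unit_def Ae_mult b_closed intro!: N.ract_closed\<close>)
      also have "\<dots> = h (\<Oplus>\<^bsub>Ae\<^esub>i\<in>I. a i \<triangleleft>\<^bsub>Ae\<^esub> \<psi> (b i \<otimes> x))"
        by (rule rmodule_hom_finsum[OF Ae_right_module N h_hom finite_I, symmetric])
          (use bx aAe Ae.ract_closed in auto)
      also have "(\<Oplus>\<^bsub>Ae\<^esub>i\<in>I. a i \<triangleleft>\<^bsub>Ae\<^esub> \<psi> (b i \<otimes> x)) = (\<Oplus>\<^bsub>Ae\<^esub>i\<in>I. (\<one> \<otimes> a i) \<triangleleft>\<^bsub>Ae\<^esub> \<psi> (b i \<otimes> x))"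
        by (rule Ae.M.finsum_cong') (use bx aAe Ae.ract_closed in \<open>auto simp: a_closed\<close>)
      also have "\<dots> = x"
        using ract_column[OF regular_right_module[OF A.ring_axioms], of \<one> x] xA
        by (simp add: regular_rmodule_def)
      finally show "(\<Oplus>\<^bsub>N\<^esub>i\<in>I. ?u i x) = h x" .
    qed
    also have "\<dots> = h" using rmodule_homD(1)[OF h_hom] by (rule PiE_restrict)
    finally show "h \<in> L" using Coind.right_submodule_finsum[OF L(1) finite_I, of ?u] uL by simp
  qed
  have "finite (coinduced_unit N ` S)" using S(1) by simp
  moreover have "coinduced_unit N ` S \<subseteq> carrier Coind" using S(2) coinduced_unit_closed by auto
  ultimately show ?thesis
    unfolding Coind.finitely_generated_iff
    using gen by (intro exI[of _ "coinduced_unit N ` S"] conjI allI impI) auto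
qed

end

end

section \<open>Morita equivalence with a full corner\<close>

lemma rmodule_hom_conjugation_bij:
  assumes M: "right_module B M" and M': "right_module B M'"
    and N: "right_module B N" and N': "right_module B N'"
    and f: "f \<in> rmodule_iso B M M'" and g: "g \<in> rmodule_iso B M' M"
    and gf: "\<And>x. x \<in> carrier M \<Longrightarrow> g (f x) = x" and fg: "\<And>y. y \<in> carrier M' \<Longrightarrow> f (g y) = y"
    and h: "h \<in> rmodule_iso B N N'"
  shows "bij_betw (\<lambda>k. compose (carrier M') h (compose (carrier M') k g))
    (rmodule_hom B M N) (rmodule_hom B M' N')"
proof -
  obtain h' where h': "h' \<in> rmodule_iso B N' N"
    "\<And>x. x \<in> carrier N \<Longrightarrow> h' (h x) = x" "\<And>y. y \<in> carrier N' \<Longrightarrow> h (h' y) = y"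
    by (rule rmodule_iso_inverse[OF N N' h], rule that)
  note homs = rmodule_isoD(1)[OF f] rmodule_isoD(1)[OF g] rmodule_isoD(1)[OF h]
    rmodule_isoD(1)[OF h'(1)]
  note cl = rmodule_homD(2)[OF homs(1)] rmodule_homD(2)[OF homs(2)]
  let ?F = "\<lambda>k. compose (carrier M') h (compose (carrier M') k g)"
  let ?G = "\<lambda>k. compose (carrier M) h' (compose (carrier M) k f)"
  have F: "?F k \<in> rmodule_hom B M' N'" if "k \<in> rmodule_hom B M N" for k
    using compose_rmodule_hom[OF M' compose_rmodule_hom[OF M' homs(2) that] homs(3)] .
  have G: "?G k \<in> rmodule_hom B M N" if "k \<in> rmodule_hom B M' N'" for k
    using compose_rmodule_hom[OF M compose_rmodule_hom[OF M homs(1) that] homs(4)] .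
  have "?G (?F k) = k" if k: "k \<in> rmodule_hom B M N" for k
    by (rule rmodule_hom_eqI[OF G[OF F[OF k]] k])
      (simp add: compose_eq cl gf h'(2) rmodule_homD(2)[OF k])
  moreover have "?F (?G k) = k" if k: "k \<in> rmodule_hom B M' N'" for k
    by (rule rmodule_hom_eqI[OF F[OF G[OF k]] k])
      (simp add: compose_eq cl fg h'(3) rmodule_homD(2)[OF k])
  ultimately show ?thesis
    by (intro bij_betw_byWitness[where f' = ?G]) (auto intro: F G)
qed

context full_corner
begin

text \<open>
  The functor is \<open>M \<mapsto> Me\<close>, followed by the passage to a copy of \<open>Me\<close> in the type prescribed for the
  objects; on homomorphisms this is restriction to \<open>Me\<close>, followed by conjugation.
\<close>

theorem corner_equivalence: "equivalent_categories (fg_right_modules A) (fg_right_modules B)"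
proof -
  let ?C = "fg_right_modules A" and ?D = "fg_right_modules B"
  have C: "M \<in> Obj ?C \<longleftrightarrow> right_module A M \<and> finitely_generated A M" for M
    by (simp add: fg_right_modules_def)
  have D: "N \<in> Obj ?D \<longleftrightarrow> right_module B N \<and> finitely_generated B N" for N
    by (simp add: fg_right_modules_def)
  define copy where "copy M N f g \<longleftrightarrow> N \<in> Obj ?D \<and> f \<in> rmodule_iso B (corner M) N \<and>
      g \<in> rmodule_iso B N (corner M) \<and> (\<forall>x\<in>carrier (corner M). g (f x) = x) \<and>
      (\<forall>y\<in>carrier N. f (g y) = y)"
    for M :: "('a, (nat \<Rightarrow> 'a) set) rmodule" and N :: "('b, (nat \<Rightarrow> 'b) set) rmodule" and f g
  have "\<exists>N f g. copy M N f g" if "M \<in> Obj ?C" for M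
  proof -
    have M: "right_module A M" "finitely_generated A M" using that by (simp_all add: C)
    note cM = corner_right_module[OF M(1)]
    obtain N :: "('b, (nat \<Rightarrow> 'b) set) rmodule" and f where
      N: "right_module B N" "finitely_generated B N" "f \<in> rmodule_iso B (corner M) N"
      using finitely_generated_copy[OF cM corner_finitely_generated[OF M]] by metis
    obtain g where "g \<in> rmodule_iso B N (corner M)"
        "\<And>x. x \<in> carrier (corner M) \<Longrightarrow> g (f x) = x" "\<And>y. y \<in> carrier N \<Longrightarrow> f (g y) = y"
      by (rule rmodule_iso_inverse[OF cM N(1,3)], rule that)
    with N have "copy M N f g" by (simp add: copy_def D)
    then show ?thesis by blast
  qed
  then obtain Fo \<sigma> \<tau> where "\<And>M. M \<in> Obj ?C \<Longrightarrow> copy M (Fo M) (\<sigma> M) (\<tau> M)" by metis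
  note * = this[unfolded copy_def]
  have Fo: "Fo M \<in> Obj ?D" and \<sigma>: "\<sigma> M \<in> rmodule_iso B (corner M) (Fo M)"
    and \<tau>: "\<tau> M \<in> rmodule_iso B (Fo M) (corner M)"
    and \<tau>\<sigma>: "\<And>x. x \<in> carrier (corner M) \<Longrightarrow> \<tau> M (\<sigma> M x) = x"
    and \<sigma>\<tau>: "\<And>y. y \<in> carrier (Fo M) \<Longrightarrow> \<sigma> M (\<tau> M y) = y" if "M \<in> Obj ?C" for M
    using * that by simp_all
  have FoM: "right_module B (Fo M)" and cM: "right_module B (corner M)" and MA: "right_module A M"
    if "M \<in> Obj ?C" for M
    using Fo[OF that] that corner_right_module[of M] by (simp_all add: C D)
  define Fa where "Fa M N f = compose (carrier (Fo M)) (\<sigma> N)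
      (compose (carrier (Fo M)) (corner_map M f) (\<tau> M))" for M N f
  have bij: "bij_betw (Fa M N) (Hom ?C M N) (Hom ?D (Fo M) (Fo N))"
    if M: "M \<in> Obj ?C" and N: "N \<in> Obj ?C" for M N
  proof -
    have "bij_betw ((\<lambda>k. compose (carrier (Fo M)) (\<sigma> N) (compose (carrier (Fo M)) k (\<tau> M))) \<circ>
        corner_map M) (rmodule_hom A M N) (rmodule_hom B (Fo M) (Fo N))"
      by (rule bij_betw_trans[OF corner_map_bij[OF MA[OF M] MA[OF N]]
            rmodule_hom_conjugation_bij[OF cM[OF M] FoM[OF M] cM[OF N] FoM[OF N] \<sigma>[OF M] \<tau>[OF M]
              \<tau>\<sigma>[OF M] \<sigma>\<tau>[OF M] \<sigma>[OF N]]])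
    moreover have "(\<lambda>k. compose (carrier (Fo M)) (\<sigma> N) (compose (carrier (Fo M)) k (\<tau> M))) \<circ>
        corner_map M = Fa M N"
      by (rule ext) (simp add: Fa_def)
    ultimately show ?thesis by (simp add: fg_right_modules_def)
  qed
  have \<tau>c: "\<tau> M y \<in> carrier (corner M)" if "M \<in> Obj ?C" "y \<in> carrier (Fo M)" for M y
    using rmodule_homD(2)[OF rmodule_isoD(1)[OF \<tau>]] that by blast
  have cmap: "corner_map M f x \<in> carrier (corner N)"
    if "M \<in> Obj ?C" "f \<in> rmodule_hom A M N" "x \<in> carrier (corner M)" for M N f x
    using rmodule_homD(2)[OF corner_map_hom[OF MA]] that by blast
  have "is_functor ?C ?D Fo Fa"
    unfolding is_functor_def
  proof (intro conjI ballI)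
    fix M assume M: "M \<in> Obj ?C"
    show "Fo M \<in> Obj ?D" by (rule Fo[OF M])
    have "corner_map M (\<lambda>x\<in>carrier M. x) x = x" if "x \<in> carrier (corner M)" for x
      using that by (simp add: corner_map_def corner_carrier)
    then have "Fa M M (\<lambda>x\<in>carrier M. x) = (\<lambda>x\<in>carrier (Fo M). x)"
      by (auto simp: Fa_def compose_def \<sigma>\<tau>[OF M] \<tau>c[OF M] intro!: restrict_ext)
    then show "Fa M M (Ident ?C M) = Ident ?D (Fo M)"
      by (simp add: fg_right_modules_def)
  next
    fix M N f assume "M \<in> Obj ?C" "N \<in> Obj ?C" "f \<in> Hom ?C M N"
    then show "Fa M N f \<in> Hom ?D (Fo M) (Fo N)" using bij_betwE[OF bij] by blast
  next
    fix L M N f g assume L: "L \<in> Obj ?C" and M: "M \<in> Obj ?C" and N: "N \<in> Obj ?C"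
      and f: "f \<in> Hom ?C L M" and g: "g \<in> Hom ?C M N"
    have f': "f \<in> rmodule_hom A L M" and g': "g \<in> rmodule_hom A M N"
      using f g by (simp_all add: fg_right_modules_def)
    have 1: "corner_map L (compose (carrier L) g f) x = corner_map M g (corner_map L f x)"
      if "x \<in> carrier (corner L)" for x
      using that cmap[OF L f' that] by (simp add: corner_map_def compose_eq corner_carrier)
    have 2: "compose (carrier (Fo L)) (\<sigma> M) (compose (carrier (Fo L)) (corner_map L f) (\<tau> L)) x
        \<in> carrier (Fo M)" if "x \<in> carrier (Fo L)" for x
      using that rmodule_homD(2)[OF rmodule_isoD(1)[OF \<sigma>[OF M]]] cmap[OF L f' \<tau>c[OF L that]]
      by (simp add: compose_eq)
    have "Fa L N (compose (carrier L) g f) = compose (carrier (Fo L)) (Fa M N g) (Fa L M f)"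
      unfolding compose_def[of "carrier (Fo L)" "Fa M N g"] unfolding Fa_def
      unfolding compose_def[of "carrier (Fo L)" "\<sigma> N"]
    proof (rule restrict_ext)
      fix x assume x: "x \<in> carrier (Fo L)"
      show "\<sigma> N (compose (carrier (Fo L)) (corner_map L (compose (carrier L) g f)) (\<tau> L) x) =
          compose (carrier (Fo M)) (\<sigma> N) (compose (carrier (Fo M)) (corner_map M g) (\<tau> M))
           (compose (carrier (Fo L)) (\<sigma> M) (compose (carrier (Fo L)) (corner_map L f) (\<tau> L)) x)"
        using 2[OF x] x cmap[OF L f' \<tau>c[OF L x]]
        by (simp add: compose_eq 1 \<tau>c[OF L] \<tau>\<sigma>[OF M])
    qed
    then show "Fa L N (Comp ?C L M N g f) = Comp ?D (Fo L) (Fo M) (Fo N) (Fa M N g) (Fa L M f)"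
      by (simp add: fg_right_modules_def)
  qed
  moreover have "\<exists>M\<in>Obj ?C. \<exists>f. is_iso ?D (Fo M) N f" if "N \<in> Obj ?D" for N
  proof -
    have N: "right_module B N" "finitely_generated B N" using that by (simp_all add: D)
    note ind = coinduced_right_module[OF N(1)]
    obtain M :: "('a, (nat \<Rightarrow> 'a) set) rmodule" and f where
      M: "right_module A M" "finitely_generated A M" and f: "f \<in> rmodule_iso A (coinduced_rmodule N) M"
      using finitely_generated_copy[OF ind coinduced_finitely_generated[OF N]] by metis
    have MC: "M \<in> Obj ?C" using M by (simp add: C)
    have 1: "corner_map (coinduced_rmodule N) f \<in> rmodule_iso B (corner (coinduced_rmodule N)) (corner M)"
      by (rule corner_map_iso[OF ind M(1) f])
    note 2 = compose_rmodule_iso[OF N(1) coinduced_unit_iso[OF N(1)] 1]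
    note 3 = compose_rmodule_iso[OF N(1) 2 \<sigma>[OF MC]]
    obtain g where "g \<in> rmodule_iso B (Fo M) N"
      by (rule rmodule_iso_inverse[OF N(1) FoM[OF MC] 3])
    then show ?thesis
      using is_iso_fg_right_modules[OF Fo[OF MC] that] MC by blast
  qed
  ultimately show ?thesis
    using equivalent_categories_fully_faithful[OF fg_right_modules_category fg_right_modules_category]
      bij by blast
qed

end

section \<open>Algebras\<close>

lemma is_algebraD:
  fixes A (structure)
  assumes "is_algebra K A"
  shows "field K" "vectorspace K A" "module K A" "ring A"
    and "\<And>a x y. \<lbrakk>a \<in> carrier K; x \<in> carrier A; y \<in> carrier A\<rbrakk>
      \<Longrightarrow> (a \<odot> x) \<otimes> y = a \<odot> (x \<otimes> y)"
    and "\<And>a x y. \<lbrakk>a \<in> carrier K; x \<in> carrier A; y \<in> carrier A\<rbrakk>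
      \<Longrightarrow> x \<otimes> (a \<odot> y) = a \<odot> (x \<otimes> y)"
  using assms by (auto simp: is_algebra_def vectorspace_def)

lemma is_algebraI:
  fixes A (structure)
  assumes "field K" "module K A" "ring A"
    and "\<And>a x y. \<lbrakk>a \<in> carrier K; x \<in> carrier A; y \<in> carrier A\<rbrakk>
      \<Longrightarrow> (a \<odot> x) \<otimes> y = a \<odot> (x \<otimes> y)"
    and "\<And>a x y. \<lbrakk>a \<in> carrier K; x \<in> carrier A; y \<in> carrier A\<rbrakk>
      \<Longrightarrow> x \<otimes> (a \<odot> y) = a \<odot> (x \<otimes> y)"
  shows "is_algebra K A"
  using assms by (auto simp: is_algebra_def intro: vectorspace.intro)

text \<open>
  The unit of \<open>B\<close> is only required to go to a unit for the image of \<open>f\<close>; this covers the inclusion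
  of \<open>eAe\<close> in \<open>A\<close>.
\<close>

lemma is_algebra_inj_transport:
  fixes A (structure)
  assumes A: "is_algebra K A"
    and f: "\<And>x. x \<in> carrier B \<Longrightarrow> f x \<in> carrier A" and inj: "inj_on f (carrier B)"
    and zero: "\<zero>\<^bsub>B\<^esub> \<in> carrier B" "f \<zero>\<^bsub>B\<^esub> = \<zero>"
    and add: "\<And>x y. \<lbrakk>x \<in> carrier B; y \<in> carrier B\<rbrakk> \<Longrightarrow> x \<oplus>\<^bsub>B\<^esub> y \<in> carrier B"
      "\<And>x y. \<lbrakk>x \<in> carrier B; y \<in> carrier B\<rbrakk> \<Longrightarrow> f (x \<oplus>\<^bsub>B\<^esub> y) = f x \<oplus> f y"
    and mult: "\<And>x y. \<lbrakk>x \<in> carrier B; y \<in> carrier B\<rbrakk> \<Longrightarrow> x \<otimes>\<^bsub>B\<^esub> y \<in> carrier B"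
      "\<And>x y. \<lbrakk>x \<in> carrier B; y \<in> carrier B\<rbrakk> \<Longrightarrow> f (x \<otimes>\<^bsub>B\<^esub> y) = f x \<otimes> f y"
    and smult: "\<And>a x. \<lbrakk>a \<in> carrier K; x \<in> carrier B\<rbrakk> \<Longrightarrow> a \<odot>\<^bsub>B\<^esub> x \<in> carrier B"
      "\<And>a x. \<lbrakk>a \<in> carrier K; x \<in> carrier B\<rbrakk> \<Longrightarrow> f (a \<odot>\<^bsub>B\<^esub> x) = a \<odot> f x"
    and one: "\<one>\<^bsub>B\<^esub> \<in> carrier B" "\<And>x. x \<in> carrier B \<Longrightarrow> f \<one>\<^bsub>B\<^esub> \<otimes> f x = f x"
      "\<And>x. x \<in> carrier B \<Longrightarrow> f x \<otimes> f \<one>\<^bsub>B\<^esub> = f x"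
  shows "is_algebra K B"
proof -
  interpret K: field K by (rule is_algebraD(1)[OF A])
  interpret R: ring A by (rule is_algebraD(4)[OF A])
  interpret A: module K A by (rule is_algebraD(3)[OF A])
  note A' = is_algebraD(5,6)[OF A]
  have eq: "x = y" if "x \<in> carrier B" "y \<in> carrier B" "f x = f y" for x y
    using inj that by (auto simp: inj_on_def)
  have grp: "abelian_group B"
  proof (rule abelian_groupI)
    fix x assume x: "x \<in> carrier B"
    show "\<exists>y\<in>carrier B. y \<oplus>\<^bsub>B\<^esub> x = \<zero>\<^bsub>B\<^esub>"
    proof (intro bexI eq)
      show "f ((\<ominus>\<^bsub>K\<^esub> \<one>\<^bsub>K\<^esub>) \<odot>\<^bsub>B\<^esub> x \<oplus>\<^bsub>B\<^esub> x) = f \<zero>\<^bsub>B\<^esub>"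
        using x f[OF x] by (simp add: add smult zero A.smult_l_minus R.l_neg)
    qed (use x zero add smult in auto)
  qed (auto intro!: eq simp: f zero add R.a_ac)
  moreover have "monoid B"
    by (rule monoidI) (auto intro!: eq simp: f mult one R.m_assoc)
  ultimately have "ring B"
    by (intro ringI) (auto intro!: eq simp: f mult add R.l_distr R.r_distr)
  moreover have "module K B"
    by (rule moduleI[OF K.is_cring grp])
      (auto intro!: eq simp: f add smult A.smult_l_distr A.smult_r_distr A.smult_assoc1)
  ultimately show ?thesis
    by (intro is_algebraI K.field_axioms) (auto intro!: eq simp: f mult smult A')
qed

lemma scalar_one_closed:
  fixes A (structure)
  assumes A: "is_algebra K A" and a: "a \<in> carrier K"
  shows "a \<odot> \<one> \<in> carrier A"
proof -
  interpret R: ring A by (rule is_algebraD(4)[OF A])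
  interpret A: module K A by (rule is_algebraD(3)[OF A])
  show ?thesis using a by simp
qed

text \<open>
  The elements \<open>a 1\<close> are central; through them the scalars act on modules and endomorphisms.
\<close>

lemma scalar_one_central:
  fixes A (structure)
  assumes A: "is_algebra K A" and a: "a \<in> carrier K" and r: "r \<in> carrier A"
  shows "(a \<odot> \<one>) \<otimes> r = a \<odot> r" "r \<otimes> (a \<odot> \<one>) = a \<odot> r"
proof -
  interpret R: ring A by (rule is_algebraD(4)[OF A])
  interpret A: module K A by (rule is_algebraD(3)[OF A])
  show "(a \<odot> \<one>) \<otimes> r = a \<odot> r" "r \<otimes> (a \<odot> \<one>) = a \<odot> r"
    using a r is_algebraD(5,6)[OF A] by simp_all
qed

lemma is_algebra_surj_transport:
  fixes A (structure)
  assumes A: "is_algebra K A" and surj: "f ` carrier A = carrier B"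
    and zero: "f \<zero> = \<zero>\<^bsub>B\<^esub>" and one: "f \<one> = \<one>\<^bsub>B\<^esub>"
    and add: "\<And>x y. \<lbrakk>x \<in> carrier A; y \<in> carrier A\<rbrakk> \<Longrightarrow> f x \<oplus>\<^bsub>B\<^esub> f y = f (x \<oplus> y)"
    and mult: "\<And>x y. \<lbrakk>x \<in> carrier A; y \<in> carrier A\<rbrakk> \<Longrightarrow> f x \<otimes>\<^bsub>B\<^esub> f y = f (x \<otimes> y)"
    and smult: "\<And>a x. \<lbrakk>a \<in> carrier K; x \<in> carrier A\<rbrakk> \<Longrightarrow> a \<odot>\<^bsub>B\<^esub> f x = f (a \<odot> x)"
  shows "is_algebra K B"
proof -
  interpret K: field K by (rule is_algebraD(1)[OF A])
  interpret R: ring A by (rule is_algebraD(4)[OF A])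
  interpret A: module K A by (rule is_algebraD(3)[OF A])
  have B: "x \<in> carrier B \<longleftrightarrow> (\<exists>a\<in>carrier A. x = f a)" for x using surj by auto
  note simps = zero[symmetric] one[symmetric] add mult smult
  have fB: "f a \<in> carrier B" if "a \<in> carrier A" for a using that B by blast
  have grp: "abelian_group B"
  proof (rule abelian_groupI)
    fix x assume "x \<in> carrier B"
    then obtain a where a: "a \<in> carrier A" "x = f a" using B by blast
    then show "\<exists>y\<in>carrier B. y \<oplus>\<^bsub>B\<^esub> x = \<zero>\<^bsub>B\<^esub>"
      by (intro bexI[of _ "f (\<ominus> a)"]) (simp_all add: simps R.l_neg fB)
  qed (auto simp: B simps R.a_ac)
  have mon: "monoid B" by (rule monoidI) (auto simp: B simps R.m_assoc)
  have ring: "ring B" by (rule ringI[OF grp mon]) (auto simp: B simps R.l_distr R.r_distr)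
  have "module K B"
    by (rule moduleI[OF K.is_cring grp])
      (auto simp: B simps A.smult_l_distr A.smult_r_distr A.smult_assoc1)
  then show ?thesis
    by (rule is_algebraI[OF K.field_axioms _ ring])
      (auto simp: B simps is_algebraD(5,6)[OF A])
qed

lemma quotient_algebra_simps:
  "carrier (quotient_algebra A I) = (\<lambda>x. I +>\<^bsub>A\<^esub> x) ` carrier A"
  "\<zero>\<^bsub>quotient_algebra A I\<^esub> = I" "\<one>\<^bsub>quotient_algebra A I\<^esub> = I +>\<^bsub>A\<^esub> \<one>\<^bsub>A\<^esub>"
  "X \<oplus>\<^bsub>quotient_algebra A I\<^esub> Y = X <+>\<^bsub>A\<^esub> Y"
  "X \<otimes>\<^bsub>quotient_algebra A I\<^esub> Y = [mod I:] X \<Otimes>\<^bsub>A\<^esub> Y"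
  "a \<odot>\<^bsub>quotient_algebra A I\<^esub> X = (\<Union>x\<in>X. I +>\<^bsub>A\<^esub> (a \<odot>\<^bsub>A\<^esub> x))"
  by (auto simp: quotient_algebra_def ring.extend_def module.fields_def FactRing_def
      A_RCOSETS_defs a_r_coset_def r_coset_def)

text \<open>
  Scalar multiplication is well defined on cosets because an ideal is closed under it:
  \<open>a i = (a 1) i\<close>.
\<close>

lemma quotient_algebra_is_algebra:
  fixes A (structure)
  assumes A: "is_algebra K A" and I: "ideal I A"
  shows "is_algebra K (quotient_algebra A I)"
    and "I +> \<zero> = \<zero>\<^bsub>quotient_algebra A I\<^esub>"
    and "I +> \<one> = \<one>\<^bsub>quotient_algebra A I\<^esub>"
    and "\<And>x y. \<lbrakk>x \<in> carrier A; y \<in> carrier A\<rbrakk>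
      \<Longrightarrow> (I +> x) \<oplus>\<^bsub>quotient_algebra A I\<^esub> (I +> y) = I +> (x \<oplus> y)"
    and "\<And>x y. \<lbrakk>x \<in> carrier A; y \<in> carrier A\<rbrakk>
      \<Longrightarrow> (I +> x) \<otimes>\<^bsub>quotient_algebra A I\<^esub> (I +> y) = I +> (x \<otimes> y)"
    and "\<And>a x. \<lbrakk>a \<in> carrier K; x \<in> carrier A\<rbrakk>
      \<Longrightarrow> a \<odot>\<^bsub>quotient_algebra A I\<^esub> (I +> x) = I +> (a \<odot> x)"
proof -
  interpret ideal I A by (rule I)
  interpret A: module K A by (rule is_algebraD(3)[OF A])
  show zero: "I +> \<zero> = \<zero>\<^bsub>quotient_algebra A I\<^esub>"
    by (simp add: quotient_algebra_simps a_coset_add_zero a_subset)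
  show one: "I +> \<one> = \<one>\<^bsub>quotient_algebra A I\<^esub>" by (simp add: quotient_algebra_simps)
  show add: "(I +> x) \<oplus>\<^bsub>quotient_algebra A I\<^esub> (I +> y) = I +> (x \<oplus> y)"
    if "x \<in> carrier A" "y \<in> carrier A" for x y
    using that by (simp add: quotient_algebra_simps a_rcos_sum)
  show mult: "(I +> x) \<otimes>\<^bsub>quotient_algebra A I\<^esub> (I +> y) = I +> (x \<otimes> y)"
    if "x \<in> carrier A" "y \<in> carrier A" for x y
    using that by (simp add: quotient_algebra_simps rcoset_mult_add)
  show smult: "a \<odot>\<^bsub>quotient_algebra A I\<^esub> (I +> x) = I +> (a \<odot> x)"
    if a: "a \<in> carrier K" and x: "x \<in> carrier A" for a x
  proof -
    have "I +> (a \<odot> y) = I +> (a \<odot> x)" if y: "y \<in> I +> x" for y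
    proof -
      obtain i where i: "i \<in> I" "y = i \<oplus> x" using y by (auto simp: a_r_coset_def')
      have iA: "i \<in> carrier A" using i(1) by simp
      have ai: "a \<odot> i \<in> I"
        using I_l_closed[OF i(1) scalar_one_closed[OF A a]] scalar_one_central(1)[OF A a iA] by simp
      have "a \<odot> y = a \<odot> i \<oplus> a \<odot> x" using i iA a x by (simp add: A.smult_r_distr)
      then have "a \<odot> y \<in> I +> (a \<odot> x)" using ai by (auto simp: a_r_coset_def')
      then show ?thesis using a x by (intro a_repr_independence'[symmetric]) auto
    qed
    moreover have "x \<in> I +> x" using x by (rule a_rcos_self)
    ultimately show ?thesis unfolding quotient_algebra_simps by blast
  qed
  show "is_algebra K (quotient_algebra A I)"
    by (rule is_algebra_surj_transport[OF A, where f = "\<lambda>x. I +> x"])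
      (simp_all add: zero one add mult smult quotient_algebra_simps(1))
qed

section \<open>Endomorphism rings of direct sums of idempotent right ideals\<close>

definition evaluate_at :: "'m \<Rightarrow> ('m \<Rightarrow> 'a) \<Rightarrow> ('m \<Rightarrow> 'm) \<Rightarrow> 'a" where
  "evaluate_at p \<theta> f = \<theta> (f p)"

text \<open>
  The identity \<open>y = p \<theta>(y)\<close> says that \<open>p\<close> and \<open>\<theta>\<close> form a dual basis of length one. It makes \<open>\<theta>\<close>
  an isomorphism from \<open>P\<close> onto \<open>eA\<close> for the idempotent \<open>e = \<theta>(p)\<close>.
\<close>

locale dual_basis_one = right_module A P
  for A :: "('a, 'c) ring_scheme" (structure) and P :: "('a, 'm) rmodule" +
  fixes p :: 'm and \<theta> :: "'m \<Rightarrow> 'a"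
  assumes p_closed: "p \<in> carrier P"
    and \<theta>_hom: "\<theta> \<in> rmodule_hom A P (regular_rmodule A)"
    and p_\<theta>: "y \<in> carrier P \<Longrightarrow> p \<triangleleft>\<^bsub>P\<^esub> \<theta> y = y"
begin

lemma \<theta>_closed: "y \<in> carrier P \<Longrightarrow> \<theta> y \<in> carrier A"
  and \<theta>_add: "\<lbrakk>x \<in> carrier P; y \<in> carrier P\<rbrakk> \<Longrightarrow> \<theta> (x \<oplus>\<^bsub>P\<^esub> y) = \<theta> x \<oplus> \<theta> y"
  and \<theta>_ract: "\<lbrakk>y \<in> carrier P; r \<in> carrier A\<rbrakk> \<Longrightarrow> \<theta> (y \<triangleleft>\<^bsub>P\<^esub> r) = \<theta> y \<otimes> r"
  using rmodule_homD(2-)[OF \<theta>_hom] by (auto simp: regular_rmodule_def)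

lemma End_eq:
  assumes f: "f \<in> rmodule_hom A P P" and y: "y \<in> carrier P"
  shows "f y = p \<triangleleft>\<^bsub>P\<^esub> (evaluate_at p \<theta> f \<otimes> \<theta> y)"
proof -
  note f' = rmodule_homD(2-)[OF f]
  have "f y = f (p \<triangleleft>\<^bsub>P\<^esub> \<theta> y)" using y by (simp add: p_\<theta>)
  also have "\<dots> = f p \<triangleleft>\<^bsub>P\<^esub> \<theta> y" by (rule f'(3)[OF p_closed \<theta>_closed[OF y]])
  also have "f p = p \<triangleleft>\<^bsub>P\<^esub> \<theta> (f p)" by (simp add: f' p_closed p_\<theta>)
  finally show ?thesis using y by (simp add: ract_assoc f' p_closed \<theta>_closed evaluate_at_def)
qed

text \<open>
  An endomorphism \<open>f\<close> of \<open>P = pA\<close> is determined by \<open>f p = p \<theta>(f p)\<close>, that is by the element \<open>\<theta>(f p)\<close>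
  of \<open>eAe\<close>; conversely \<open>t \<in> eAe\<close> gives the endomorphism \<open>y \<mapsto> p (t \<theta>(y))\<close>, left multiplication by
  \<open>t\<close> on \<open>eA\<close>.
\<close>

lemma End_to_corner_bij:
  "bij_betw (evaluate_at p \<theta>) (rmodule_hom A P P)
     {t \<in> carrier A. \<theta> p \<otimes> t = t \<and> t \<otimes> \<theta> p = t}"
proof (rule bij_betw_byWitness[where f' = "\<lambda>t. \<lambda>y\<in>carrier P. p \<triangleleft>\<^bsub>P\<^esub> (t \<otimes> \<theta> y)"])
  let ?g = "\<lambda>t. \<lambda>y\<in>carrier P. p \<triangleleft>\<^bsub>P\<^esub> (t \<otimes> \<theta> y)"
  have g: "?g t \<in> rmodule_hom A P P" if "t \<in> carrier A" for t
    by (rule restrict_rmodule_hom[OF right_module_axioms])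
      (use that in \<open>auto simp: p_closed \<theta>_closed \<theta>_add \<theta>_ract ract_r_distr
        B.r_distr ract_assoc[symmetric] B.m_assoc[symmetric] intro!: ract_closed\<close>)
  show "\<forall>f\<in>rmodule_hom A P P. ?g (evaluate_at p \<theta> f) = f"
  proof
    fix f assume f: "f \<in> rmodule_hom A P P"
    have "evaluate_at p \<theta> f \<in> carrier A"
      using rmodule_homD(2)[OF f] by (simp add: evaluate_at_def \<theta>_closed p_closed)
    then show "?g (evaluate_at p \<theta> f) = f"
      by (intro rmodule_hom_eqI[OF g f]) (simp_all add: End_eq[OF f])
  qed
  show "\<forall>t\<in>{t \<in> carrier A. \<theta> p \<otimes> t = t \<and> t \<otimes> \<theta> p = t}. evaluate_at p \<theta> (?g t) = t"
    by (auto simp: evaluate_at_def p_closed \<theta>_closed \<theta>_ract)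
  show "evaluate_at p \<theta> ` rmodule_hom A P P \<subseteq> {t \<in> carrier A. \<theta> p \<otimes> t = t \<and> t \<otimes> \<theta> p = t}"
  proof clarify
    fix f assume f: "f \<in> rmodule_hom A P P"
    note f' = rmodule_homD(2-)[OF f]
    have "\<theta> p \<otimes> \<theta> (f p) = \<theta> (f p)"
      using \<theta>_ract[of p "\<theta> (f p)"] by (simp add: p_closed \<theta>_closed f' p_\<theta>)
    moreover have "\<theta> (f p) \<otimes> \<theta> p = \<theta> (f p)"
      using \<theta>_ract[of "f p" "\<theta> p"] f'(3)[of p "\<theta> p"] by (simp add: p_closed \<theta>_closed f' p_\<theta>)
    ultimately show "evaluate_at p \<theta> f \<in> carrier A \<and> \<theta> p \<otimes> evaluate_at p \<theta> f = evaluate_at p \<theta> f \<and>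
        evaluate_at p \<theta> f \<otimes> \<theta> p = evaluate_at p \<theta> f"
      by (simp add: evaluate_at_def \<theta>_closed p_closed f')
  qed
  show "?g ` {t \<in> carrier A. \<theta> p \<otimes> t = t \<and> t \<otimes> \<theta> p = t} \<subseteq> rmodule_hom A P P"
    using g by auto
qed

end

lemma End_algebra_simps:
  "carrier (End_algebra A P) = rmodule_hom A P P"
  "\<one>\<^bsub>End_algebra A P\<^esub> = (\<lambda>x\<in>carrier P. x)"
  "\<zero>\<^bsub>End_algebra A P\<^esub> = (\<lambda>x\<in>carrier P. \<zero>\<^bsub>P\<^esub>)"
  "f \<otimes>\<^bsub>End_algebra A P\<^esub> g = compose (carrier P) f g"
  "f \<oplus>\<^bsub>End_algebra A P\<^esub> g = (\<lambda>x\<in>carrier P. f x \<oplus>\<^bsub>P\<^esub> g x)"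
  "a \<odot>\<^bsub>End_algebra A P\<^esub> f = (\<lambda>x\<in>carrier P. f x \<triangleleft>\<^bsub>P\<^esub> (a \<odot>\<^bsub>A\<^esub> \<one>\<^bsub>A\<^esub>))"
  by (simp_all add: End_algebra_def)

text \<open>
  Composition \<open>(f g)(x) = f (g x)\<close> corresponds to the product in the same order, as endomorphisms of
  \<open>eA\<close> are left multiplications.
\<close>

lemma End_to_corner_algebra:
  fixes A (structure)
  assumes K: "is_algebra K A" and dual: "dual_basis_one A P p \<theta>"
  shows "is_algebra K (End_algebra A P)"
    and "\<And>f g. \<lbrakk>f \<in> rmodule_hom A P P; g \<in> rmodule_hom A P P\<rbrakk>
      \<Longrightarrow> evaluate_at p \<theta> (f \<oplus>\<^bsub>End_algebra A P\<^esub> g) = evaluate_at p \<theta> f \<oplus> evaluate_at p \<theta> g"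
    and "\<And>f g. \<lbrakk>f \<in> rmodule_hom A P P; g \<in> rmodule_hom A P P\<rbrakk>
      \<Longrightarrow> evaluate_at p \<theta> (f \<otimes>\<^bsub>End_algebra A P\<^esub> g) = evaluate_at p \<theta> f \<otimes> evaluate_at p \<theta> g"
    and "\<And>a f. \<lbrakk>a \<in> carrier K; f \<in> rmodule_hom A P P\<rbrakk>
      \<Longrightarrow> evaluate_at p \<theta> (a \<odot>\<^bsub>End_algebra A P\<^esub> f) = a \<odot> evaluate_at p \<theta> f"
    and "evaluate_at p \<theta> \<one>\<^bsub>End_algebra A P\<^esub> = \<theta> p"
proof -
  interpret dual_basis_one A P p \<theta> by (rule dual)
  note [simp] = End_algebra_simps
  note hom = rmodule_homD(2-)
  have corner: "evaluate_at p \<theta> f \<in> carrier A" "\<theta> p \<otimes> evaluate_at p \<theta> f = evaluate_at p \<theta> f"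
    "evaluate_at p \<theta> f \<otimes> \<theta> p = evaluate_at p \<theta> f" if "f \<in> rmodule_hom A P P" for f
    using bij_betwE[OF End_to_corner_bij] that by auto
  show add: "evaluate_at p \<theta> (f \<oplus>\<^bsub>End_algebra A P\<^esub> g) = evaluate_at p \<theta> f \<oplus> evaluate_at p \<theta> g"
    if "f \<in> rmodule_hom A P P" "g \<in> rmodule_hom A P P" for f g
    using hom(1)[OF that(1)] hom(1)[OF that(2)] by (simp add: evaluate_at_def p_closed \<theta>_add)
  show mult: "evaluate_at p \<theta> (f \<otimes>\<^bsub>End_algebra A P\<^esub> g) = evaluate_at p \<theta> f \<otimes> evaluate_at p \<theta> g"
    if f: "f \<in> rmodule_hom A P P" and g: "g \<in> rmodule_hom A P P" for f g
  proof -
    have "evaluate_at p \<theta> (f \<otimes>\<^bsub>End_algebra A P\<^esub> g) = \<theta> p \<otimes> (evaluate_at p \<theta> f \<otimes> evaluate_at p \<theta> g)"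
      using End_eq[OF f, of "g p"] hom(1)[OF f] hom(1)[OF g] corner[OF f]
      by (simp add: evaluate_at_def compose_eq p_closed \<theta>_ract \<theta>_closed)
    also have "\<dots> = evaluate_at p \<theta> f \<otimes> evaluate_at p \<theta> g"
      using corner[OF f] corner[OF g] by (simp add: B.m_assoc[symmetric] p_closed \<theta>_closed)
    finally show ?thesis .
  qed
  show smult: "evaluate_at p \<theta> (a \<odot>\<^bsub>End_algebra A P\<^esub> f) = a \<odot> evaluate_at p \<theta> f"
    if "a \<in> carrier K" "f \<in> rmodule_hom A P P" for a f
    using hom(1)[OF that(2)] scalar_one_closed[OF K that(1)] scalar_one_central[OF K that(1)]
    by (simp add: evaluate_at_def p_closed \<theta>_ract \<theta>_closed)
  show one: "evaluate_at p \<theta> \<one>\<^bsub>End_algebra A P\<^esub> = \<theta> p" by (simp add: evaluate_at_def p_closed)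
  show "is_algebra K (End_algebra A P)"
  proof (rule is_algebra_inj_transport[OF K, where f = "evaluate_at p \<theta>"], unfold End_algebra_simps(1))
    show "inj_on (evaluate_at p \<theta>) (rmodule_hom A P P)"
      using End_to_corner_bij by (simp add: bij_betw_def)
    show "\<zero>\<^bsub>End_algebra A P\<^esub> \<in> rmodule_hom A P P"
      unfolding End_algebra_simps
      by (rule restrict_rmodule_hom[OF right_module_axioms]) (simp_all add: ract_l_null)
    have "\<theta> (p \<triangleleft>\<^bsub>P\<^esub> \<zero>) = \<zero>" using \<theta>_ract[OF p_closed, of \<zero>] by (simp add: \<theta>_closed p_closed)
    then show "evaluate_at p \<theta> \<zero>\<^bsub>End_algebra A P\<^esub> = \<zero>"
      by (simp add: evaluate_at_def p_closed ract_r_null)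
    show "\<one>\<^bsub>End_algebra A P\<^esub> \<in> rmodule_hom A P P"
      using id_rmodule_hom[OF right_module_axioms] by simp
  next
    fix f g assume f: "f \<in> rmodule_hom A P P" and g: "g \<in> rmodule_hom A P P"
    show "f \<otimes>\<^bsub>End_algebra A P\<^esub> g \<in> rmodule_hom A P P"
      using compose_rmodule_hom[OF right_module_axioms g f] by simp
    show "f \<oplus>\<^bsub>End_algebra A P\<^esub> g \<in> rmodule_hom A P P"
      unfolding End_algebra_simps
      by (rule restrict_rmodule_hom[OF right_module_axioms])
        (simp_all add: hom[OF f] hom[OF g] ract_l_distr M.a_ac)
  next
    fix a f assume a: "a \<in> carrier K" and f: "f \<in> rmodule_hom A P P"
    note c = scalar_one_closed[OF K a] scalar_one_central[OF K a]
    show "a \<odot>\<^bsub>End_algebra A P\<^esub> f \<in> rmodule_hom A P P"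
      unfolding End_algebra_simps
    proof (rule restrict_rmodule_hom[OF right_module_axioms])
      fix x r assume "x \<in> carrier P" "r \<in> carrier A"
      then show "f (x \<triangleleft>\<^bsub>P\<^esub> r) \<triangleleft>\<^bsub>P\<^esub> (a \<odot> \<one>) = f x \<triangleleft>\<^bsub>P\<^esub> (a \<odot> \<one>) \<triangleleft>\<^bsub>P\<^esub> r"
        using c(1) c(2,3)[of r] by (simp add: hom[OF f] ract_assoc[symmetric])
    qed (use c(1) in \<open>simp_all add: hom[OF f] ract_l_distr ract_closed\<close>)
  qed (use corner add mult smult one in auto)
qed

lemma carrier_right_ideal_rmodule:
  assumes A: "ring A" and x: "x \<in> carrier A" "x \<otimes>\<^bsub>A\<^esub> x = x"
  shows "carrier (right_ideal_rmodule A x) = {y \<in> carrier A. x \<otimes>\<^bsub>A\<^esub> y = y}"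
proof -
  interpret ring A by (rule A)
  interpret R: right_module A "regular_rmodule A" by (rule regular_right_module[OF A])
  have simps: "carrier (regular_rmodule A) = carrier A" "\<zero>\<^bsub>regular_rmodule A\<^esub> = \<zero>\<^bsub>A\<^esub>"
    "add (regular_rmodule A) = add A" "ract (regular_rmodule A) = mult A"
    by (simp_all add: regular_rmodule_def)
  have "right_submodule A (regular_rmodule A) {y \<in> carrier A. x \<otimes>\<^bsub>A\<^esub> y = y}"
    by (rule R.right_submoduleI) (use x in \<open>auto simp: simps r_distr m_assoc[symmetric]\<close>)
  moreover have "y \<in> N" if "right_submodule A (regular_rmodule A) N" "x \<in> N" "y \<in> carrier A"
      "x \<otimes>\<^bsub>A\<^esub> y = y" for N y
    using R.right_submoduleD(4)[OF that(1), of x y] that by (simp add: simps)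
  ultimately have "right_generated A (regular_rmodule A) {x} = {y \<in> carrier A. x \<otimes>\<^bsub>A\<^esub> y = y}"
    unfolding right_generated_def using x by blast
  then show ?thesis by (simp add: right_ideal_rmodule_def)
qed

text \<open>
  For orthogonal idempotents \<open>x\<^sub>j\<close> with sum \<open>e\<close>, the sum of the components is an isomorphism from the
  direct sum of the \<open>x\<^sub>j A\<close> onto \<open>eA\<close>, with inverse \<open>r \<mapsto> (x\<^sub>j r)\<^sub>j\<close>. The family of the \<open>x\<^sub>j\<close>
  corresponds to \<open>e\<close> and serves as the element \<open>p\<close>.
\<close>

lemma orthogonal_idempotents_dual_basis:
  fixes A (structure)
  assumes A: "ring A" and J: "finite J" and x: "\<And>j. j \<in> J \<Longrightarrow> x j \<in> carrier A"
    and idem: "\<And>j. j \<in> J \<Longrightarrow> x j \<otimes> x j = x j"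
    and orth: "\<And>i j. \<lbrakk>i \<in> J; j \<in> J; i \<noteq> j\<rbrakk> \<Longrightarrow> x i \<otimes> x j = \<zero>"
    and P: "P = rmodule_direct_sum J (\<lambda>j. right_ideal_rmodule A (x j))"
    and \<theta>: "\<theta> = (\<lambda>f\<in>carrier P. \<Oplus>j\<in>J. f j)"
  shows "dual_basis_one A P (\<lambda>j\<in>J. x j) \<theta>" and "\<theta> (\<lambda>j\<in>J. x j) = (\<Oplus>j\<in>J. x j)"
proof -
  interpret ring A by (rule A)
  have Pc: "f \<in> carrier P \<longleftrightarrow> f \<in> J \<rightarrow>\<^sub>E carrier A \<and> (\<forall>j\<in>J. x j \<otimes> f j = f j)" for f
  proof -
    have "f \<in> carrier P \<longleftrightarrow> f \<in> (\<Pi>\<^sub>E j\<in>J. {y \<in> carrier A. x j \<otimes> y = y})"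
      unfolding P rmodule_direct_sum_def using J carrier_right_ideal_rmodule[OF A x idem]
      by (simp cong: PiE_cong)
    then show ?thesis by (auto simp: PiE_iff)
  qed
  have Pz: "\<zero>\<^bsub>P\<^esub> = (\<lambda>j\<in>J. \<zero>)"
    and Pa: "f \<oplus>\<^bsub>P\<^esub> g = (\<lambda>j\<in>J. f j \<oplus> g j)" and Pr: "f \<triangleleft>\<^bsub>P\<^esub> r = (\<lambda>j\<in>J. f j \<otimes> r)" for f g r
    by (simp_all add: P rmodule_direct_sum_def right_ideal_rmodule_def regular_rmodule_def)
  have cl: "f j \<in> carrier A" "x j \<otimes> f j = f j" if "f \<in> carrier P" "j \<in> J" for f j
    using that by (auto simp: Pc)
  have \<theta>c: "\<theta> f \<in> carrier A" if "f \<in> carrier P" for f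
    using cl[OF that] that by (auto simp: \<theta> intro!: finsum_closed)
  have addP: "f \<oplus>\<^bsub>P\<^esub> g \<in> carrier P" "\<theta> (f \<oplus>\<^bsub>P\<^esub> g) = \<theta> f \<oplus> \<theta> g"
    if f: "f \<in> carrier P" and g: "g \<in> carrier P" for f g
  proof -
    show 1: "f \<oplus>\<^bsub>P\<^esub> g \<in> carrier P"
      using cl[OF f] cl[OF g] by (auto simp: Pc Pa r_distr x)
    have "(\<Oplus>j\<in>J. (f \<oplus>\<^bsub>P\<^esub> g) j) = (\<Oplus>j\<in>J. f j \<oplus> g j)"
      by (rule finsum_cong') (use cl[OF f] cl[OF g] in \<open>auto simp: Pa\<close>)
    also have "\<dots> = (\<Oplus>j\<in>J. f j) \<oplus> (\<Oplus>j\<in>J. g j)"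
      by (rule finsum_addf) (use cl[OF f] cl[OF g] in auto)
    finally show "\<theta> (f \<oplus>\<^bsub>P\<^esub> g) = \<theta> f \<oplus> \<theta> g" using 1 f g by (simp add: \<theta>)
  qed
  have ractP: "f \<triangleleft>\<^bsub>P\<^esub> r \<in> carrier P" "\<theta> (f \<triangleleft>\<^bsub>P\<^esub> r) = \<theta> f \<otimes> r"
    if f: "f \<in> carrier P" and r: "r \<in> carrier A" for f r
  proof -
    show 1: "f \<triangleleft>\<^bsub>P\<^esub> r \<in> carrier P"
      using cl[OF f] r by (auto simp: Pc Pr x m_assoc[symmetric])
    have "(\<Oplus>j\<in>J. (f \<triangleleft>\<^bsub>P\<^esub> r) j) = (\<Oplus>j\<in>J. f j \<otimes> r)"
      by (rule finsum_cong') (use cl[OF f] r in \<open>auto simp: Pr\<close>)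
    also have "\<dots> = (\<Oplus>j\<in>J. f j) \<otimes> r"
      by (rule finsum_ldistr[symmetric]) (use cl[OF f] J r in auto)
    finally show "\<theta> (f \<triangleleft>\<^bsub>P\<^esub> r) = \<theta> f \<otimes> r" using 1 f by (simp add: \<theta>)
  qed
  have x\<theta>: "x k \<otimes> \<theta> f = f k" if f: "f \<in> carrier P" and k: "k \<in> J" for f k
  proof -
    have "x k \<otimes> \<theta> f = (\<Oplus>j\<in>J. x k \<otimes> f j)"
      using f cl[OF f] J k by (auto simp: \<theta> x intro!: finsum_rdistr)
    also have "\<dots> = (\<Oplus>j\<in>J. if k = j then f j else \<zero>)"
    proof (rule finsum_cong')
      fix j assume j: "j \<in> J"
      have "x k \<otimes> f j = (x k \<otimes> x j) \<otimes> f j" using cl[OF f j] x k j by (simp add: m_assoc)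
      then show "x k \<otimes> f j = (if k = j then f j else \<zero>)"
        using cl[OF f j] orth[OF k j] idem[OF k] by auto
    qed (use cl[OF f] in auto)
    also have "\<dots> = f k" by (rule finsum_singleton[OF k J]) (use cl[OF f] in auto)
    finally show ?thesis .
  qed
  have pP: "(\<lambda>j\<in>J. x j) \<in> carrier P" by (simp add: Pc x idem)
  have zP: "\<zero>\<^bsub>P\<^esub> \<in> carrier P" by (simp add: Pc Pz x)
  have "\<theta> \<zero>\<^bsub>P\<^esub> = \<zero>" using ractP(2)[OF zP zero_closed] \<theta>c[OF zP] by (simp add: Pr Pz cong: restrict_cong)
  moreover have "inj_on \<theta> (carrier P)"
  proof (rule inj_onI)
    fix f g assume f: "f \<in> carrier P" and g: "g \<in> carrier P" and eq: "\<theta> f = \<theta> g"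
    have "f j = g j" if "j \<in> J" for j using x\<theta>[OF f that] x\<theta>[OF g that] eq by simp
    with f g show "f = g" unfolding Pc by (metis PiE_ext)
  qed
  ultimately have PM: "right_module A P"
    using zP addP ractP \<theta>c
    by (intro right_module_inj_transport[OF regular_right_module[OF A], where f = \<theta>])
      (auto simp: regular_rmodule_def)
  have "\<theta> = restrict \<theta> (carrier P)" by (simp add: \<theta>)
  also have "\<dots> \<in> rmodule_hom A P (regular_rmodule A)"
    by (rule restrict_rmodule_hom[OF PM]) (use addP ractP \<theta>c in \<open>auto simp: regular_rmodule_def\<close>)
  finally have hom: "\<theta> \<in> rmodule_hom A P (regular_rmodule A)" .
  have "(\<lambda>j\<in>J. x j) \<triangleleft>\<^bsub>P\<^esub> \<theta> f = f" if f: "f \<in> carrier P" for f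
  proof -
    have "(\<lambda>j\<in>J. x j) \<triangleleft>\<^bsub>P\<^esub> \<theta> f = restrict f J"
      using x\<theta>[OF f] by (simp add: Pr cong: restrict_cong)
    also have "\<dots> = f" using f PiE_restrict[of f J "\<lambda>_. carrier A"] by (simp add: Pc)
    finally show ?thesis .
  qed
  then show "dual_basis_one A P (\<lambda>j\<in>J. x j) \<theta>"
    by (intro dual_basis_one.intro dual_basis_one_axioms.intro PM pP hom)
  have "finsum A (restrict x J) J = (\<Oplus>j\<in>J. x j)" by (rule finsum_cong') (auto simp: x)
  then show "\<theta> (\<lambda>j\<in>J. x j) = (\<Oplus>j\<in>J. x j)" using pP by (simp add: \<theta>)
qed

section \<open>Algebras spanned by matrix units over a preorder\<close>

lemma underlying_vectorspace:
  assumes B: "is_algebra K B" and M: "right_module B M"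
  shows "vectorspace K (underlying_space B M)"
proof -
  interpret K: field K by (rule is_algebraD(1)[OF B])
  interpret right_module B M by (rule M)
  interpret V: module K B by (rule is_algebraD(3)[OF B])
  have s: "a \<odot>\<^bsub>B\<^esub> \<one>\<^bsub>B\<^esub> \<in> carrier B" if "a \<in> carrier K" for a
    using scalar_one_closed[OF B that] .
  have "abelian_group (underlying_space B M)"
    by (rule abelian_groupI)
      (auto simp: underlying_space_def M.a_ac intro: M.add.l_inv_ex)
  then have "module K (underlying_space B M)"
  proof (rule moduleI[OF K.is_cring])
    fix a b x assume a: "a \<in> carrier K" and b: "b \<in> carrier K"
      and x: "x \<in> carrier (underlying_space B M)"
    have "(a \<otimes>\<^bsub>K\<^esub> b) \<odot>\<^bsub>B\<^esub> \<one>\<^bsub>B\<^esub> = (b \<odot>\<^bsub>B\<^esub> \<one>\<^bsub>B\<^esub>) \<otimes>\<^bsub>B\<^esub> (a \<odot>\<^bsub>B\<^esub> \<one>\<^bsub>B\<^esub>)"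
      using a b s scalar_one_central(2)[OF B a s[OF b]] by (simp add: V.smult_assoc1)
    then show "(a \<otimes>\<^bsub>K\<^esub> b) \<odot>\<^bsub>underlying_space B M\<^esub> x =
        a \<odot>\<^bsub>underlying_space B M\<^esub> (b \<odot>\<^bsub>underlying_space B M\<^esub> x)"
      using x a b s by (simp add: underlying_space_def ract_assoc)
  qed (auto simp: underlying_space_def ract_closed s ract_l_distr ract_r_distr ract_one V.smult_l_distr)
  then show ?thesis by (intro vectorspace.intro K.field_axioms)
qed

lemma vectorspace_dim_one:
  assumes V: "vectorspace K W" and x: "x \<in> carrier W" "x \<noteq> \<zero>\<^bsub>W\<^esub>"
    and gen: "carrier W \<subseteq> {a \<odot>\<^bsub>W\<^esub> x | a. a \<in> carrier K}"
  shows "vectorspace.fin_dim K W" "vectorspace.dim K W = 1"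
proof -
  interpret vs: vectorspace K W by (rule V)
  have "x \<in> vs.span {x}" using vs.in_own_span[of "{x}"] x by simp
  then have "carrier W \<subseteq> vs.span {x}"
    using gen LinearCombinations.submodule.smult_closed[OF vs.span_is_submodule[of "{x}"]] x by auto
  then have g: "vs.span {x} = carrier W" using vs.span_is_subset2[of "{x}"] x by auto
  then show "vs.fin_dim" unfolding vs.fin_dim_def using x by (intro exI[of _ "{x}"]) simp
  show "vs.dim = 1"
    unfolding vs.dim_def
  proof (rule Least_equality)
    show "\<exists>A. finite A \<and> card A = 1 \<and> A \<subseteq> carrier W \<and> vs.span A = carrier W"
      using g x by (intro exI[of _ "{x}"]) simp
  next
    fix n assume "\<exists>A. finite A \<and> card A = n \<and> A \<subseteq> carrier W \<and> vs.span A = carrier W"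
    then obtain A where A: "finite A" "card A = n" "vs.span A = carrier W" by blast
    have "A \<noteq> {}" using A(3) x vs.span_empty by auto
    then show "1 \<le> n" using A(1,2) by (cases n) auto
  qed
qed

text \<open>
  If the matrix units are linearly independent, this is the incidence algebra of the preorder; in
  general it is a quotient of the incidence algebra.
\<close>

locale incidence_units =
  fixes K :: "('k, 'c) ring_scheme" and A :: "('k, 'a, 'd) module_scheme" (structure)
    and V :: "'v set" and le :: "'v \<Rightarrow> 'v \<Rightarrow> bool" and E :: "'v \<Rightarrow> 'v \<Rightarrow> 'a"
  assumes algebra: "is_algebra K A" and finite_V: "finite V"
    and le_V: "le u v \<Longrightarrow> u \<in> V \<and> v \<in> V"
    and le_refl: "v \<in> V \<Longrightarrow> le v v" and le_trans: "\<lbrakk>le u v; le v w\<rbrakk> \<Longrightarrow> le u w"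
    and E_closed: "le u v \<Longrightarrow> E u v \<in> carrier A"
    and E_mult: "\<lbrakk>le u v; le v w\<rbrakk> \<Longrightarrow> E u v \<otimes> E v w = E u w"
    and E_orth: "\<lbrakk>le u v; le v' w; v \<noteq> v'\<rbrakk> \<Longrightarrow> E u v \<otimes> E v' w = \<zero>"
    and E_sum: "(\<Oplus>v\<in>V. E v v) = \<one>"
    and E_span: "module.span K A {E u v | u v. le u v} = carrier A"
begin

sublocale ring A by (rule is_algebraD(4)[OF algebra])

lemma E_induct [consumes 1, case_names zero add smult unit]:
  assumes x: "x \<in> carrier A" and zero: "Q \<zero>"
    and add: "\<And>x y. \<lbrakk>x \<in> carrier A; y \<in> carrier A; Q x; Q y\<rbrakk> \<Longrightarrow> Q (x \<oplus> y)"
    and smult: "\<And>a x. \<lbrakk>a \<in> carrier K; x \<in> carrier A; Q x\<rbrakk> \<Longrightarrow> Q (a \<odot> x)"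
    and unit: "\<And>u v. le u v \<Longrightarrow> Q (E u v)"
  shows "Q x"
proof -
  interpret vs: module K A by (rule is_algebraD(3)[OF algebra])
  have "LinearCombinations.submodule K {x \<in> carrier A. Q x} A"
    by (rule LinearCombinations.submodule.intro)
      (use zero add smult in \<open>auto intro: is_algebraD(3)[OF algebra]\<close>)
  then have "vs.span {E u v | u v. le u v} \<subseteq> {x \<in> carrier A. Q x}"
    by (rule vs.span_is_subset[rotated]) (use unit E_closed in auto)
  then show ?thesis using x E_span by auto
qed

end

context incidence_units
begin

lemma fin_dim: "vectorspace.fin_dim K A"
proof -
  interpret vs: vectorspace K A by (rule is_algebraD(2)[OF algebra])
  have "{(u, v). le u v} \<subseteq> V \<times> V" using le_V by auto
  then have "finite ((\<lambda>(u, v). E u v) ` {(u, v). le u v})"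
    using finite_V by (metis finite_SigmaI finite_subset finite_imageI)
  also have "(\<lambda>(u, v). E u v) ` {(u, v). le u v} = {E u v | u v. le u v}" by auto
  finally show ?thesis
    unfolding vs.fin_dim_def
    by (intro exI[of _ "{E u v | u v. le u v}"]) (use E_closed E_span in auto)
qed

text \<open>
  For a nonzero \<open>x\<close> with \<open>x E v v = x\<close>, a matrix unit \<open>E u w\<close> annihilates \<open>x\<close> unless \<open>u = v\<close>, and
  then it sends \<open>x\<close> into \<open>M E w w\<close> with \<open>w\<close> above \<open>v\<close>. Choosing \<open>v\<close> maximal with \<open>M E v v \<noteq> 0\<close> leaves only
  \<open>w = v\<close>, so \<open>K x\<close> is a submodule.
\<close>

lemma antisym_basic:
  assumes antisym: "\<And>u v. \<lbrakk>le u v; le v u\<rbrakk> \<Longrightarrow> u = v"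
  shows "basic_algebra TYPE('u) K A"
  unfolding basic_algebra_def
proof (intro conjI allI impI algebra fin_dim)
  fix M :: "('a, 'u) rmodule" assume simple: "simple_right_module A M"
  then have M: "right_module A M" by (simp add: simple_right_module_def)
  interpret M: right_module A M by (rule M)
  note vs = underlying_vectorspace[OF algebra M]
  have us: "carrier (underlying_space A M) = carrier M" "\<zero>\<^bsub>underlying_space A M\<^esub> = \<zero>\<^bsub>M\<^esub>"
    "add (underlying_space A M) = add M" "\<And>a m. a \<odot>\<^bsub>underlying_space A M\<^esub> m = m \<triangleleft>\<^bsub>M\<^esub> (a \<odot> \<one>)"
    by (simp_all add: underlying_space_def)
  interpret W: vectorspace K "underlying_space A M" by (rule vs)
  have EV: "E v v \<in> carrier A" if "v \<in> V" for v using E_closed[OF le_refl[OF that]] .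
  define T where "T = {v \<in> V. \<exists>y\<in>carrier M. y \<triangleleft>\<^bsub>M\<^esub> E v v \<noteq> \<zero>\<^bsub>M\<^esub>}"
  have "\<exists>m\<in>carrier M. m \<noteq> \<zero>\<^bsub>M\<^esub>"
    using simple M.M.zero_closed unfolding simple_right_module_def by blast
  then obtain m where m: "m \<in> carrier M" "m \<noteq> \<zero>\<^bsub>M\<^esub>" by blast
  have "T \<noteq> {}"
  proof
    assume "T = {}"
    have "m = m \<triangleleft>\<^bsub>M\<^esub> (\<Oplus>v\<in>V. E v v)" using m by (simp add: E_sum M.ract_one)
    also have "\<dots> = (\<Oplus>\<^bsub>M\<^esub>v\<in>V. m \<triangleleft>\<^bsub>M\<^esub> E v v)"
      by (rule M.ract_finsum) (use m EV finite_V in auto)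
    also have "\<dots> = \<zero>\<^bsub>M\<^esub>"
      by (rule M.M.add.finprod_one_eqI) (use \<open>T = {}\<close> m in \<open>auto simp: T_def\<close>)
    finally show False using m by simp
  qed
  \<comment> \<open>\<open>h\<close> strictly decreases along the order, so minimizing it yields a maximal element\<close>
  define h where "h v = card {u. le v u}" for v
  have finT: "finite T" using finite_V by (simp add: T_def)
  obtain v where v: "v \<in> T" and min: "\<And>u. u \<in> T \<Longrightarrow> h v \<le> h u"
    using arg_min_if_finite[OF finT \<open>T \<noteq> {}\<close>, of h] that[of "arg_min_on h T"] by (auto simp: not_less)
  from v obtain y where y: "y \<in> carrier M" "y \<triangleleft>\<^bsub>M\<^esub> E v v \<noteq> \<zero>\<^bsub>M\<^esub>" and vV: "v \<in> V"
    by (auto simp: T_def)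
  define x where "x = y \<triangleleft>\<^bsub>M\<^esub> E v v"
  have x: "x \<in> carrier M" "x \<noteq> \<zero>\<^bsub>M\<^esub>" "x \<triangleleft>\<^bsub>M\<^esub> E v v = x"
    using y EV[OF vV] E_mult[OF le_refl[OF vV] le_refl[OF vV]]
    by (simp_all add: x_def M.ract_closed M.ract_assoc[symmetric])
  have zero: "x \<triangleleft>\<^bsub>M\<^esub> E v u = \<zero>\<^bsub>M\<^esub>" if u: "le v u" "u \<noteq> v" for u
  proof -
    have uV: "u \<in> V" using le_V u by blast
    have "{w. le u w} \<subset> {w. le v w}"
      using u le_trans le_refl[OF vV] antisym by blast
    moreover have "finite {w. le v w}" using le_V finite_V by (auto intro: finite_subset[of _ V])
    ultimately have "h u < h v" unfolding h_def by (rule psubset_card_mono[rotated])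
    then have "u \<notin> T" using min[of u] by auto
    then have "(x \<triangleleft>\<^bsub>M\<^esub> E v u) \<triangleleft>\<^bsub>M\<^esub> E u u = \<zero>\<^bsub>M\<^esub>"
      using uV x M.ract_closed E_closed[OF u(1)] by (auto simp: T_def)
    then show ?thesis
      using M.ract_assoc[OF x(1) E_closed[OF u(1)] EV[OF uV]] E_mult[OF u(1) le_refl[OF uV]] by simp
  qed
  define L where "L = {a \<odot>\<^bsub>underlying_space A M\<^esub> x | a. a \<in> carrier K}"
  have LI: "a \<odot>\<^bsub>underlying_space A M\<^esub> x \<in> L" if "a \<in> carrier K" for a
    using that by (auto simp: L_def)
  have L0: "\<zero>\<^bsub>M\<^esub> \<in> L"
    using LI[of "\<zero>\<^bsub>K\<^esub>"] W.smult_l_null[of x] x by (simp add: us(1,2))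
  have Ladd: "s \<oplus>\<^bsub>M\<^esub> t \<in> L" if "s \<in> L" "t \<in> L" for s t
    using that W.smult_l_distr[of _ _ x, symmetric] x LI unfolding L_def us(3)[symmetric]
    by (auto simp: us(1))
  have Lsmult: "a \<odot>\<^bsub>underlying_space A M\<^esub> s \<in> L" if "a \<in> carrier K" "s \<in> L" for a s
    using that W.smult_assoc1[of a _ x, symmetric] x LI unfolding L_def
    by (auto simp: us(1))
  have LM: "L \<subseteq> carrier M" using x W.smult_closed[of _ x] by (auto simp: L_def us(1))
  have xL: "x \<in> L" using LI[of "\<one>\<^bsub>K\<^esub>"] W.smult_one[of x] x by (simp add: us(1))
  have sc: "(s \<triangleleft>\<^bsub>M\<^esub> (a \<odot> \<one>)) \<triangleleft>\<^bsub>M\<^esub> r = a \<odot>\<^bsub>underlying_space A M\<^esub> (s \<triangleleft>\<^bsub>M\<^esub> r)"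
    "s \<triangleleft>\<^bsub>M\<^esub> (a \<odot> r) = a \<odot>\<^bsub>underlying_space A M\<^esub> (s \<triangleleft>\<^bsub>M\<^esub> r)"
    if "a \<in> carrier K" "r \<in> carrier A" "s \<in> carrier M" for a r s
    using that scalar_one_central[OF algebra that(1,2)] scalar_one_closed[OF algebra that(1)]
    by (simp_all add: us M.ract_assoc[symmetric])
  have xr: "x \<triangleleft>\<^bsub>M\<^esub> r \<in> L" if "r \<in> carrier A" for r
    using that
  proof (induction rule: E_induct)
    case zero
    then show ?case using L0 x by (simp add: M.ract_r_null)
  next
    case (add r s)
    then show ?case using Ladd x by (simp add: M.ract_r_distr)
  next
    case (smult a r)
    then show ?case using Lsmult x by (simp add: sc)
  next
    case (unit u w)
    show ?case
    proof (cases "u = v")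
      case True
      then show ?thesis using zero[of w] unit x xL L0 by (cases "w = v") auto
    next
      case False
      have "x \<triangleleft>\<^bsub>M\<^esub> E u w = x \<triangleleft>\<^bsub>M\<^esub> (E v v \<otimes> E u w)"
        using x M.ract_assoc[OF x(1) EV[OF vV] E_closed[OF unit]] by simp
      also have "\<dots> = \<zero>\<^bsub>M\<^esub>"
        using E_orth[OF le_refl[OF vV] unit] False x by (simp add: M.ract_r_null)
      finally show ?thesis using L0 by simp
    qed
  qed
  have "right_submodule A M L"
  proof (rule M.right_submoduleI[OF LM L0 Ladd])
    fix s r assume "s \<in> L" and r: "r \<in> carrier A"
    then obtain a where "a \<in> carrier K" "s = x \<triangleleft>\<^bsub>M\<^esub> (a \<odot> \<one>)" by (auto simp: L_def us(4))
    then show "s \<triangleleft>\<^bsub>M\<^esub> r \<in> L" using Lsmult xr[OF r] sc(1)[of a r x] r x by simp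
  qed
  then have "L = carrier M"
    using simple xL x unfolding simple_right_module_def by blast
  then show "vectorspace.fin_dim K (underlying_space A M)" "vectorspace.dim K (underlying_space A M) = 1"
    using vectorspace_dim_one[OF vs, of x] x by (auto simp: us(1,2) L_def)
qed

end

context incidence_units
begin

text \<open>
  Here \<open>J\<close> indexes representatives of the classes of mutually comparable elements, and \<open>e\<close> is the
  sum of their idempotents. The elements \<open>E v (w j)\<close> and \<open>E (w j) v\<close>, for \<open>w j\<close> the representative of
  \<open>v\<close>, witness that \<open>e\<close> is full. The corner \<open>eAe\<close> is again spanned by matrix units, now over the
  partially ordered set of classes: compressing \<open>E u v\<close> by \<open>e\<close> on both sides leaves it unchanged if
  \<open>u\<close> and \<open>v\<close> are representatives, and kills it otherwise.
\<close>

theorem basic_morita_representatives: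
  fixes J :: "'j set" and w :: "'j \<Rightarrow> 'v"
  assumes J: "finite J" and wV: "\<And>j. j \<in> J \<Longrightarrow> w j \<in> V"
    and cover: "\<And>v. v \<in> V \<Longrightarrow> \<exists>j\<in>J. le v (w j) \<and> le (w j) v"
    and unique: "\<And>i j. \<lbrakk>i \<in> J; j \<in> J; le (w i) (w j); le (w j) (w i)\<rbrakk> \<Longrightarrow> i = j"
    and P: "P = rmodule_direct_sum J (\<lambda>j. right_ideal_rmodule A (E (w j) (w j)))"
  shows "basic_algebra TYPE('u) K (End_algebra A P) \<and> morita_equivalent K A (End_algebra A P)"
proof -
  let ?B = "End_algebra A P"
  define e where "e = (\<Oplus>j\<in>J. E (w j) (w j))"
  define p where "p = (\<lambda>j\<in>J. E (w j) (w j))"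
  define \<theta> where "\<theta> = (\<lambda>f\<in>carrier P. \<Oplus>j\<in>J. f j)"
  define \<phi> where "\<phi> = evaluate_at p \<theta>"
  have refl: "le (w j) (w j)" if "j \<in> J" for j using le_refl wV that by blast
  have w_inj: "i = j" if "i \<in> J" "j \<in> J" "w i = w j" for i j
    using unique[OF that(1,2)] refl[OF that(1)] that(3) by simp
  have idem_closed: "E (w j) (w j) \<in> carrier A" if "j \<in> J" for j using E_closed refl that by blast
  have idem: "E (w j) (w j) \<otimes> E (w j) (w j) = E (w j) (w j)" if "j \<in> J" for j
    by (rule E_mult[OF refl[OF that] refl[OF that]])
  have orth: "E (w i) (w i) \<otimes> E (w j) (w j) = \<zero>" if "i \<in> J" "j \<in> J" "i \<noteq> j" for i j
    by (rule E_orth[OF refl[OF that(1)] refl[OF that(2)]]) (use w_inj that in blast)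
  note dual_basis = orthogonal_idempotents_dual_basis[OF ring_axioms J idem_closed idem orth P \<theta>_def]
  have dual: "dual_basis_one A P p \<theta>" unfolding p_def by (rule dual_basis(1))
  have \<theta>p: "\<theta> p = e" unfolding p_def e_def by (rule dual_basis(2))
  interpret dual: dual_basis_one A P p \<theta> by (rule dual)
  note End = End_to_corner_algebra[OF algebra dual, folded \<phi>_def]
  have B_carrier: "carrier ?B = rmodule_hom A P P" by (simp add: End_algebra_simps)
  have e_closed: "e \<in> carrier A" unfolding e_def by (rule finsum_closed) (use idem_closed in auto)
  have delta: "(\<Oplus>j\<in>J. if w j = u then z else \<zero>) = (if u \<in> w ` J then z else \<zero>)"
    if z: "z \<in> carrier A" for u z
  proof (cases "u \<in> w ` J")
    case True
    then obtain i where i: "i \<in> J" "u = w i" by auto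
    have "(\<Oplus>j\<in>J. if w j = u then z else \<zero>) = (\<Oplus>j\<in>J. if i = j then z else \<zero>)"
      by (rule finsum_cong') (use i z w_inj in auto)
    also have "\<dots> = z" by (rule finsum_singleton[OF i(1) J]) (use z in auto)
    finally show ?thesis using True by simp
  next
    case False
    then have "w j \<noteq> u" if "j \<in> J" for j using that by blast
    then show ?thesis using False by (simp add: add.finprod_one_eqI)
  qed
  have e_E: "e \<otimes> E u v = (if u \<in> w ` J then E u v else \<zero>)" if uv: "le u v" for u v
  proof -
    have "e \<otimes> E u v = (\<Oplus>j\<in>J. E (w j) (w j) \<otimes> E u v)"
      unfolding e_def by (rule finsum_ldistr) (use J idem_closed E_closed[OF uv] in auto)
    also have "\<dots> = (\<Oplus>j\<in>J. if w j = u then E u v else \<zero>)"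
    proof (rule finsum_cong')
      fix j assume j: "j \<in> J"
      show "E (w j) (w j) \<otimes> E u v = (if w j = u then E u v else \<zero>)"
        using E_mult[OF refl[OF j], of v] E_orth[OF refl[OF j] uv] uv by auto
    qed (use E_closed[OF uv] in auto)
    finally show ?thesis by (simp add: delta E_closed[OF uv])
  qed
  have E_e: "E u v \<otimes> e = (if v \<in> w ` J then E u v else \<zero>)" if uv: "le u v" for u v
  proof -
    have "E u v \<otimes> e = (\<Oplus>j\<in>J. E u v \<otimes> E (w j) (w j))"
      unfolding e_def by (rule finsum_rdistr) (use J idem_closed E_closed[OF uv] in auto)
    also have "\<dots> = (\<Oplus>j\<in>J. if w j = v then E u v else \<zero>)"
    proof (rule finsum_cong')
      fix j assume j: "j \<in> J"
      show "E u v \<otimes> E (w j) (w j) = (if w j = v then E u v else \<zero>)"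
        using E_mult[OF uv, of v] E_orth[OF uv refl[OF j]] uv refl[OF j] by auto
    qed (use E_closed[OF uv] in auto)
    finally show ?thesis by (simp add: delta E_closed[OF uv])
  qed
  obtain c where c: "\<And>v. v \<in> V \<Longrightarrow> c v \<in> J" "\<And>v. v \<in> V \<Longrightarrow> le v (w (c v))"
      "\<And>v. v \<in> V \<Longrightarrow> le (w (c v)) v"
    using cover by metis
  interpret corner: full_corner A ?B \<phi> e V "\<lambda>v. E v (w (c v))" "\<lambda>v. E (w (c v)) v"
  proof (intro full_corner.intro full_corner_axioms.intro ring_axioms is_algebraD(4)[OF End(1)] finite_V)
    show "bij_betw \<phi> (carrier ?B) {t \<in> carrier A. e \<otimes> t = t \<and> t \<otimes> e = t}"
      using dual.End_to_corner_bij by (simp add: \<phi>_def B_carrier \<theta>p)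
    have "(\<Oplus>v\<in>V. E v (w (c v)) \<otimes> E (w (c v)) v) = (\<Oplus>v\<in>V. E v v)"
      by (rule finsum_cong') (use c E_mult E_closed[OF le_refl] in auto)
    then show "(\<Oplus>v\<in>V. E v (w (c v)) \<otimes> E (w (c v)) v) = \<one>" by (simp add: E_sum)
  qed (use End(2,3,5) c E_closed e_E E_e in \<open>auto simp: B_carrier \<theta>p\<close>)
  define le' where "le' i j \<longleftrightarrow> i \<in> J \<and> j \<in> J \<and> le (w i) (w j)" for i j
  have Ew: "E (w i) (w j) \<in> carrier A" "e \<otimes> E (w i) (w j) = E (w i) (w j)"
    "E (w i) (w j) \<otimes> e = E (w i) (w j)" if "le' i j" for i j
    using that E_closed e_E E_e by (auto simp: le'_def)
  have \<psi>E: "corner.\<psi> (E (w i) (w j)) \<in> carrier ?B" "\<phi> (corner.\<psi> (E (w i) (w j))) = E (w i) (w j)"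
    if "le' i j" for i j
    using corner.\<psi>_closed[OF Ew] corner.\<phi>_\<psi>[OF Ew] that by blast+
  have \<psi>_zero: "corner.\<psi> \<zero> = \<zero>\<^bsub>?B\<^esub>"
    by (rule corner.\<psi>_eqI) (use corner.\<phi>_finsum[of "{}"] in auto)
  have e_e: "e \<otimes> e = e" by (rule corner.e_e)
  have eAe: "e \<otimes> r \<otimes> e \<in> carrier A" "e \<otimes> (e \<otimes> r \<otimes> e) = e \<otimes> r \<otimes> e" "(e \<otimes> r \<otimes> e) \<otimes> e = e \<otimes> r \<otimes> e"
    if "r \<in> carrier A" for r
  proof -
    show "e \<otimes> r \<otimes> e \<in> carrier A" using that e_closed by simp
    have "e \<otimes> (e \<otimes> r \<otimes> e) = (e \<otimes> e) \<otimes> r \<otimes> e" using that e_closed by (simp add: m_assoc)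
    then show "e \<otimes> (e \<otimes> r \<otimes> e) = e \<otimes> r \<otimes> e" by (simp add: e_e)
    show "(e \<otimes> r \<otimes> e) \<otimes> e = e \<otimes> r \<otimes> e" using that e_closed by (simp add: m_assoc e_e)
  qed
  have \<psi>_eAe: "corner.\<psi> (e \<otimes> r \<otimes> e) \<in> carrier ?B" "\<phi> (corner.\<psi> (e \<otimes> r \<otimes> e)) = e \<otimes> r \<otimes> e"
    if "r \<in> carrier A" for r
    using corner.\<psi>_closed[OF eAe[OF that]] corner.\<phi>_\<psi>[OF eAe[OF that]] by blast+
  have units: "incidence_units K ?B J le' (\<lambda>i j. corner.\<psi> (E (w i) (w j)))"
  proof (rule incidence_units.intro[OF End(1) J])
    show "le' j j" if "j \<in> J" for j using refl that by (simp add: le'_def)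
    show "le' i k" if "le' i j" "le' j k" for i j k using that le_trans by (auto simp: le'_def)
    show "corner.\<psi> (E (w i) (w j)) \<in> carrier ?B" if "le' i j" for i j by (rule \<psi>E(1)[OF that])
  next
    fix i j k assume ij: "le' i j" and jk: "le' j k"
    show "corner.\<psi> (E (w i) (w j)) \<otimes>\<^bsub>?B\<^esub> corner.\<psi> (E (w j) (w k)) = corner.\<psi> (E (w i) (w k))"
      by (rule corner.\<psi>_eqI[symmetric])
        (use ij jk in \<open>auto simp: \<psi>E corner.\<phi>_mult le'_def intro!: corner.B.m_closed E_mult\<close>)
  next
    fix i j j' k assume ij: "le' i j" and jk: "le' j' k" and "j \<noteq> j'"
    then have "E (w i) (w j) \<otimes> E (w j') (w k) = \<zero>"
      using w_inj by (intro E_orth) (auto simp: le'_def)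
    then have "corner.\<psi> \<zero> = corner.\<psi> (E (w i) (w j)) \<otimes>\<^bsub>?B\<^esub> corner.\<psi> (E (w j') (w k))"
      using ij jk by (intro corner.\<psi>_eqI) (simp_all add: \<psi>E corner.\<phi>_mult)
    then show "corner.\<psi> (E (w i) (w j)) \<otimes>\<^bsub>?B\<^esub> corner.\<psi> (E (w j') (w k)) = \<zero>\<^bsub>?B\<^esub>"
      by (simp add: \<psi>_zero)
  next
    have le'_refl: "le' j j" if "j \<in> J" for j using refl that by (simp add: le'_def)
    have "\<phi> (\<Oplus>\<^bsub>?B\<^esub>j\<in>J. corner.\<psi> (E (w j) (w j))) = (\<Oplus>j\<in>J. \<phi> (corner.\<psi> (E (w j) (w j))))"
      by (rule corner.\<phi>_finsum[OF J]) (use \<psi>E(1) le'_refl in auto)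
    also have "\<dots> = e"
      unfolding e_def by (rule finsum_cong') (use \<psi>E(2)[OF le'_refl] idem_closed in auto)
    finally have "corner.\<psi> e = (\<Oplus>\<^bsub>?B\<^esub>j\<in>J. corner.\<psi> (E (w j) (w j)))"
      by (intro corner.\<psi>_eqI corner.B.finsum_closed) (use \<psi>E(1) le'_refl in auto)
    moreover have "corner.\<psi> e = \<one>\<^bsub>?B\<^esub>" by (rule corner.\<psi>_eqI) (simp_all add: corner.\<phi>_one)
    ultimately show "(\<Oplus>\<^bsub>?B\<^esub>j\<in>J. corner.\<psi> (E (w j) (w j))) = \<one>\<^bsub>?B\<^esub>" by simp
  next
    let ?S = "{corner.\<psi> (E (w i) (w j)) | i j. le' i j}"
    interpret B: module K ?B by (rule is_algebraD(3)[OF End(1)])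
    have S: "?S \<subseteq> carrier ?B" using \<psi>E(1) by auto
    note sub = B.span_is_submodule[OF S]
    note Q0 = LinearCombinations.submodule.zero_closed[OF sub]
      and Qadd = LinearCombinations.submodule.m_closed[OF sub]
      and Qsmult = LinearCombinations.submodule.smult_closed[OF sub]
    have QE: "corner.\<psi> (E (w i) (w j)) \<in> B.span ?S" if "le' i j" for i j
      using B.in_own_span[OF S] that by auto
    have Q: "corner.\<psi> (e \<otimes> r \<otimes> e) \<in> B.span ?S" if "r \<in> carrier A" for r
      using that
    proof (induction rule: E_induct)
      case zero
      then show ?case using Q0 e_closed by (simp add: \<psi>_zero)
    next
      case (add r s)
      have "corner.\<psi> (e \<otimes> (r \<oplus> s) \<otimes> e) = corner.\<psi> (e \<otimes> r \<otimes> e \<oplus> e \<otimes> s \<otimes> e)"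
        using add e_closed by (simp add: r_distr l_distr)
      also have "\<dots> = corner.\<psi> (e \<otimes> r \<otimes> e) \<oplus>\<^bsub>?B\<^esub> corner.\<psi> (e \<otimes> s \<otimes> e)"
        using add eAe \<psi>_eAe by (intro corner.\<psi>_eqI) (simp_all add: corner.\<phi>_add)
      finally show ?case using Qadd add \<psi>_eAe by simp
    next
      case (smult a r)
      interpret A: module K A by (rule is_algebraD(3)[OF algebra])
      have "corner.\<psi> (e \<otimes> (a \<odot> r) \<otimes> e) = corner.\<psi> (a \<odot> (e \<otimes> r \<otimes> e))"
        using smult e_closed by (simp add: is_algebraD(5,6)[OF algebra])
      also have "\<dots> = a \<odot>\<^bsub>?B\<^esub> corner.\<psi> (e \<otimes> r \<otimes> e)"
        using smult \<psi>_eAe End(4)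
        by (intro corner.\<psi>_eqI) (auto simp: B_carrier[symmetric])
      finally show ?case using Qsmult smult \<psi>_eAe by simp
    next
      case (unit u v)
      show ?case
      proof (cases "u \<in> w ` J \<and> v \<in> w ` J")
        case True
        then obtain i j where "i \<in> J" "j \<in> J" "u = w i" "v = w j" by auto
        then show ?thesis using QE[of i j] unit by (simp add: e_E E_e le'_def)
      next
        case False
        then have "e \<otimes> E u v \<otimes> e = \<zero>" using unit e_closed by (auto simp: e_E E_e)
        then show ?thesis using Q0 by (simp add: \<psi>_zero)
      qed
    qed
    have "x \<in> B.span ?S" if x: "x \<in> carrier ?B" for x
      using Q[OF corner.\<phi>_closed[OF x]] x by (simp add: corner.e_\<phi> corner.\<phi>_e corner.\<psi>_\<phi>)
    then show "B.span ?S = carrier ?B" using B.span_is_subset2[OF S] by auto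
  next
    show "i \<in> J \<and> j \<in> J" if "le' i j" for i j using that by (simp add: le'_def)
  qed
  have "basic_algebra TYPE('u) K ?B"
    by (rule incidence_units.antisym_basic[OF units]) (use unique in \<open>auto simp: le'_def\<close>)
  moreover have "morita_equivalent K A ?B"
    unfolding morita_equivalent_def using algebra End(1) corner.corner_equivalence by simp
  ultimately show ?thesis by simp
qed

end

section \<open>The path algebra\<close>

lemma (in comm_monoid) finprod_Sigma:
  assumes "finite X" "\<And>x. x \<in> X \<Longrightarrow> finite (Y x)"
    and "\<And>x y. \<lbrakk>x \<in> X; y \<in> Y x\<rbrakk> \<Longrightarrow> f x y \<in> carrier G"
  shows "(\<Otimes>x\<in>X. \<Otimes>y\<in>Y x. f x y) = (\<Otimes>z\<in>Sigma X Y. f (fst z) (snd z))"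
  using assms
proof (induction X rule: finite_induct)
  case (insert x X)
  have "Sigma (insert x X) Y = Pair x ` Y x \<union> Sigma X Y" by auto
  moreover have "finprod G (\<lambda>z. f (fst z) (snd z)) (Pair x ` Y x \<union> Sigma X Y)
      = finprod G (\<lambda>z. f (fst z) (snd z)) (Pair x ` Y x) \<otimes> finprod G (\<lambda>z. f (fst z) (snd z)) (Sigma X Y)"
    by (rule finprod_Un_disjoint) (use insert in auto)
  moreover have "finprod G (\<lambda>z. f (fst z) (snd z)) (Pair x ` Y x) = finprod G (f x) (Y x)"
    by (subst finprod_reindex) (use insert in \<open>auto simp: inj_on_def\<close>)
  moreover have "(\<lambda>x. finprod G (f x) (Y x)) \<in> X \<rightarrow> carrier G" "finprod G (f x) (Y x) \<in> carrier G"
    using insert by (auto intro!: finprod_closed)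
  ultimately show ?case using insert by simp
qed simp

definition path_concat :: "('v, 'e) qpath \<Rightarrow> ('v, 'e) qpath \<Rightarrow> ('v, 'e) qpath" where
  "path_concat p q = (fst p, fst (snd p) @ fst (snd q), snd (snd q))"

definition factorizations :: "('v, 'e) pre_digraph \<Rightarrow> ('v, 'e) qpath \<Rightarrow> (('v, 'e) qpath \<times> ('v, 'e) qpath) set" where
  "factorizations Q r = {(p, q). p \<in> qpaths Q \<and> q \<in> qpaths Q \<and> is_concat p q r}"

lemma factorizations_iff:
  "(p, q) \<in> factorizations Q r \<longleftrightarrow>
     p \<in> qpaths Q \<and> q \<in> qpaths Q \<and> snd (snd p) = fst q \<and> r = path_concat p q"
  by (cases p; cases q) (auto simp: factorizations_def is_concat_def path_concat_def)

lemma factorizations_fst_snd: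
  assumes "s \<in> factorizations Q r"
  shows "fst s \<in> qpaths Q" "snd s \<in> qpaths Q" "snd (snd (fst s)) = fst (snd s)"
    "r = path_concat (fst s) (snd s)"
  using assms factorizations_iff[of "fst s" "snd s" Q r] by auto

lemma path_concat_assoc: "path_concat (path_concat p q) r = path_concat p (path_concat q r)"
  by (simp add: path_concat_def)

lemma path_concat_ends [simp]:
  "fst (path_concat p q) = fst p" "snd (snd (path_concat p q)) = snd (snd q)"
  by (simp_all add: path_concat_def)

context wf_digraph
begin

lemma path_concat_qpaths:
  assumes "p \<in> qpaths G" "q \<in> qpaths G" "snd (snd p) = fst q"
  shows "path_concat p q \<in> qpaths G"
  using assms by (cases p; cases q) (auto simp: qpaths_def path_concat_def)

lemma vertex_qpath: "(v, [], w) \<in> qpaths G \<longleftrightarrow> v = w \<and> v \<in> verts G"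
  by (auto simp: qpaths_def awalk_Nil_iff)

lemma qpath_ends: "p \<in> qpaths G \<Longrightarrow> fst p \<in> verts G \<and> snd (snd p) \<in> verts G"
  by (auto simp: qpaths_def)

text \<open>
  A factorization of a path is determined by the length of its first factor.
\<close>

lemma finite_factorizations: "finite (factorizations G r)"
proof -
  obtain u cs w where r: "r = (u, cs, w)" by (cases r)
  define h where "h i = ((u, take i cs, awlast u (take i cs)), (awlast u (take i cs), drop i cs, w))" for i
  have "factorizations G r \<subseteq> h ` {..length cs}"
  proof
    fix s assume s: "s \<in> factorizations G r"
    obtain as x bs where s': "s = ((u, as, x), (x, bs, w))" "cs = as @ bs" "awalk u as x"
      using factorizations_fst_snd[OF s] r
      by (cases s) (auto simp: path_concat_def qpaths_def)
    then have "s = h (length as)" by (simp add: h_def)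
    then show "s \<in> h ` {..length cs}" using s' by auto
  qed
  then show ?thesis using finite_surj by blast
qed

end

lemma path_algebra_simps:
  "\<zero>\<^bsub>path_algebra K Q\<^esub> = (\<lambda>r. \<zero>\<^bsub>K\<^esub>)"
  "f \<oplus>\<^bsub>path_algebra K Q\<^esub> g = (\<lambda>r. f r \<oplus>\<^bsub>K\<^esub> g r)"
  "a \<odot>\<^bsub>path_algebra K Q\<^esub> f = (\<lambda>r. a \<otimes>\<^bsub>K\<^esub> f r)"
  "f \<otimes>\<^bsub>path_algebra K Q\<^esub> g = (\<lambda>r. \<Oplus>\<^bsub>K\<^esub>s\<in>factorizations Q r. f (fst s) \<otimes>\<^bsub>K\<^esub> g (snd s))"
  "\<one>\<^bsub>path_algebra K Q\<^esub> = (\<lambda>r. if r \<in> {(v, [], v) | v. v \<in> verts Q} then \<one>\<^bsub>K\<^esub> else \<zero>\<^bsub>K\<^esub>)"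
  by (simp_all add: path_algebra_def factorizations_def)

lemma path_algebra_carrier:
  "f \<in> carrier (path_algebra K Q) \<longleftrightarrow>
     (\<forall>r. f r \<in> carrier K) \<and> finite {r. f r \<noteq> \<zero>\<^bsub>K\<^esub>} \<and> (\<forall>r. f r \<noteq> \<zero>\<^bsub>K\<^esub> \<longrightarrow> r \<in> qpaths Q)"
  by (auto simp: path_algebra_def)

locale quiver_algebra = K: field K + Q: fin_digraph Q
  for K :: "('k, 'c) ring_scheme" (structure) and Q :: "('v, 'e) pre_digraph"
begin

abbreviation KQ :: "('k, ('v, 'e) qpath \<Rightarrow> 'k) module" where "KQ \<equiv> path_algebra K Q"

(* A path is a triple; quantifiers over paths are not to be split into quantifiers over its parts. *)
declare split_paired_All [simp del] split_paired_Ex [simp del]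

lemma coeff_closed: "f \<in> carrier KQ \<Longrightarrow> f r \<in> carrier K"
  by (simp add: path_algebra_carrier)

lemma summand_closed:
  "\<lbrakk>f \<in> carrier KQ; g \<in> carrier KQ\<rbrakk> \<Longrightarrow> f p \<otimes> g q \<in> carrier K"
  by (simp add: coeff_closed)

lemma mult_closed:
  assumes f: "f \<in> carrier KQ" and g: "g \<in> carrier KQ"
  shows "f \<otimes>\<^bsub>KQ\<^esub> g \<in> carrier KQ"
proof -
  let ?S = "(\<lambda>(p, q). path_concat p q) ` ({p. f p \<noteq> \<zero>} \<times> {q. g q \<noteq> \<zero>})"
  have *: "r \<in> ?S \<inter> qpaths Q" if r: "(f \<otimes>\<^bsub>KQ\<^esub> g) r \<noteq> \<zero>" for r
  proof -
    have "\<exists>s\<in>factorizations Q r. f (fst s) \<otimes> g (snd s) \<noteq> \<zero>"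
      using r K.add.finprod_one_eqI[of "factorizations Q r" "\<lambda>s. f (fst s) \<otimes> g (snd s)"]
      unfolding path_algebra_simps by blast
    then obtain s where s: "s \<in> factorizations Q r" "f (fst s) \<otimes> g (snd s) \<noteq> \<zero>" by blast
    then have "f (fst s) \<noteq> \<zero>" "g (snd s) \<noteq> \<zero>"
      using coeff_closed f g by fastforce+
    then show ?thesis
      using factorizations_fst_snd[OF s(1)] Q.path_concat_qpaths[of "fst s" "snd s"] by force
  qed
  have "finite ?S" using f g by (auto simp: path_algebra_carrier)
  then have "finite {r. (f \<otimes>\<^bsub>KQ\<^esub> g) r \<noteq> \<zero>}" by (rule finite_subset[rotated]) (use * in blast)
  moreover have "(f \<otimes>\<^bsub>KQ\<^esub> g) r \<in> carrier K" for r
    by (auto simp: path_algebra_simps intro!: K.finsum_closed summand_closed f g)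
  ultimately show ?thesis using * by (auto simp: path_algebra_carrier)
qed

text \<open>
  Both triple products are the sum over all ways of cutting the path \<open>r\<close> into three paths, once
  cutting \<open>(ab)c\<close> and once \<open>a(bc)\<close>.
\<close>

lemma mult_assoc:
  assumes f: "f \<in> carrier KQ" and g: "g \<in> carrier KQ" and h: "h \<in> carrier KQ"
  shows "(f \<otimes>\<^bsub>KQ\<^esub> g) \<otimes>\<^bsub>KQ\<^esub> h = f \<otimes>\<^bsub>KQ\<^esub> (g \<otimes>\<^bsub>KQ\<^esub> h)"
proof
  fix r
  note cl = coeff_closed[OF f] coeff_closed[OF g] coeff_closed[OF h]
  note fin = Q.finite_factorizations
  let ?t = "\<lambda>(a, b, c). f a \<otimes> g b \<otimes> h c"
  let ?L = "SIGMA s:factorizations Q r. factorizations Q (fst s)"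
  let ?R = "SIGMA s:factorizations Q r. factorizations Q (snd s)"
  define l where "l = (\<lambda>(s :: ('v, 'e) qpath \<times> ('v, 'e) qpath, s' :: ('v, 'e) qpath \<times> ('v, 'e) qpath).
    (fst s', snd s', snd s))"
  define m where "m = (\<lambda>(s :: ('v, 'e) qpath \<times> ('v, 'e) qpath, s' :: ('v, 'e) qpath \<times> ('v, 'e) qpath).
    (fst s, fst s', snd s'))"
  define T where "T = {(a, b, c). a \<in> qpaths Q \<and> b \<in> qpaths Q \<and> c \<in> qpaths Q \<and>
    snd (snd a) = fst b \<and> snd (snd b) = fst c \<and> r = path_concat a (path_concat b c)}"
  have l: "inj_on l ?L" "l ` ?L = T"
  proof -
    show "inj_on l ?L"
    proof (rule inj_on_inverseI)
      fix z assume "z \<in> ?L"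
      then obtain s s' where "z = (s, s')" "s' \<in> factorizations Q (fst s)" by blast
      then show "(\<lambda>(a, b, c). ((path_concat a b, c), (a, b))) (l z) = z"
        using factorizations_fst_snd(4)[of s' Q "fst s", symmetric] by (simp add: l_def)
    qed
    show "l ` ?L = T"
    proof (intro equalityI subsetI)
      fix x assume "x \<in> l ` ?L"
      then obtain s s' where s: "x = l (s, s')" "s \<in> factorizations Q r"
          "s' \<in> factorizations Q (fst s)" by blast
      show "x \<in> T"
        using factorizations_fst_snd[OF s(2)] factorizations_fst_snd[OF s(3)] s(1)
        by (simp add: l_def T_def path_concat_assoc)
    next
      fix x assume x: "x \<in> T"
      obtain a b c where abc: "x = (a, b, c)" by (cases x)
      with x have "((path_concat a b, c), (a, b)) \<in> ?L"
        by (auto simp: T_def factorizations_iff path_concat_assoc intro: Q.path_concat_qpaths)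
      then show "x \<in> l ` ?L" by (rule rev_image_eqI) (simp add: l_def abc)
    qed
  qed
  have m: "inj_on m ?R" "m ` ?R = T"
  proof -
    show "inj_on m ?R"
    proof (rule inj_on_inverseI)
      fix z assume "z \<in> ?R"
      then obtain s s' where "z = (s, s')" "s' \<in> factorizations Q (snd s)" by blast
      then show "(\<lambda>(a, b, c). ((a, path_concat b c), (b, c))) (m z) = z"
        using factorizations_fst_snd(4)[of s' Q "snd s", symmetric] by (simp add: m_def case_prod_beta)
    qed
    show "m ` ?R = T"
    proof (intro equalityI subsetI)
      fix x assume "x \<in> m ` ?R"
      then obtain s s' where s: "x = m (s, s')" "s \<in> factorizations Q r"
          "s' \<in> factorizations Q (snd s)" by blast
      show "x \<in> T"
        using factorizations_fst_snd[OF s(2)] factorizations_fst_snd[OF s(3)] s(1)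
        by (simp add: m_def T_def case_prod_beta)
    next
      fix x assume x: "x \<in> T"
      obtain a b c where abc: "x = (a, b, c)" by (cases x)
      with x have "((a, path_concat b c), (b, c)) \<in> ?R"
        by (auto simp: T_def factorizations_iff intro: Q.path_concat_qpaths)
      then show "x \<in> m ` ?R" by (rule rev_image_eqI) (simp add: m_def abc)
    qed
  qed
  have "((f \<otimes>\<^bsub>KQ\<^esub> g) \<otimes>\<^bsub>KQ\<^esub> h) r = (\<Oplus>s\<in>factorizations Q r. \<Oplus>s'\<in>factorizations Q (fst s).
      f (fst s') \<otimes> g (snd s') \<otimes> h (snd s))"
    unfolding path_algebra_simps
    by (rule K.finsum_cong') (auto simp: fin cl intro!: K.finsum_ldistr K.finsum_closed)
  also have "\<dots> = (\<Oplus>z\<in>?L. ?t (l z))"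
    by (subst K.add.finprod_Sigma) (auto simp: fin cl l_def case_prod_beta)
  also have "\<dots> = (\<Oplus>x\<in>T. ?t x)"
    unfolding l(2)[symmetric] by (rule K.finsum_reindex[OF _ l(1), symmetric]) (auto simp: cl)
  also have "\<dots> = (\<Oplus>z\<in>?R. ?t (m z))"
    unfolding m(2)[symmetric] by (rule K.finsum_reindex[OF _ m(1)]) (auto simp: cl)
  also have "\<dots> = (\<Oplus>s\<in>factorizations Q r. \<Oplus>s'\<in>factorizations Q (snd s).
      f (fst s) \<otimes> (g (fst s') \<otimes> h (snd s')))"
    by (subst K.add.finprod_Sigma) (auto simp: fin cl m_def case_prod_beta K.m_assoc)
  also have "\<dots> = (f \<otimes>\<^bsub>KQ\<^esub> (g \<otimes>\<^bsub>KQ\<^esub> h)) r"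
    unfolding path_algebra_simps
    by (rule K.finsum_cong') (auto simp: fin cl intro!: K.finsum_rdistr[symmetric] K.finsum_closed)
  finally show "((f \<otimes>\<^bsub>KQ\<^esub> g) \<otimes>\<^bsub>KQ\<^esub> h) r = (f \<otimes>\<^bsub>KQ\<^esub> (g \<otimes>\<^bsub>KQ\<^esub> h)) r" .
qed

lemma path_elem_closed: "p \<in> qpaths Q \<Longrightarrow> path_elem K p \<in> carrier KQ"
  by (auto simp: path_algebra_carrier path_elem_def)

lemma one_closed: "\<one>\<^bsub>KQ\<^esub> \<in> carrier KQ"
proof -
  have "finite ((\<lambda>v. (v, [], v)) ` verts Q)" by simp
  then have "finite {r. \<one>\<^bsub>KQ\<^esub> r \<noteq> \<zero>}"
    by (rule finite_subset[rotated]) (auto simp: path_algebra_simps)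
  then show ?thesis by (auto simp: path_algebra_carrier path_algebra_simps Q.vertex_qpath)
qed

lemma finsum_unique_factorization:
  assumes s: "s \<in> factorizations Q r" and t: "t s \<in> carrier K"
    and other: "\<And>s'. \<lbrakk>s' \<in> factorizations Q r; s' \<noteq> s\<rbrakk> \<Longrightarrow> t s' = \<zero>"
  shows "(\<Oplus>s\<in>factorizations Q r. t s) = t s"
proof -
  have "(\<Oplus>s'\<in>factorizations Q r. t s') = (\<Oplus>s'\<in>factorizations Q r. if s = s' then t s else \<zero>)"
    by (rule K.finsum_cong') (use t other in auto)
  also have "\<dots> = t s"
    using K.finsum_singleton[OF s Q.finite_factorizations, of "\<lambda>_. t s"] t by simp
  finally show ?thesis .
qed

lemma one_mult:
  assumes f: "f \<in> carrier KQ"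
  shows "\<one>\<^bsub>KQ\<^esub> \<otimes>\<^bsub>KQ\<^esub> f = f" "f \<otimes>\<^bsub>KQ\<^esub> \<one>\<^bsub>KQ\<^esub> = f"
proof -
  note cl = coeff_closed[OF f]
  have one: "\<one>\<^bsub>KQ\<^esub> p = \<zero>" if "fst (snd p) \<noteq> []" for p
    using that by (auto simp: path_algebra_simps(5))
  have "(\<one>\<^bsub>KQ\<^esub> \<otimes>\<^bsub>KQ\<^esub> f) r = f r \<and> (f \<otimes>\<^bsub>KQ\<^esub> \<one>\<^bsub>KQ\<^esub>) r = f r" for r
  proof (cases "r \<in> qpaths Q")
    case True
    note ends = Q.qpath_ends[OF True]
    let ?l = "((fst r, [], fst r), r)" and ?r = "(r, (snd (snd r), [], snd (snd r)))"
    have lr: "?l \<in> factorizations Q r" "?r \<in> factorizations Q r"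
      using True ends by (simp_all add: factorizations_iff Q.vertex_qpath path_concat_def)
    have l_unique: "s = ?l" if s: "s \<in> factorizations Q r" and "fst (snd (fst s)) = []" for s
    proof -
      have "fst s = (fst r, [], fst r)" "snd s = r"
        using that(2) factorizations_fst_snd[OF s] Q.vertex_qpath[of "fst (fst s)" "snd (snd (fst s))"]
        by (cases s; auto simp: path_concat_def prod_eq_iff)+
      then show ?thesis by (simp add: prod_eq_iff)
    qed
    have r_unique: "s = ?r" if s: "s \<in> factorizations Q r" and "fst (snd (snd s)) = []" for s
    proof -
      have "snd s = (snd (snd r), [], snd (snd r))" "fst s = r"
        using that(2) factorizations_fst_snd[OF s] Q.vertex_qpath[of "fst (snd s)" "snd (snd (snd s))"]
        by (cases s; auto simp: path_concat_def prod_eq_iff)+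
      then show ?thesis by (simp add: prod_eq_iff)
    qed
    have "(\<Oplus>s\<in>factorizations Q r. \<one>\<^bsub>KQ\<^esub> (fst s) \<otimes> f (snd s)) = \<one>\<^bsub>KQ\<^esub> (fst r, [], fst r) \<otimes> f r"
      using finsum_unique_factorization[OF lr(1), of "\<lambda>s. \<one>\<^bsub>KQ\<^esub> (fst s) \<otimes> f (snd s)"]
        cl one l_unique coeff_closed[OF one_closed] by fastforce
    moreover have "(\<Oplus>s\<in>factorizations Q r. f (fst s) \<otimes> \<one>\<^bsub>KQ\<^esub> (snd s)) = f r \<otimes> \<one>\<^bsub>KQ\<^esub> (snd (snd r), [], snd (snd r))"
      using finsum_unique_factorization[OF lr(2), of "\<lambda>s. f (fst s) \<otimes> \<one>\<^bsub>KQ\<^esub> (snd s)"]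
        cl one r_unique coeff_closed[OF one_closed] by fastforce
    ultimately show ?thesis using cl ends by (auto simp: path_algebra_simps(4,5))
  next
    case False
    have "factorizations Q r = {}" "f r = \<zero>"
      using False f factorizations_fst_snd[of _ Q r] Q.path_concat_qpaths
      by (auto simp: path_algebra_carrier) metis+
    then show ?thesis by (simp add: path_algebra_simps(4))
  qed
  then show "\<one>\<^bsub>KQ\<^esub> \<otimes>\<^bsub>KQ\<^esub> f = f" "f \<otimes>\<^bsub>KQ\<^esub> \<one>\<^bsub>KQ\<^esub> = f" by blast+
qed

lemma add_closed:
  assumes "f \<in> carrier KQ" "g \<in> carrier KQ"
  shows "f \<oplus>\<^bsub>KQ\<^esub> g \<in> carrier KQ"
proof -
  have "finite ({r. f r \<noteq> \<zero>} \<union> {r. g r \<noteq> \<zero>})"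
    using assms by (simp add: path_algebra_carrier)
  then have "finite {r. (f \<oplus>\<^bsub>KQ\<^esub> g) r \<noteq> \<zero>}"
    by (rule finite_subset[rotated]) (auto simp: path_algebra_simps)
  then show ?thesis
    using assms by (auto simp: path_algebra_carrier path_algebra_simps) (metis K.l_zero K.zero_closed)
qed

lemma smult_closed:
  assumes "a \<in> carrier K" "f \<in> carrier KQ"
  shows "a \<odot>\<^bsub>KQ\<^esub> f \<in> carrier KQ"
proof -
  have "finite {r. f r \<noteq> \<zero>}" using assms by (simp add: path_algebra_carrier)
  then have "finite {r. (a \<odot>\<^bsub>KQ\<^esub> f) r \<noteq> \<zero>}"
    by (rule finite_subset[rotated]) (use assms in \<open>auto simp: path_algebra_simps\<close>)
  then show ?thesis
    using assms by (auto simp: path_algebra_carrier path_algebra_simps) (metis K.r_null)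
qed

lemma path_algebra_is_algebra: "is_algebra K KQ"
proof -
  note cl = coeff_closed
  note smult_cl = smult_closed and add_cl = add_closed
  have grp: "abelian_group KQ"
  proof (rule abelian_groupI)
    fix f assume f: "f \<in> carrier KQ"
    show "\<exists>g\<in>carrier KQ. g \<oplus>\<^bsub>KQ\<^esub> f = \<zero>\<^bsub>KQ\<^esub>"
      by (rule bexI[OF _ smult_cl[of "\<ominus> \<one>" f]])
        (use f cl in \<open>auto simp: path_algebra_simps K.l_minus K.l_neg\<close>)
  qed (auto simp: add_cl, auto simp: path_algebra_simps K.a_ac cl path_algebra_carrier)
  have mon: "monoid KQ"
    by (rule monoidI) (simp_all add: mult_closed one_closed mult_assoc one_mult)
  have ring: "ring KQ"
  proof (rule ringI[OF grp mon])
    fix f g h assume f: "f \<in> carrier KQ" and g: "g \<in> carrier KQ" and h: "h \<in> carrier KQ"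
    note c = cl[OF f] cl[OF g] cl[OF h]
    show "(f \<oplus>\<^bsub>KQ\<^esub> g) \<otimes>\<^bsub>KQ\<^esub> h = f \<otimes>\<^bsub>KQ\<^esub> h \<oplus>\<^bsub>KQ\<^esub> g \<otimes>\<^bsub>KQ\<^esub> h"
      unfolding path_algebra_simps by (rule ext, subst K.finsum_addf[symmetric]) (auto simp: c K.l_distr)
    show "h \<otimes>\<^bsub>KQ\<^esub> (f \<oplus>\<^bsub>KQ\<^esub> g) = h \<otimes>\<^bsub>KQ\<^esub> f \<oplus>\<^bsub>KQ\<^esub> h \<otimes>\<^bsub>KQ\<^esub> g"
      unfolding path_algebra_simps by (rule ext, subst K.finsum_addf[symmetric]) (auto simp: c K.r_distr)
  qed
  have "module K KQ"
    by (rule moduleI[OF K.is_cring grp])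
      (simp add: smult_cl, auto simp: path_algebra_simps K.l_distr K.r_distr K.m_assoc cl)
  then show ?thesis
  proof (rule is_algebraI[OF K.field_axioms _ ring])
    fix a f g assume a: "a \<in> carrier K" and f: "f \<in> carrier KQ" and g: "g \<in> carrier KQ"
    note c = cl[OF f] cl[OF g]
    note fin = Q.finite_factorizations
    show "(a \<odot>\<^bsub>KQ\<^esub> f) \<otimes>\<^bsub>KQ\<^esub> g = a \<odot>\<^bsub>KQ\<^esub> (f \<otimes>\<^bsub>KQ\<^esub> g)"
      unfolding path_algebra_simps
      by (rule ext, subst K.finsum_rdistr[OF fin]) (auto simp: a c K.m_assoc)
    show "f \<otimes>\<^bsub>KQ\<^esub> (a \<odot>\<^bsub>KQ\<^esub> g) = a \<odot>\<^bsub>KQ\<^esub> (f \<otimes>\<^bsub>KQ\<^esub> g)"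
      unfolding path_algebra_simps
      by (rule ext, subst K.finsum_rdistr[OF fin]) (auto simp: a c K.m_lcomm)
  qed
qed

end

section \<open>The commuting algebra\<close>

context quiver_algebra
begin

lemma path_elem_mult:
  assumes p: "p \<in> qpaths Q" and q: "q \<in> qpaths Q"
  shows "path_elem K p \<otimes>\<^bsub>KQ\<^esub> path_elem K q
    = (if snd (snd p) = fst q then path_elem K (path_concat p q) else \<zero>\<^bsub>KQ\<^esub>)"
proof
  fix r
  have "(path_elem K p \<otimes>\<^bsub>KQ\<^esub> path_elem K q) r
      = (\<Oplus>s\<in>factorizations Q r. if (p, q) = s then \<one> else \<zero>)"
    unfolding path_algebra_simps
    by (rule K.finsum_cong') (auto simp: path_elem_def)
  also have "\<dots> = (if (p, q) \<in> factorizations Q r then \<one> else \<zero>)"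
    using K.finsum_singleton[OF _ Q.finite_factorizations, of "(p, q)" r "\<lambda>_. \<one>"]
    by (auto intro!: K.add.finprod_one_eqI)
  finally show "(path_elem K p \<otimes>\<^bsub>KQ\<^esub> path_elem K q) r
    = (if snd (snd p) = fst q then path_elem K (path_concat p q) else \<zero>\<^bsub>KQ\<^esub>) r"
    using p q by (auto simp: factorizations_iff path_elem_def path_algebra_simps)
qed

lemma sum_vertex_elems: "(\<Oplus>\<^bsub>KQ\<^esub>v\<in>verts Q. vertex_elem K v) = \<one>\<^bsub>KQ\<^esub>"
proof
  interpret KQ: ring KQ by (rule is_algebraD(4)[OF path_algebra_is_algebra])
  fix r :: "('v, 'e) qpath"
  have closed: "vertex_elem K v \<in> carrier KQ" if "v \<in> verts Q" for v
    using that by (simp add: vertex_elem_def path_elem_closed Q.vertex_qpath)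
  have coeff: "vertex_elem K v r \<in> carrier K" if "v \<in> verts Q" for v
    by (rule coeff_closed[OF closed[OF that]])
  have "(\<Oplus>\<^bsub>KQ\<^esub>v\<in>V. vertex_elem K v) r = (\<Oplus>v\<in>V. vertex_elem K v r)" if "finite V" "V \<subseteq> verts Q" for V
    using that
  proof (induction V rule: finite_induct)
    case empty
    then show ?case by (simp add: path_algebra_simps)
  next
    case (insert v V)
    then have "(\<lambda>v. vertex_elem K v) \<in> V \<rightarrow> carrier KQ" "vertex_elem K v \<in> carrier KQ"
      "(\<lambda>v. vertex_elem K v r) \<in> V \<rightarrow> carrier K" "vertex_elem K v r \<in> carrier K"
      using closed coeff by auto
    with insert show ?case by (simp add: path_algebra_simps(2))
  qed
  then have "(\<Oplus>\<^bsub>KQ\<^esub>v\<in>verts Q. vertex_elem K v) r = (\<Oplus>v\<in>verts Q. vertex_elem K v r)" by simp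
  also have "\<dots> = \<one>\<^bsub>KQ\<^esub> r"
  proof (cases "r \<in> {(v, [], v) | v. v \<in> verts Q}")
    case True
    then obtain u where u: "u \<in> verts Q" "r = (u, [], u)" by blast
    have "(\<Oplus>v\<in>verts Q. vertex_elem K v r) = (\<Oplus>v\<in>verts Q. if u = v then \<one> else \<zero>)"
      by (rule K.finsum_cong') (auto simp: u vertex_elem_def path_elem_def)
    also have "\<dots> = \<one>" by (rule K.finsum_singleton) (use u in auto)
    finally show ?thesis using u by (auto simp: path_algebra_simps)
  next
    case False
    then have "vertex_elem K v r = \<zero>" if "v \<in> verts Q" for v
      using that by (auto simp: vertex_elem_def path_elem_def)
    with False show ?thesis
      by (auto simp: path_algebra_simps(5) intro!: K.add.finprod_one_eqI)
  qed
  finally show "(\<Oplus>\<^bsub>KQ\<^esub>v\<in>verts Q. vertex_elem K v) r = \<one>\<^bsub>KQ\<^esub> r" .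
qed

lemma path_algebra_induct [consumes 1, case_names zero add smult path]:
  assumes f: "f \<in> carrier KQ" and zero: "R \<zero>\<^bsub>KQ\<^esub>"
    and add: "\<And>f g. \<lbrakk>f \<in> carrier KQ; g \<in> carrier KQ; R f; R g\<rbrakk> \<Longrightarrow> R (f \<oplus>\<^bsub>KQ\<^esub> g)"
    and smult: "\<And>a f. \<lbrakk>a \<in> carrier K; f \<in> carrier KQ; R f\<rbrakk> \<Longrightarrow> R (a \<odot>\<^bsub>KQ\<^esub> f)"
    and path: "\<And>p. p \<in> qpaths Q \<Longrightarrow> R (path_elem K p)"
  shows "R f"
proof -
  have "finite {r. f r \<noteq> \<zero>}" using f by (simp add: path_algebra_carrier)
  moreover have "R f" if "finite S" "f \<in> carrier KQ" "{r. f r \<noteq> \<zero>} \<subseteq> S" for S f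
    using that
  proof (induction S arbitrary: f rule: finite_induct)
    case empty
    then have "f = \<zero>\<^bsub>KQ\<^esub>" by (auto simp: path_algebra_simps)
    then show ?case using zero by simp
  next
    case (insert p S)
    note c = coeff_closed[OF insert.prems(1)]
    \<comment> \<open>split off the path \<open>p\<close> from the support of \<open>f\<close>\<close>
    define g where "g = f(p := \<zero>)"
    have "{r. g r \<noteq> \<zero>} \<subseteq> {r. f r \<noteq> \<zero>}" by (auto simp: g_def)
    then have g: "g \<in> carrier KQ"
      using insert.prems(1) c by (auto simp: path_algebra_carrier g_def intro: finite_subset)
    have Rg: "R g" by (rule insert.IH[OF g]) (use insert.prems in \<open>auto simp: g_def\<close>)
    show ?case
    proof (cases "f p = \<zero>")
      case True
      then have "g = f" by (auto simp: g_def)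
      then show ?thesis using Rg by simp
    next
      case False
      then have p: "p \<in> qpaths Q" using insert.prems(1) by (simp add: path_algebra_carrier)
      have "f = f p \<odot>\<^bsub>KQ\<^esub> path_elem K p \<oplus>\<^bsub>KQ\<^esub> g"
        by (rule ext) (use c in \<open>simp add: path_algebra_simps path_elem_def g_def\<close>)
      then show ?thesis
        using add[OF smult_closed[OF c path_elem_closed[OF p]] g smult[OF c path_elem_closed[OF p] path[OF p]] Rg]
        by metis
    qed
  qed
  ultimately show ?thesis using f by blast
qed

abbreviation (input) \<rho> where "\<rho> \<equiv> commuting_proj K Q"

lemma commuting_ideal_ideal: "ideal (commuting_ideal K Q) KQ"
proof -
  interpret KQ: ring KQ by (rule is_algebraD(4)[OF path_algebra_is_algebra])
  show ?thesis
    unfolding commuting_ideal_def by (rule KQ.genideal_ideal) (auto intro: path_elem_closed)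
qed

lemma commuting_algebra_proj:
  "carrier (commuting_algebra K Q) = \<rho> ` carrier KQ"
  "is_algebra K (commuting_algebra K Q)"
  "\<rho> \<zero>\<^bsub>KQ\<^esub> = \<zero>\<^bsub>commuting_algebra K Q\<^esub>"
  "\<rho> \<one>\<^bsub>KQ\<^esub> = \<one>\<^bsub>commuting_algebra K Q\<^esub>"
  "\<lbrakk>x \<in> carrier KQ; y \<in> carrier KQ\<rbrakk> \<Longrightarrow> \<rho> x \<oplus>\<^bsub>commuting_algebra K Q\<^esub> \<rho> y = \<rho> (x \<oplus>\<^bsub>KQ\<^esub> y)"
  "\<lbrakk>x \<in> carrier KQ; y \<in> carrier KQ\<rbrakk> \<Longrightarrow> \<rho> x \<otimes>\<^bsub>commuting_algebra K Q\<^esub> \<rho> y = \<rho> (x \<otimes>\<^bsub>KQ\<^esub> y)"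
  "\<lbrakk>a \<in> carrier K; x \<in> carrier KQ\<rbrakk> \<Longrightarrow> a \<odot>\<^bsub>commuting_algebra K Q\<^esub> \<rho> x = \<rho> (a \<odot>\<^bsub>KQ\<^esub> x)"
  using quotient_algebra_is_algebra[OF path_algebra_is_algebra commuting_ideal_ideal]
  unfolding commuting_algebra_def commuting_proj_def quotient_algebra_simps(1) by blast+

lemma commuting_proj_parallel:
  assumes p: "p \<in> qpaths Q" and q: "q \<in> qpaths Q" and "parallel p q"
  shows "\<rho> (path_elem K p) = \<rho> (path_elem K q)"
proof -
  interpret KQ: ring KQ by (rule is_algebraD(4)[OF path_algebra_is_algebra])
  let ?S = "{path_elem K p \<ominus>\<^bsub>KQ\<^esub> path_elem K q | p q. p \<in> qpaths Q \<and> q \<in> qpaths Q \<and> parallel p q}"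
  have "?S \<subseteq> commuting_ideal K Q"
    unfolding commuting_ideal_def by (rule KQ.genideal_self) (auto intro: path_elem_closed)
  then have "path_elem K p \<ominus>\<^bsub>KQ\<^esub> path_elem K q \<in> commuting_ideal K Q" using assms by blast
  then show ?thesis
    unfolding commuting_proj_def
    using KQ.quotient_eq_iff_same_a_r_cos[OF commuting_ideal_ideal path_elem_closed[OF p] path_elem_closed[OF q]]
    by simp
qed

definition reaches :: "'v \<Rightarrow> 'v \<Rightarrow> bool" where
  "reaches u v \<longleftrightarrow> (\<exists>as. Q.awalk u as v)"

text \<open>
  The class of an arbitrary path from \<open>u\<close> to \<open>v\<close>; by \<open>commuting_proj_parallel\<close> its choice does not
  matter.
\<close>

definition path_unit :: "'v \<Rightarrow> 'v \<Rightarrow> (('v, 'e) qpath \<Rightarrow> 'k) set" where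
  "path_unit u v = \<rho> (path_elem K (u, SOME as. Q.awalk u as v, v))"

lemma path_unit_eq:
  assumes p: "p \<in> qpaths Q"
  shows "reaches (fst p) (snd (snd p))" "path_unit (fst p) (snd (snd p)) = \<rho> (path_elem K p)"
proof -
  obtain u as v where p': "p = (u, as, v)" by (cases p)
  then have w: "Q.awalk u as v" using p by (simp add: qpaths_def)
  then show "reaches (fst p) (snd (snd p))" by (auto simp: p' reaches_def)
  have "Q.awalk u (SOME as. Q.awalk u as v) v" by (rule someI[of _ as]) (rule w)
  then have "\<rho> (path_elem K (u, SOME as. Q.awalk u as v, v)) = \<rho> (path_elem K p)"
    using p by (intro commuting_proj_parallel) (auto simp: qpaths_def parallel_def p')
  then show "path_unit (fst p) (snd (snd p)) = \<rho> (path_elem K p)" by (simp add: path_unit_def p')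
qed

lemma reaches_path:
  assumes "reaches u v"
  obtains p where "p \<in> qpaths Q" "fst p = u" "snd (snd p) = v" "path_unit u v = \<rho> (path_elem K p)"
proof -
  obtain as where as: "Q.awalk u as v" using assms by (auto simp: reaches_def)
  show thesis
    using path_unit_eq(2)[of "(u, as, v)"] that[of "(u, as, v)"] as by (simp add: qpaths_def)
qed

lemma vertex_unit:
  assumes "v \<in> verts Q"
  shows "path_unit v v = \<rho> (vertex_elem K v)"
  using path_unit_eq(2)[of "(v, [], v)"] assms by (simp add: Q.vertex_qpath vertex_elem_def)

text \<open>
  The multiplication rules are inherited from the concatenation of paths. That the \<open>path_unit\<close>s span
  follows because the paths span \<open>KQ\<close> and each of them is sent to a \<open>path_unit\<close>.
\<close>

lemma commuting_algebra_incidence_units: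
  "incidence_units K (commuting_algebra K Q) (verts Q) reaches path_unit"
proof (rule incidence_units.intro[OF commuting_algebra_proj(2)])
  let ?A = "commuting_algebra K Q"
  interpret KQ: ring KQ by (rule is_algebraD(4)[OF path_algebra_is_algebra])
  interpret A: ring ?A by (rule is_algebraD(4)[OF commuting_algebra_proj(2)])
  interpret M: module K ?A by (rule is_algebraD(3)[OF commuting_algebra_proj(2)])
  show "finite (verts Q)" by simp
  show "u \<in> verts Q \<and> v \<in> verts Q" if "reaches u v" for u v
    using that by (auto simp: reaches_def)
  show "reaches v v" if "v \<in> verts Q" for v
    using that by (auto simp: reaches_def Q.awalk_Nil_iff intro: exI[of _ "[]"])
  show closed: "path_unit u v \<in> carrier ?A" if "reaches u v" for u v
    using that by (rule reaches_path) (auto simp: commuting_algebra_proj(1) path_elem_closed)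
  show "reaches u w" if "reaches u v" "reaches v w" for u v w
    using that unfolding reaches_def by (metis Q.awalk_appendI)
  show "path_unit u v \<otimes>\<^bsub>?A\<^esub> path_unit v w = path_unit u w" if uv: "reaches u v" and vw: "reaches v w" for u v w
  proof -
    obtain p where p: "p \<in> qpaths Q" "fst p = u" "snd (snd p) = v" "path_unit u v = \<rho> (path_elem K p)"
      using uv by (rule reaches_path)
    obtain q where q: "q \<in> qpaths Q" "fst q = v" "snd (snd q) = w" "path_unit v w = \<rho> (path_elem K q)"
      using vw by (rule reaches_path)
    have "path_concat p q \<in> qpaths Q" using p q by (intro Q.path_concat_qpaths) auto
    then show ?thesis
      using path_unit_eq(2)[of "path_concat p q"] p q
      by (simp add: commuting_algebra_proj(6) path_elem_closed path_elem_mult)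
  qed
  show "path_unit u v \<otimes>\<^bsub>?A\<^esub> path_unit v' w = \<zero>\<^bsub>?A\<^esub>"
    if uv: "reaches u v" and vw: "reaches v' w" and ne: "v \<noteq> v'" for u v v' w
  proof -
    obtain p where p: "p \<in> qpaths Q" "fst p = u" "snd (snd p) = v" "path_unit u v = \<rho> (path_elem K p)"
      using uv by (rule reaches_path)
    obtain q where q: "q \<in> qpaths Q" "fst q = v'" "snd (snd q) = w" "path_unit v' w = \<rho> (path_elem K q)"
      using vw by (rule reaches_path)
    show ?thesis
      using p q ne by (simp add: commuting_algebra_proj path_elem_closed path_elem_mult)
  qed
  have vertex_closed: "vertex_elem K v \<in> carrier KQ" if "v \<in> verts Q" for v
    using that by (simp add: vertex_elem_def path_elem_closed Q.vertex_qpath)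
  have "(\<Oplus>\<^bsub>?A\<^esub>v\<in>V. path_unit v v) = \<rho> (\<Oplus>\<^bsub>KQ\<^esub>v\<in>V. vertex_elem K v)" if "finite V" "V \<subseteq> verts Q" for V
    using that
  proof (induction V rule: finite_induct)
    case empty
    then show ?case by (simp add: commuting_algebra_proj(3))
  next
    case (insert v V)
    then have "vertex_elem K \<in> V \<rightarrow> carrier KQ" "vertex_elem K v \<in> carrier KQ"
      "(\<lambda>v. path_unit v v) \<in> V \<rightarrow> carrier ?A" "path_unit v v \<in> carrier ?A"
      using vertex_closed by (auto simp: vertex_unit commuting_algebra_proj(1))
    with insert show ?case
      by (simp add: commuting_algebra_proj(5) vertex_unit KQ.finsum_closed)
  qed
  then show "(\<Oplus>\<^bsub>?A\<^esub>v\<in>verts Q. path_unit v v) = \<one>\<^bsub>?A\<^esub>"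
    by (simp add: sum_vertex_elems commuting_algebra_proj(4))
  let ?S = "{path_unit u v | u v. reaches u v}"
  have S: "?S \<subseteq> carrier ?A" using closed by auto
  note sub = M.span_is_submodule[OF S]
  have "\<rho> f \<in> M.span ?S" if "f \<in> carrier KQ" for f
    using that
  proof (induction rule: path_algebra_induct)
    case zero
    then show ?case
      using LinearCombinations.submodule.zero_closed[OF sub] by (simp add: commuting_algebra_proj(3))
  next
    case (add f g)
    then show ?case
      using LinearCombinations.submodule.m_closed[OF sub add(3,4)] by (simp add: commuting_algebra_proj(5))
  next
    case (smult a f)
    then show ?case
      using LinearCombinations.submodule.smult_closed[OF sub smult(1,3)]
      by (simp add: commuting_algebra_proj(7))
  next
    case (path p)
    then have "\<rho> (path_elem K p) \<in> ?S" using path_unit_eq[OF path] by force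
    then show ?case using M.in_own_span[OF S] by blast
  qed
  then show "M.span ?S = carrier ?A"
    using M.span_is_subset2[OF S] by (auto simp: commuting_algebra_proj(1))
qed

end

lemma rmodule_direct_sum_cong:
  assumes "\<And>i. i \<in> I \<Longrightarrow> M i = N i"
  shows "rmodule_direct_sum I M = rmodule_direct_sum I N"
proof -
  have "(\<Pi>\<^sub>E i\<in>I. carrier (M i)) = (\<Pi>\<^sub>E i\<in>I. carrier (N i))" by (rule PiE_cong) (simp add: assms)
  moreover have "{i \<in> I. x i \<noteq> \<zero>\<^bsub>M i\<^esub>} = {i \<in> I. x i \<noteq> \<zero>\<^bsub>N i\<^esub>}" for x using assms by auto
  ultimately show ?thesis by (simp add: rmodule_direct_sum_def assms cong: restrict_cong)
qed

theorem theorem5p2: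
  fixes K :: "('k, 'c) ring_scheme"
    and Q :: "('v, 'e) pre_digraph"
    and v :: "nat \<Rightarrow> 'v" and n :: nat
    and D :: "nat \<Rightarrow> 'v set" and m :: nat
    and w :: "nat \<Rightarrow> 'v"
    and A :: "('k, (('v, 'e) qpath \<Rightarrow> 'k) set) module"
    and \<rho> :: "(('v, 'e) qpath \<Rightarrow> 'k) \<Rightarrow> (('v, 'e) qpath \<Rightarrow> 'k) set"
    and P :: "((('v, 'e) qpath \<Rightarrow> 'k) set, nat \<Rightarrow> (('v, 'e) qpath \<Rightarrow> 'k) set) rmodule"
  assumes "field K"
    and "fin_digraph Q"
    and "bij_betw v {1..n} (verts Q)"
    and "bij_betw D {1..m} (path_connected_components Q)"
    and "A = commuting_algebra K Q"
    and "\<rho> = commuting_proj K Q"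
    and "\<forall>j\<in>{1..m}. w j \<in> D j"
    and "P = rmodule_direct_sum {1..m} (\<lambda>j. right_ideal_rmodule A (\<rho> (vertex_elem K (w j))))"
  shows "basic_algebra TYPE('u) K (End_algebra A P) \<and> morita_equivalent K A (End_algebra A P)"
proof -
  interpret quiver_algebra K Q by (intro quiver_algebra.intro assms(1,2))
  note units = commuting_algebra_incidence_units
  interpret incidence_units K "commuting_algebra K Q" "verts Q" reaches path_unit by (rule units)
  \<comment> \<open>representatives of different components are not mutually reachable, and each vertex is mutually reachable with one of them\<close>
  define R where "R = {(u, v). reaches u v \<and> reaches v u}"
  have comp: "path_connected_components Q = verts Q // R"
    by (simp add: path_connected_components_def R_def reaches_def)
  have equiv: "equiv (verts Q) R"
  proof -
    have "R \<subseteq> verts Q \<times> verts Q" using le_V by (auto simp: R_def)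
    moreover have "refl_on (verts Q) R" using le_refl by (simp add: refl_on_def R_def)
    moreover have "sym R" by (rule symI) (simp add: R_def)
    moreover have "trans R"
    proof (rule transI)
      fix x y z assume "(x, y) \<in> R" "(y, z) \<in> R"
      then show "(x, z) \<in> R" using le_trans[of x y z] le_trans[of z y x] by (simp add: R_def)
    qed
    ultimately show ?thesis by (simp add: equiv_def)
  qed
  have D: "D j \<in> verts Q // R" "w j \<in> D j" if "j \<in> {1..m}" for j
    using assms(4,7) that comp by (auto simp: bij_betw_def)
  have wV: "w j \<in> verts Q" if "j \<in> {1..m}" for j
    using D[OF that] in_quotient_imp_subset[OF equiv] by blast
  have "P = rmodule_direct_sum {1..m} (\<lambda>j. right_ideal_rmodule A (path_unit (w j) (w j)))"
    unfolding assms(8) assms(6) by (rule rmodule_direct_sum_cong) (simp add: vertex_unit wV)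
  moreover have "\<exists>j\<in>{1..m}. reaches u (w j) \<and> reaches (w j) u" if "u \<in> verts Q" for u
  proof -
    have "R `` {u} \<in> D ` {1..m}" using that assms(4) comp by (simp add: bij_betw_def quotientI)
    then obtain j where j: "j \<in> {1..m}" "R `` {u} = D j" by auto
    then have "w j \<in> R `` {u}" using D(2) by simp
    then show ?thesis using j(1) by (auto simp: R_def)
  qed
  moreover have "i = j" if "i \<in> {1..m}" "j \<in> {1..m}" "reaches (w i) (w j)" "reaches (w j) (w i)" for i j
  proof -
    have "(w i, w j) \<in> R" using that by (simp add: R_def)
    then have "D i = D j"
      using quotient_eqI[OF equiv D(1)[OF that(1)] D(1)[OF that(2)] D(2)[OF that(1)] D(2)[OF that(2)]] by simp
    then show ?thesis by (rule inj_onD[OF bij_betw_imp_inj_on[OF assms(4)] _ that(1,2)])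
  qed
  ultimately show ?thesis
    unfolding assms(5) by (intro basic_morita_representatives[OF _ wV]) auto
qed

end
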